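(* Let $0<\rho<1$ and suppose $n/N\to\rho$ as $n,m\to\infty$, where $N=n+m$. Let $(k^{(p)})_{p\ge1}$ be a sequence of kernels ($k=k^{(p)}$ on $\mathbb{R}^p$) with $\mathbb{E}[k^4(Z_1,Z_2)]<\infty$ for each $p$. Assume the null hypothesis $X=^dY$ (so that $X=^dY=^dZ$) for each $p$. If for some constant $0<\tau\le1$, $$\frac{\mathbb{E}\big[|\tilde k(Z_1,Z_2)|^{2+2\tau}\big]}{N^{\tau}\,(\mathcal{V}_k^2(Z))^{1+\tau}}\to0\qquad\text{and}\qquad \frac{\big(\mathbb{E}[g^k(Z_1,Z_2,Z_3,Z_4)]\big)^{(1+\tau)/2}}{(\mathcal{V}_k^2(Z))^{1+\tau}}\to0$$ as $N,p\to\infty$, then $T_{n,m,p}^k$ converges in distribution to $\mathcal{N}(0,1)$.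
   Context: Kernel: a kernel on $\mathbb{R}^p$ is a symmetric function $k:\mathbb{R}^p\times\mathbb{R}^p\to\mathbb{R}$ satisfying either (a) $k\ge0$, $k(x,y)=0$ iff $x=y$, and for all Borel probability measures $P\ne Q$ with $\int k(z,z_0)\,dP(z)<\infty$ and $\int k(z,z_0)\,dQ(z)<\infty$ for some $z_0$, one has $\int k\,d([P-Q]\times[P-Q])<0$; or (b) $-k$ is the reproducing kernel of an RKHS on $\mathbb{R}^p$ and is characteristic (the mean embedding map on Borel probability measures is injective). It is assumed that $k(x,x)=a_0^k$ is a finite constant not depending on $x$. Sampling: for each $p$, $X,Y$ are random vectors in $\mathbb{R}^p$; $X_1,\dots,X_n$ are i.i.d. copies of $X$, $Y_1,\dots,Y_m$ are i.i.d. copies of $Y$, the two samples are independent. $Z$ is the mixture equal to $X$ with probability $\rho$ and to $Y$ with probability $1-\rho$; $Z_1,Z_2,\dots$ are i.i.d. copies of $Z$. Notation: $\tilde k(Z_1,Z_2)=k(Z_1,Z_2)-\mathbb{E}[k(Z_1,Z_2)]$; $\mathcal{V}_k^2(Z)=\mathbb{E}[k^2(Z_1,Z_2)]-2\mathbb{E}[k(Z_1,Z_2)k(Z_1,Z_3)]+(\mathbb{E}[k(Z_1,Z_2)])^2$; $d^k(z_1,z_2)=k(z_1,z_2)-\mathbb{E}[k(Z,z_2)]-\mathbb{E}[k(z_1,Z)]+\mathbb{E}[k(Z_1,Z_2)]$; $g^k(z_1,z_2,z_3,z_4)=d^k(z_1,z_2)d^k(z_1,z_3)d^k(z_2,z_4)d^k(z_3,z_4)$.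 Test statistic: $\mathcal{E}_{n,m}^k(X,Y)=\frac{2}{nm}\sum_{i=1}^n\sum_{j=1}^m k(X_i,Y_j)-\binom n2^{-1}\sum_{1\le i<j\le n}k(X_i,X_j)-\binom m2^{-1}\sum_{1\le i<j\le m}k(Y_i,Y_j)$; $c_{n,m}=\frac{2}{n(n-1)}+\frac{4}{nm}+\frac{2}{m(m-1)}$. Let $W_1,\dots,W_N$ be the pooled sample ($W_s=X_s$ for $s\le n$, $W_s=Y_{s-n}$ for $s>n$), $a_{s,t}=k(W_s,W_t)$ for $1\le s,t\le N$, $\tilde a_{\cdot t}=\frac{1}{N-2}\sum_{i=1}^N a_{i,t}$, $\tilde a_{s\cdot}=\frac1{N-2}\sum_{j=1}^Na_{s,j}$, $\tilde a_{\cdot\cdot}=\frac{1}{(N-1)(N-2)}\sum_{i,j=1}^Na_{i,j}$, $A^*_{s,t}=a_{s,t}-\tilde a_{\cdot t}-\tilde a_{s\cdot}+\tilde a_{\cdot\cdot}$, and $\mathcal{V}_{n,m}^{k*}(X,Y)=\frac{1}{N(N-3)}\sum_{s\ne t}(A^*_{s,t})^2-\frac{(a_0^k)^2}{(N-1)(N-3)}$. Finally $T_{n,m,p}^k=\mathcal{E}_{n,m}^k(X,Y)\big/\sqrt{c_{n,m}\mathcal{V}_{n,m}^{k*}(X,Y)}$. *)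

theory Defs
  imports "HOL-Probability.Probability"
begin

text \<open>The dimension \<open>p\<close> tends to infinity, so vectors in \<open>\<real>\<^sup>p\<close> are functions on
  \<open>{..<p}\<close> (\<open>undefined\<close> elsewhere). As \<open>\<real>\<close> is second countable, the product sigma-algebra
  is the Borel sigma-algebra of \<open>\<real>\<^sup>p\<close>.\<close>

definition Rvec :: "nat \<Rightarrow> (nat \<Rightarrow> real) measure" where
  "Rvec p = (\<Pi>\<^sub>M i\<in>{..<p}. borel)"

definition prob_measures :: "'x measure \<Rightarrow> 'x measure set" where
  "prob_measures R = {P. prob_space P \<and> sets P = sets R}"


section \<open>Kernels\<close>

text \<open>The integral of \<open>k\<close> against the product of the signed measure \<open>P - Q\<close> with itself,
  expanded over the four product measures.\<close>

definition diff_energy :: "('x \<Rightarrow> 'x \<Rightarrow> real) \<Rightarrow> 'x measure \<Rightarrow> 'x measure \<Rightarrow> real" where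
  "diff_energy k P Q =
     (\<integral>z. k (fst z) (snd z) \<partial>(P \<Otimes>\<^sub>M P)) - (\<integral>z. k (fst z) (snd z) \<partial>(P \<Otimes>\<^sub>M Q))
   - (\<integral>z. k (fst z) (snd z) \<partial>(Q \<Otimes>\<^sub>M P)) + (\<integral>z. k (fst z) (snd z) \<partial>(Q \<Otimes>\<^sub>M Q))"

text \<open>Since \<open>k \<ge> 0\<close>, integrability of \<open>k(\<cdot>, z0)\<close> says that its integral is finite.\<close>

definition strong_negative_type :: "'x measure \<Rightarrow> ('x \<Rightarrow> 'x \<Rightarrow> real) \<Rightarrow> bool" where
  "strong_negative_type R k \<longleftrightarrow>
     (\<forall>x\<in>space R. \<forall>y\<in>space R. 0 \<le> k x y \<and> (k x y = 0 \<longleftrightarrow> x = y)) \<and>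
     (\<forall>P\<in>prob_measures R. \<forall>Q\<in>prob_measures R. P \<noteq> Q \<longrightarrow>
        (\<exists>z0\<in>space R. integrable P (\<lambda>z. k z z0) \<and> integrable Q (\<lambda>z. k z z0)) \<longrightarrow>
        diff_energy k P Q < 0)"

text \<open>\<open>H\<close> is a Hilbert space of real functions on \<open>S\<close> with inner product \<open>ip\<close>; its elements
  are normalised to vanish outside \<open>S\<close>, so that equality of elements is equality on \<open>S\<close>.\<close>

definition hilbert_function_space ::
  "'x set \<Rightarrow> ('x \<Rightarrow> real) set \<Rightarrow> (('x \<Rightarrow> real) \<Rightarrow> ('x \<Rightarrow> real) \<Rightarrow> real) \<Rightarrow> bool" where
  "hilbert_function_space S H ip \<longleftrightarrow>
     (\<forall>f\<in>H. \<forall>x. x \<notin> S \<longrightarrow> f x = 0) \<and>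
     (\<lambda>x. 0) \<in> H \<and>
     (\<forall>f\<in>H. \<forall>g\<in>H. (\<lambda>x. f x + g x) \<in> H) \<and>
     (\<forall>c. \<forall>f\<in>H. (\<lambda>x. c * f x) \<in> H) \<and>
     (\<forall>f\<in>H. \<forall>g\<in>H. ip f g = ip g f) \<and>
     (\<forall>f\<in>H. \<forall>g\<in>H. \<forall>h\<in>H. ip (\<lambda>x. f x + g x) h = ip f h + ip g h) \<and>
     (\<forall>c. \<forall>f\<in>H. \<forall>g\<in>H. ip (\<lambda>x. c * f x) g = c * ip f g) \<and>
     (\<forall>f\<in>H. 0 \<le> ip f f \<and> (ip f f = 0 \<longrightarrow> f = (\<lambda>x. 0))) \<and>
     Metric_space.mcomplete H (\<lambda>f g. sqrt (ip (\<lambda>x. f x - g x) (\<lambda>x. f x - g x)))"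

definition rkhs ::
  "'x set \<Rightarrow> ('x \<Rightarrow> 'x \<Rightarrow> real) \<Rightarrow> ('x \<Rightarrow> real) set \<Rightarrow>
   (('x \<Rightarrow> real) \<Rightarrow> ('x \<Rightarrow> real) \<Rightarrow> real) \<Rightarrow> bool" where
  "rkhs S K H ip \<longleftrightarrow>
     hilbert_function_space S H ip \<and>
     (\<forall>x\<in>S. let Kx = (\<lambda>y. if y \<in> S then K x y else 0) in
        Kx \<in> H \<and> (\<forall>f\<in>H. ip f Kx = f x))"

text \<open>The mean embedding of \<open>P\<close> is the (weak) integral of the sections \<open>K(x, \<cdot>)\<close> with respect
  to \<open>P\<close>. For measurable kernels with constant diagonal, the only case of interest here, it
  exists for every probability measure.\<close>

definition mean_embedding ::
  "('x \<Rightarrow> real) set \<Rightarrow> (('x \<Rightarrow> real) \<Rightarrow> ('x \<Rightarrow> real) \<Rightarrow> real) \<Rightarrow> 'x measure \<Rightarrow> ('x \<Rightarrow> real)" where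
  "mean_embedding H ip P = (THE u. u \<in> H \<and> (\<forall>f\<in>H. ip f u = (\<integral>x. f x \<partial>P)))"

definition characteristic_reproducing :: "'x measure \<Rightarrow> ('x \<Rightarrow> 'x \<Rightarrow> real) \<Rightarrow> bool" where
  "characteristic_reproducing R K \<longleftrightarrow>
     (\<exists>H ip. rkhs (space R) K H ip \<and> inj_on (mean_embedding H ip) (prob_measures R))"

definition is_kernel :: "'x measure \<Rightarrow> ('x \<Rightarrow> 'x \<Rightarrow> real) \<Rightarrow> bool" where
  "is_kernel R k \<longleftrightarrow>
     (\<lambda>z. k (fst z) (snd z)) \<in> borel_measurable (R \<Otimes>\<^sub>M R) \<and>
     (\<forall>x\<in>space R. \<forall>y\<in>space R. k x y = k y x) \<and>
     (strong_negative_type R k \<or> characteristic_reproducing R (\<lambda>x y. - k x y))"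


section \<open>Sampling\<close>

definition two_sample ::
  "'w measure \<Rightarrow> 'x measure \<Rightarrow> ('w \<Rightarrow> 'x) \<Rightarrow> ('w \<Rightarrow> 'x) \<Rightarrow>
   (nat \<Rightarrow> 'w \<Rightarrow> 'x) \<Rightarrow> (nat \<Rightarrow> 'w \<Rightarrow> 'x) \<Rightarrow> bool" where
  "two_sample M R X Y Xs Ys \<longleftrightarrow>
     prob_space M \<and> X \<in> M \<rightarrow>\<^sub>M R \<and> Y \<in> M \<rightarrow>\<^sub>M R \<and>
     prob_space.indep_vars M (\<lambda>_. R) (case_sum Xs Ys) ({1..} <+> {1..}) \<and>
     (\<forall>i\<ge>1. distr M R (Xs i) = distr M R X) \<and>
     (\<forall>j\<ge>1. distr M R (Ys j) = distr M R Y)"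

text \<open>The law of the mixture of \<open>P\<close> (with probability \<open>\<rho>\<close>) and \<open>Q\<close>.\<close>

definition mixture :: "real \<Rightarrow> 'x measure \<Rightarrow> 'x measure \<Rightarrow> 'x measure" where
  "mixture \<rho> P Q = measure_pmf (bernoulli_pmf \<rho>) \<bind> (\<lambda>b. if b then P else Q)"

text \<open>The joint law of \<open>Z 1, Z 2, \<dots>\<close>, i.i.d. with law \<open>L\<close>.\<close>

definition copies :: "'x measure \<Rightarrow> (nat \<Rightarrow> 'x) measure" where
  "copies L = (\<Pi>\<^sub>M i\<in>{1..}. L)"


section \<open>Population quantities\<close>

text \<open>Throughout, \<open>L\<close> is the law of \<open>Z\<close>.\<close>

definition k_mean :: "('x \<Rightarrow> 'x \<Rightarrow> real) \<Rightarrow> 'x measure \<Rightarrow> real" where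
  "k_mean k L = (\<integral>Z. k (Z 1) (Z 2) \<partial>copies L)"

definition k_tilde :: "('x \<Rightarrow> 'x \<Rightarrow> real) \<Rightarrow> 'x measure \<Rightarrow> 'x \<Rightarrow> 'x \<Rightarrow> real" where
  "k_tilde k L z1 z2 = k z1 z2 - k_mean k L"

definition k_var :: "('x \<Rightarrow> 'x \<Rightarrow> real) \<Rightarrow> 'x measure \<Rightarrow> real" where
  "k_var k L =
     (\<integral>Z. (k (Z 1) (Z 2))\<^sup>2 \<partial>copies L)
     - 2 * (\<integral>Z. k (Z 1) (Z 2) * k (Z 1) (Z 3) \<partial>copies L) + (k_mean k L)\<^sup>2"

definition d_fun :: "('x \<Rightarrow> 'x \<Rightarrow> real) \<Rightarrow> 'x measure \<Rightarrow> 'x \<Rightarrow> 'x \<Rightarrow> real" where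
  "d_fun k L z1 z2 = k z1 z2 - (\<integral>z. k z z2 \<partial>L) - (\<integral>z. k z1 z \<partial>L) + k_mean k L"

definition g_fun :: "('x \<Rightarrow> 'x \<Rightarrow> real) \<Rightarrow> 'x measure \<Rightarrow> 'x \<Rightarrow> 'x \<Rightarrow> 'x \<Rightarrow> 'x \<Rightarrow> real" where
  "g_fun k L z1 z2 z3 z4 = d_fun k L z1 z2 * d_fun k L z1 z3 * d_fun k L z2 z4 * d_fun k L z3 z4"


section \<open>The test statistic\<close>

definition energy_stat ::
  "('x \<Rightarrow> 'x \<Rightarrow> real) \<Rightarrow> nat \<Rightarrow> nat \<Rightarrow> (nat \<Rightarrow> 'x) \<Rightarrow> (nat \<Rightarrow> 'x) \<Rightarrow> real" where
  "energy_stat k n m x y =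
     2 / (real n * real m) * (\<Sum>i=1..n. \<Sum>j=1..m. k (x i) (y j))
     - 1 / real (n choose 2) * (\<Sum>i=1..n. \<Sum>j\<in>{i<..n}. k (x i) (x j))
     - 1 / real (m choose 2) * (\<Sum>i=1..m. \<Sum>j\<in>{i<..m}. k (y i) (y j))"

definition c_coeff :: "nat \<Rightarrow> nat \<Rightarrow> real" where
  "c_coeff n m = 2 / (real n * (real n - 1)) + 4 / (real n * real m) + 2 / (real m * (real m - 1))"

definition pooled :: "nat \<Rightarrow> (nat \<Rightarrow> 'x) \<Rightarrow> (nat \<Rightarrow> 'x) \<Rightarrow> nat \<Rightarrow> 'x" where
  "pooled n x y s = (if s \<le> n then x s else y (s - n))"

definition A_star :: "nat \<Rightarrow> (nat \<Rightarrow> nat \<Rightarrow> real) \<Rightarrow> nat \<Rightarrow> nat \<Rightarrow> real" where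
  "A_star N a s t =
     a s t - 1 / (real N - 2) * (\<Sum>i=1..N. a i t) - 1 / (real N - 2) * (\<Sum>j=1..N. a s j)
     + 1 / ((real N - 1) * (real N - 2)) * (\<Sum>i=1..N. \<Sum>j=1..N. a i j)"

text \<open>\<open>a0\<close> is the common value of \<open>k\<close> on the diagonal.\<close>

definition V_star ::
  "('x \<Rightarrow> 'x \<Rightarrow> real) \<Rightarrow> real \<Rightarrow> nat \<Rightarrow> nat \<Rightarrow> (nat \<Rightarrow> 'x) \<Rightarrow> (nat \<Rightarrow> 'x) \<Rightarrow> real" where
  "V_star k a0 n m x y =
     (let N = n + m; W = pooled n x y; A = A_star N (\<lambda>s t. k (W s) (W t)) in
      1 / (real N * (real N - 3)) * (\<Sum>s=1..N. \<Sum>t\<in>{1..N} - {s}. (A s t)\<^sup>2)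
      - a0\<^sup>2 / ((real N - 1) * (real N - 3)))"

text \<open>When \<open>V_star\<close> vanishes the quotient is undefined in the usual sense; here it is \<open>0\<close>.\<close>

definition T_stat ::
  "('x \<Rightarrow> 'x \<Rightarrow> real) \<Rightarrow> real \<Rightarrow> nat \<Rightarrow> nat \<Rightarrow> (nat \<Rightarrow> 'x) \<Rightarrow> (nat \<Rightarrow> 'x) \<Rightarrow> real" where
  "T_stat k a0 n m x y = energy_stat k n m x y / sqrt (c_coeff n m * V_star k a0 n m x y)"

end

theory Submission
  imports Defs
begin

text \<open>Why the theorem holds. Under the null hypothesis the pooled sample consists of \<open>N = n + m\<close>
  independent observations with a common law \<open>L\<close>. The energy statistic is a sum
  \<open>\<Sum>\<^sub>s\<^sub><\<^sub>t c\<^sub>s\<^sub>t k(W\<^sub>s, W\<^sub>t)\<close> in which the weights of all pairs containing a given index add up to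
  zero. The off-diagonal part of \<open>A\<^sup>*\<close> is, up to a constant determined by the diagonal value of \<open>k\<close>,
  the projection of the off-diagonal part of the matrix \<open>k(W\<^sub>s, W\<^sub>t)\<close> to the matrices with zero row sums.
  So neither changes when a function of the form \<open>u(x) + u(y)\<close> is subtracted from \<open>k\<close> off the diagonal,
  and \<open>k\<close> may be replaced there by its double centering, which integrates to zero in each argument.
  Dividing it by the square root of its second moment gives a degenerate kernel \<open>h\<close> with \<open>E h\<^sup>2 = 1\<close>, and the statistic becomes \<open>S / sqrt R\<close> with
  \<open>S = \<Sum>\<^sub>s\<^sub><\<^sub>t b\<^sub>s\<^sub>t h(W\<^sub>s, W\<^sub>t)\<close>, \<open>\<Sum> b\<^sub>s\<^sub>t\<^sup>2 = 1\<close>, \<open>\<bar>b\<^sub>s\<^sub>t\<bar> \<le> K / N\<close>, and a quadratic expression \<open>R\<close> in the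
  values of \<open>h\<close> (\<open>T_stat_eq\<close>).

  The row sums \<open>\<xi>\<^sub>t = \<Sum>\<^sub>s\<^sub><\<^sub>t b\<^sub>s\<^sub>t h(W\<^sub>s, W\<^sub>t)\<close> are martingale differences. For martingale differences
  on a product space with conditional variances \<open>v\<^sub>t\<close>, an explicit inequality compares the characteristic
  function of the sum with that of the normal law (\<open>martingale_char_bound\<close>),
  in terms of \<open>E \<bar>\<Sum> v\<^sub>t - 1\<bar>\<close> and of a Lindeberg sum \<open>\<Sum> E \<chi>(\<xi>\<^sub>t\<^sup>2)\<close>. The
  function \<open>\<chi>(x) = x\<^sup>2 / (1 + x)\<close> is comparable with \<open>x min(x, 1)\<close> but convex and rational, and
  \<open>\<chi>(x\<^sup>2) \<le> \<bar>x\<bar>\<close> to the power \<open>2 + 2\<tau>\<close> for every \<open>\<tau>\<close> between \<open>0\<close> and \<open>1\<close>. So one number,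
  \<open>\<Lambda> = N E \<chi>(h\<^sup>2 / N)\<close>, carries the whole moment condition, whatever \<open>\<tau>\<close> is
  (\<open>lindeberg_le_lyapunov_ratio\<close>). Everything else is bounded by \<open>\<Lambda>\<close>, by \<open>1 / N\<close> and by
  \<open>\<gamma> = E G\<^sup>2\<close>, where \<open>G(x, y) = E h(x, Z) h(y, Z)\<close>; by Fubini, \<open>\<gamma>\<close> is the quotient of \<open>E g\<close> by the
  squared variance, that is, the second condition (\<open>g_mean_eq\<close>).

  The Lindeberg sum is at most a multiple of \<open>\<Lambda>\<close> (\<open>lindeberg_sum_le\<close>): each \<open>\<xi>\<^sub>t\<close> is built up one term
  at a time and \<open>\<chi>(x\<^sup>2)\<close> is expanded to second order. The sum of the conditional variances is a
  weighted sum of the values \<open>G(W\<^sub>r, W\<^sub>s)\<close>; its off-diagonal part is again a sum of a degenerate kernel, so it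
  is small in mean square by \<open>\<gamma>\<close>, and its diagonal part, as well as \<open>R\<close>, obeys a law of large numbers
  for weighted averages over pairs (\<open>pair_average_law_of_large_numbers\<close>), proved by truncation at
  height \<open>N\<close> with an error governed by \<open>\<Lambda>\<close>. Finally, division by \<open>sqrt R\<close> is harmless as \<open>R\<close> tends
  to \<open>1\<close> in mean, and Levy's continuity theorem turns convergence of characteristic functions into
  convergence in distribution.

  Conditional expectations never appear as such. On a product measure, averaging over a fresh
  value of coordinate \<open>i\<close> is the conditional expectation given the other coordinates, and the
  identities of the first section do all conditioning.\<close>

section \<open>Resampling one coordinate of a product measure\<close>

locale law = prob_space L for L :: "'x measure"
begin

abbreviation sample :: "nat set \<Rightarrow> (nat \<Rightarrow> 'x) measure" where
  "sample I \<equiv> PiM I (\<lambda>_. L)"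

lemma prob_space_sample: "prob_space (sample I)"
  by (rule prob_space_PiM) (rule prob_space_axioms)

lemma measurable_resample [measurable]:
  assumes "i \<in> I"
  shows "(\<lambda>z. (fst z)(i := snd z)) \<in> sample I \<Otimes>\<^sub>M L \<rightarrow>\<^sub>M sample I"
proof -
  have "insert i I = I" using assms by auto
  then show ?thesis
    using measurable_add_dim[of i I "\<lambda>_. L"] by (simp add: case_prod_unfold)
qed

lemma space_resample:
  assumes "i \<in> I" "w \<in> space (sample I)" "y \<in> space L"
  shows "w(i := y) \<in> space (sample I)"
  using assms by (auto simp: space_PiM PiE_iff extensional_def)

lemma space_coordinate:
  assumes "i \<in> I" "w \<in> space (sample I)"
  shows "w i \<in> space L"
  using assms by (auto simp: space_PiM PiE_iff)

text \<open>A vector with independent coordinates keeps its law when one coordinate is replaced by an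
  independent copy.\<close>

lemma distr_resample:
  assumes i: "i \<in> I"
  shows "distr (sample I \<Otimes>\<^sub>M L) (sample I) (\<lambda>z. (fst z)(i := snd z)) = sample I"
proof -
  let ?J = "I - {i}"
  have ins: "insert i ?J = I" using i by auto
  interpret S: prob_space "sample I" by (rule prob_space_sample)
  interpret SJ: prob_space "sample ?J" by (rule prob_space_sample)
  interpret P: pair_prob_space "sample I" L ..
  interpret Q: pair_prob_space L "sample ?J" ..
  have r [measurable]: "(\<lambda>w. restrict w ?J) \<in> sample I \<rightarrow>\<^sub>M sample ?J"
    by (rule measurable_restrict_subset) auto
  have proj: "distr (sample I) (sample ?J) (\<lambda>w. restrict w ?J) = sample ?J"
    using distr_PiM_reindex[of I "\<lambda>_. L" "\<lambda>x. x" ?J] prob_space_axioms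
    by (auto simp: restrict_def cong: if_cong)
  have u [measurable]: "(\<lambda>(x, X). X(i := x)) \<in> L \<Otimes>\<^sub>M sample ?J \<rightarrow>\<^sub>M sample I"
    unfolding case_prod_unfold
    by (rule measurable_fun_upd[where J = ?J]) (use i in auto)
  have "sample I = distr (L \<Otimes>\<^sub>M sample ?J) (sample I) (\<lambda>(x, X). X(i := x))"
    using distr_pair_PiM_eq_PiM[of ?J "\<lambda>_. L" i] prob_space_axioms ins by simp
  also have "L \<Otimes>\<^sub>M sample ?J = distr L L (\<lambda>x. x) \<Otimes>\<^sub>M distr (sample I) (sample ?J) (\<lambda>w. restrict w ?J)"
    using proj by (simp add: distr_id)
  also have "\<dots> = distr (L \<Otimes>\<^sub>M sample I) (L \<Otimes>\<^sub>M sample ?J) (\<lambda>(x, w). (x, restrict w ?J))"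
    by (rule pair_measure_distr) (auto simp: proj SJ.sigma_finite_measure_axioms)
  also have "distr \<dots> (sample I) (\<lambda>(x, X). X(i := x))
      = distr (L \<Otimes>\<^sub>M sample I) (sample I) (\<lambda>z. (restrict (snd z) ?J)(i := fst z))"
    by (subst distr_distr) (auto simp: comp_def case_prod_unfold)
  also have "\<dots> = distr (L \<Otimes>\<^sub>M sample I) (sample I) (\<lambda>z. (snd z)(i := fst z))"
    by (rule distr_cong)
       (auto simp: space_pair_measure space_PiM PiE_iff extensional_def restrict_def fun_eq_iff)
  also have "L \<Otimes>\<^sub>M sample I = distr (sample I \<Otimes>\<^sub>M L) (L \<Otimes>\<^sub>M sample I) (\<lambda>(x, y). (y, x))"
    by (rule pair_sigma_finite.distr_pair_swap)
       (simp add: pair_sigma_finite_def sigma_finite_measure_axioms S.sigma_finite_measure_axioms)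
  also have "distr \<dots> (sample I) (\<lambda>z. (snd z)(i := fst z))
      = distr (sample I \<Otimes>\<^sub>M L) (sample I) (\<lambda>z. (fst z)(i := snd z))"
  proof (subst distr_distr)
    show "(\<lambda>z. (snd z)(i := fst z)) \<in> L \<Otimes>\<^sub>M sample I \<rightarrow>\<^sub>M sample I"
      using measurable_compose[OF measurable_pair_swap' measurable_resample[OF i]]
      by (simp add: case_prod_unfold)
  qed (auto simp: comp_def case_prod_unfold)
  finally show ?thesis by simp
qed

lemma
  fixes f :: "(nat \<Rightarrow> 'x) \<Rightarrow> 'b::{banach, second_countable_topology}"
  assumes i: "i \<in> I" and f: "integrable (sample I) f"
  shows integral_resample: "(\<integral>w. f w \<partial>sample I) = (\<integral>w. (\<integral>y. f (w(i := y)) \<partial>L) \<partial>sample I)"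
    and integrable_resample: "integrable (sample I) (\<lambda>w. \<integral>y. f (w(i := y)) \<partial>L)"
    and AE_integrable_resample: "AE w in sample I. integrable L (\<lambda>y. f (w(i := y)))"
proof -
  interpret S: prob_space "sample I" by (rule prob_space_sample)
  interpret P: pair_prob_space "sample I" L ..
  have f': "integrable (distr (sample I \<Otimes>\<^sub>M L) (sample I) (\<lambda>z. (fst z)(i := snd z))) f"
    using f by (simp add: distr_resample[OF i])
  then have int: "integrable (sample I \<Otimes>\<^sub>M L) (\<lambda>z. f ((fst z)(i := snd z)))"
    by (rule integrable_distr[OF measurable_resample[OF i]])
  then have int': "integrable (sample I \<Otimes>\<^sub>M L) (\<lambda>(w, y). f (w(i := y)))"
    by (simp add: case_prod_unfold)
  show "integrable (sample I) (\<lambda>w. \<integral>y. f (w(i := y)) \<partial>L)"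
    by (rule P.integrable_fst[OF int'])
  show "AE w in sample I. integrable L (\<lambda>y. f (w(i := y)))"
    by (rule P.AE_integrable_fst[OF int'])
  have "(\<integral>w. f w \<partial>sample I) = (\<integral>w. f w \<partial>distr (sample I \<Otimes>\<^sub>M L) (sample I) (\<lambda>z. (fst z)(i := snd z)))"
    by (simp add: distr_resample[OF i])
  also have "\<dots> = (\<integral>z. f ((fst z)(i := snd z)) \<partial>(sample I \<Otimes>\<^sub>M L))"
    by (rule integral_distr[OF measurable_resample[OF i]]) (use f in auto)
  also have "\<dots> = (\<integral>w. (\<integral>y. f (w(i := y)) \<partial>L) \<partial>sample I)"
    using P.integral_fst[OF int'] by (simp add: case_prod_unfold)
  finally show "(\<integral>w. f w \<partial>sample I) = (\<integral>w. (\<integral>y. f (w(i := y)) \<partial>L) \<partial>sample I)" .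
qed

text \<open>A factor \<open>B\<close> that does not see coordinate \<open>i\<close> can be pulled out of the average over that
  coordinate.\<close>

lemma
  fixes f :: "(nat \<Rightarrow> 'x) \<Rightarrow> 'b::{real_normed_field, banach, second_countable_topology}"
  assumes i: "i \<in> I" and Bf: "integrable (sample I) (\<lambda>w. B w * f w)"
    and B: "\<And>w y. w \<in> space (sample I) \<Longrightarrow> y \<in> space L \<Longrightarrow> B (w(i := y)) = B w"
    and F: "\<And>w. w \<in> space (sample I) \<Longrightarrow> (\<integral>y. f (w(i := y)) \<partial>L) = F w"
  shows integral_integrate_out: "(\<integral>w. B w * f w \<partial>sample I) = (\<integral>w. B w * F w \<partial>sample I)"
    and integrable_integrate_out: "integrable (sample I) (\<lambda>w. B w * F w)"
proof -
  have *: "(\<integral>y. B (w(i := y)) * f (w(i := y)) \<partial>L) = B w * F w" if "w \<in> space (sample I)" for w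
  proof -
    have "(\<integral>y. B (w(i := y)) * f (w(i := y)) \<partial>L) = (\<integral>y. B w * f (w(i := y)) \<partial>L)"
      using B[OF that] by (intro Bochner_Integration.integral_cong) auto
    also have "\<dots> = B w * F w" using F[OF that] by simp
    finally show ?thesis .
  qed
  show "(\<integral>w. B w * f w \<partial>sample I) = (\<integral>w. B w * F w \<partial>sample I)"
    unfolding integral_resample[OF i Bf]
    using * by (intro Bochner_Integration.integral_cong) auto
  show "integrable (sample I) (\<lambda>w. B w * F w)"
    using integrable_resample[OF i Bf] * by (subst (asm) Bochner_Integration.integrable_cong) auto
qed

lemma distr_two_coordinates:
  assumes "i \<in> I" "j \<in> I" "i \<noteq> j"
  shows "distr (sample I) (L \<Otimes>\<^sub>M L) (\<lambda>w. (w i, w j)) = L \<Otimes>\<^sub>M L"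
proof -
  interpret S: prob_space "sample I" by (rule prob_space_sample)
  interpret P: pair_prob_space "sample I" L ..
  have m [measurable]: "(\<lambda>w. w i) \<in> sample I \<rightarrow>\<^sub>M L" "(\<lambda>w. w j) \<in> sample I \<rightarrow>\<^sub>M L"
    using assms by (auto intro: measurable_component_singleton)
  have "distr (sample I) (L \<Otimes>\<^sub>M L) (\<lambda>w. (w i, w j))
     = distr (distr (sample I \<Otimes>\<^sub>M L) (sample I) (\<lambda>z. (fst z)(j := snd z))) (L \<Otimes>\<^sub>M L) (\<lambda>w. (w i, w j))"
    using assms by (simp add: distr_resample)
  also have "\<dots> = distr (sample I \<Otimes>\<^sub>M L) (L \<Otimes>\<^sub>M L) (\<lambda>(w, y). (w i, y))"
    using assms by (subst distr_distr) (auto simp: comp_def case_prod_unfold)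
  also have "\<dots> = distr (sample I) L (\<lambda>w. w i) \<Otimes>\<^sub>M distr L L (\<lambda>x. x)"
    by (rule pair_measure_distr[symmetric]) (auto simp: distr_id sigma_finite_measure_axioms)
  also have "\<dots> = L \<Otimes>\<^sub>M L"
    using assms prob_space_axioms by (simp add: distr_id distr_PiM_component[of I "\<lambda>_. L" i])
  finally show ?thesis .
qed

lemma
  fixes f :: "'x \<times> 'x \<Rightarrow> 'b::{banach, second_countable_topology}"
  assumes ij: "i \<in> I" "j \<in> I" "i \<noteq> j" and f [measurable]: "f \<in> borel_measurable (L \<Otimes>\<^sub>M L)"
  shows integral_two_coordinates: "(\<integral>w. f (w i, w j) \<partial>sample I) = (\<integral>z. f z \<partial>(L \<Otimes>\<^sub>M L))"
    and integrable_two_coordinates: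
      "integrable (sample I) (\<lambda>w. f (w i, w j)) \<longleftrightarrow> integrable (L \<Otimes>\<^sub>M L) f"
proof -
  have m [measurable]: "(\<lambda>w. w i) \<in> sample I \<rightarrow>\<^sub>M L" "(\<lambda>w. w j) \<in> sample I \<rightarrow>\<^sub>M L"
    using assms by (auto intro: measurable_component_singleton)
  show "(\<integral>w. f (w i, w j) \<partial>sample I) = (\<integral>z. f z \<partial>(L \<Otimes>\<^sub>M L))"
    by (subst distr_two_coordinates[OF ij, symmetric], subst integral_distr) auto
  show "integrable (sample I) (\<lambda>w. f (w i, w j)) \<longleftrightarrow> integrable (L \<Otimes>\<^sub>M L) f"
    by (subst distr_two_coordinates[OF ij, symmetric], subst integrable_distr_eq) auto
qed

lemma
  fixes f :: "'x \<Rightarrow> 'b::{banach, second_countable_topology}"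
  assumes i: "i \<in> I" and f [measurable]: "f \<in> borel_measurable L"
  shows integral_one_coordinate: "(\<integral>w. f (w i) \<partial>sample I) = (\<integral>x. f x \<partial>L)"
    and integrable_one_coordinate: "integrable (sample I) (\<lambda>w. f (w i)) \<longleftrightarrow> integrable L f"
proof -
  have m [measurable]: "(\<lambda>w. w i) \<in> sample I \<rightarrow>\<^sub>M L"
    using assms by (auto intro: measurable_component_singleton)
  have d: "distr (sample I) L (\<lambda>w. w i) = L"
    using i prob_space_axioms by (intro distr_PiM_component[of I "\<lambda>_. L" i]) auto
  show "(\<integral>w. f (w i) \<partial>sample I) = (\<integral>x. f x \<partial>L)"
    by (subst (2) d[symmetric], subst integral_distr) auto
  show "integrable (sample I) (\<lambda>w. f (w i)) \<longleftrightarrow> integrable L f"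
    by (subst (2) d[symmetric], subst integrable_distr_eq) auto
qed

end

section \<open>A convex function that is quadratic near zero and linear at infinity\<close>

text \<open>For \<open>x \<ge> 0\<close> this lies between \<open>x min(x, 1) / 2\<close> and \<open>x min(x, 1)\<close>. Unlike
  \<open>x min(x, 1)\<close> it is convex, so that Jensen's inequality applies.\<close>

definition chi :: "real \<Rightarrow> real" where
  "chi x = x\<^sup>2 / (1 + x)"

lemma chi_eq: "0 \<le> x \<Longrightarrow> chi x = x - 1 + 1 / (1 + x)"
  by (simp add: chi_def field_simps power2_eq_square)

lemma measurable_chi [measurable]: "chi \<in> borel_measurable borel"
  unfolding chi_def by measurable

lemma chi_0 [simp]: "chi 0 = 0"
  by (simp add: chi_def)

lemma chi_nonneg: "0 \<le> x \<Longrightarrow> 0 \<le> chi x"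
  by (simp add: chi_def)

lemma chi_le_self: "0 \<le> x \<Longrightarrow> chi x \<le> x"
  by (simp add: chi_eq)

text \<open>The difference of the two sides is \<open>(x - a)\<^sup>2 / ((1 + a)\<^sup>2 (1 + x))\<close>.\<close>

lemma chi_tangent:
  assumes "0 \<le> a" "0 \<le> x"
  shows "chi a + (1 - 1 / (1 + a)\<^sup>2) * (x - a) \<le> chi x"
proof -
  have "chi x - chi a - (1 - 1 / (1 + a)\<^sup>2) * (x - a) = (x - a)\<^sup>2 / ((1 + a)\<^sup>2 * (1 + x))"
    using assms by (simp add: chi_eq divide_simps) (simp add: algebra_simps power2_eq_square)
  also have "\<dots> \<ge> 0" using assms by simp
  finally show ?thesis by linarith
qed

lemma chi_mono:
  assumes "0 \<le> x" "x \<le> y"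
  shows "chi x \<le> chi y"
proof -
  have "0 \<le> (1 - 1 / (1 + x)\<^sup>2) * (y - x)"
    using assms by (intro mult_nonneg_nonneg) (auto simp: divide_simps power2_eq_square algebra_simps)
  then show ?thesis using chi_tangent[of x y] assms by linarith
qed

lemma chi_scale_up:
  assumes "1 \<le> c" "0 \<le> x"
  shows "chi (c * x) \<le> c\<^sup>2 * chi x"
proof -
  have "(c * x)\<^sup>2 / (1 + c * x) \<le> (c * x)\<^sup>2 / (1 + x)"
    using assms mult_right_mono[of 1 c x] by (intro divide_left_mono mult_pos_pos) auto
  then show ?thesis by (simp add: chi_def power_mult_distrib)
qed

lemma chi_scale_down:
  assumes "0 \<le> c" "c \<le> 1" "0 \<le> x"
  shows "chi (c * x) \<le> c * chi x"
proof (cases "c = 0")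
  case False
  have "(c * x)\<^sup>2 / (1 + c * x) \<le> (c * x\<^sup>2) / (1 + x)"
  proof -
    have "(c * x)\<^sup>2 * (1 + x) \<le> (c * x\<^sup>2) * (1 + c * x)"
    proof -
      have "(c * x\<^sup>2) * (1 + c * x) - (c * x)\<^sup>2 * (1 + x) = c * x\<^sup>2 * (1 - c)"
        by (simp add: algebra_simps power2_eq_square)
      also have "\<dots> \<ge> 0" using assms by simp
      finally show ?thesis by linarith
    qed
    then show ?thesis using assms by (simp add: divide_simps add_pos_nonneg)
  qed
  then show ?thesis by (simp add: chi_def)
qed simp

text \<open>The square of a sum of three terms is at most nine times the largest square, and \<open>chi (9 * x)\<close> is
  at most \<open>81 * chi x\<close>.\<close>

lemma chi_square_add3: "chi ((a + b + c)\<^sup>2) \<le> 81 * (chi (a\<^sup>2) + chi (b\<^sup>2) + chi (c\<^sup>2))"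
proof -
  have *: "chi ((a + b + c)\<^sup>2) \<le> 81 * chi (m\<^sup>2)" if "\<bar>a\<bar> \<le> \<bar>m\<bar>" "\<bar>b\<bar> \<le> \<bar>m\<bar>" "\<bar>c\<bar> \<le> \<bar>m\<bar>" for m
  proof -
    have "\<bar>a + b + c\<bar> \<le> \<bar>3 * m\<bar>" using that by linarith
    then have "(a + b + c)\<^sup>2 \<le> 9 * m\<^sup>2" by (simp only: abs_le_square_iff power_mult_distrib) simp
    then have "chi ((a + b + c)\<^sup>2) \<le> chi (9 * m\<^sup>2)" by (intro chi_mono) auto
    also have "\<dots> \<le> 81 * chi (m\<^sup>2)" using chi_scale_up[of 9 "m\<^sup>2"] by simp
    finally show ?thesis .
  qed
  have nn: "0 \<le> chi (a\<^sup>2)" "0 \<le> chi (b\<^sup>2)" "0 \<le> chi (c\<^sup>2)" by (auto intro: chi_nonneg)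
  consider "\<bar>b\<bar> \<le> \<bar>a\<bar>" "\<bar>c\<bar> \<le> \<bar>a\<bar>" | "\<bar>a\<bar> \<le> \<bar>b\<bar>" "\<bar>c\<bar> \<le> \<bar>b\<bar>" | "\<bar>a\<bar> \<le> \<bar>c\<bar>" "\<bar>b\<bar> \<le> \<bar>c\<bar>"
    by linarith
  then show ?thesis
    using *[of a] *[of b] *[of c] nn by cases auto
qed

text \<open>Jensen's inequality, from the tangent of \<open>chi\<close> at the mean.\<close>

lemma (in prob_space) chi_expectation_le:
  assumes X: "integrable M X" and pos: "AE x in M. 0 \<le> X x"
  shows "chi (expectation X) \<le> expectation (\<lambda>x. chi (X x))"
    and "integrable M (\<lambda>x. chi (X x))"
proof -
  have [measurable]: "X \<in> borel_measurable M" using X by auto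
  show int: "integrable M (\<lambda>x. chi (X x))"
    by (rule Bochner_Integration.integrable_bound[OF X]) (use pos in \<open>auto simp: chi_nonneg chi_le_self\<close>)
  define a where "a = expectation X"
  have a: "0 \<le> a" unfolding a_def by (rule integral_nonneg_AE) (use pos in simp)
  have "expectation (\<lambda>x. chi a + (1 - 1 / (1 + a)\<^sup>2) * (X x - a)) \<le> expectation (\<lambda>x. chi (X x))"
    by (rule integral_mono_AE) (use X int pos a chi_tangent in auto)
  then show "chi (expectation X) \<le> expectation (\<lambda>x. chi (X x))"
    using X by (simp add: a_def prob_space)
qed

text \<open>For \<open>\<bar>x\<bar> \<le> 1\<close> the left side is at most \<open>x\<^sup>4\<close>, otherwise at most \<open>x\<^sup>2\<close>; the exponent on the right
  lies between the two.\<close>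

lemma chi_square_le_powr:
  assumes \<tau>: "0 < \<tau>" "\<tau> \<le> 1"
  shows "chi (x\<^sup>2) \<le> \<bar>x\<bar> powr (2 + 2 * \<tau>)"
proof (cases "x = 0")
  case False
  have sq: "x\<^sup>2 = \<bar>x\<bar> powr 2" and q: "(x\<^sup>2)\<^sup>2 = \<bar>x\<bar> powr 4"
    using False by (auto simp: powr_numeral)
  show ?thesis
  proof (cases "\<bar>x\<bar> \<le> 1")
    case True
    have "chi (x\<^sup>2) \<le> (x\<^sup>2)\<^sup>2"
      using divide_left_mono[of 1 "1 + x\<^sup>2" "(x\<^sup>2)\<^sup>2"] by (simp add: chi_def add_pos_nonneg)
    also have "\<dots> \<le> \<bar>x\<bar> powr (2 + 2 * \<tau>)"
      unfolding q using True False \<tau> by (intro powr_mono') auto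
    finally show ?thesis .
  next
    case False
    have "chi (x\<^sup>2) \<le> x\<^sup>2" by (intro chi_le_self) simp
    also have "\<dots> \<le> \<bar>x\<bar> powr (2 + 2 * \<tau>)"
      unfolding sq using False \<tau> by (intro powr_mono) auto
    finally show ?thesis .
  qed
qed simp

section \<open>A quantitative martingale central limit theorem\<close>

text \<open>The remainder is at most \<open>\<bar>x\<bar>\<^sup>3\<close>, which is used for \<open>\<bar>x\<bar> \<le> \<epsilon>\<close>, and at most \<open>x\<^sup>2\<close>, which for
  \<open>\<bar>x\<bar> > \<epsilon>\<close> is of the order of \<open>chi (x\<^sup>2)\<close>.\<close>

lemma iexp_quadratic_remainder:
  assumes \<epsilon>: "0 < \<epsilon>" "\<epsilon> \<le> 1"
  shows "cmod (iexp x - (1 + \<i> * x - x\<^sup>2 / 2)) \<le> \<epsilon> * x\<^sup>2 + 2 / \<epsilon>\<^sup>2 * chi (x\<^sup>2)"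
proof -
  have e: "(\<Sum>k\<le>2. (\<i> * complex_of_real x) ^ k / fact k) = 1 + \<i> * x - x\<^sup>2 / 2"
    by (simp add: numeral_2_eq_2 atMost_Suc power_mult_distrib)
  have r2: "cmod (iexp x - (1 + \<i> * x - x\<^sup>2 / 2)) \<le> x\<^sup>2"
    using iexp_approx2[of x 2] unfolding e by simp
  have r3: "cmod (iexp x - (1 + \<i> * x - x\<^sup>2 / 2)) \<le> \<bar>x\<bar> ^ 3"
  proof -
    have "cmod (iexp x - (1 + \<i> * x - x\<^sup>2 / 2)) \<le> \<bar>x\<bar> ^ Suc 2 / fact (Suc 2)"
      using iexp_approx1[of x 2] unfolding e .
    also have "\<dots> \<le> \<bar>x\<bar> ^ 3" by (simp add: numeral_3_eq_3[symmetric] fact_numeral)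
    finally show ?thesis .
  qed
  have c: "0 \<le> chi (x\<^sup>2)" by (simp add: chi_nonneg)
  show ?thesis
  proof (cases "\<bar>x\<bar> \<le> \<epsilon>")
    case True
    have "\<bar>x\<bar> ^ 3 = \<bar>x\<bar> * x\<^sup>2" by (simp add: power3_eq_cube power2_eq_square)
    also have "\<dots> \<le> \<epsilon> * x\<^sup>2" using True by (intro mult_right_mono) auto
    finally show ?thesis using r3 c \<epsilon> by (smt (verit) divide_nonneg_nonneg mult_nonneg_nonneg zero_le_power2)
  next
    case False
    have "\<epsilon>\<^sup>2 \<le> x\<^sup>2" using False \<epsilon> abs_le_square_iff[of \<epsilon> x] by simp
    moreover have "\<epsilon>\<^sup>2 \<le> 1" using \<epsilon> by (simp add: power_le_one)
    moreover have "\<epsilon>\<^sup>2 * x\<^sup>2 \<le> x\<^sup>2" using calculation by (simp add: mult_left_le_one_le)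
    ultimately have "\<epsilon>\<^sup>2 * (1 + x\<^sup>2) \<le> 2 * x\<^sup>2" by (simp add: algebra_simps)
    then have "x\<^sup>2 * (\<epsilon>\<^sup>2 * (1 + x\<^sup>2)) \<le> x\<^sup>2 * (2 * x\<^sup>2)" by (intro mult_left_mono) auto
    then have "x\<^sup>2 \<le> 2 / \<epsilon>\<^sup>2 * chi (x\<^sup>2)"
      using \<epsilon> by (simp add: chi_def field_simps add_pos_nonneg power2_eq_square)
    then show ?thesis using r2 \<epsilon> by (smt (verit) mult_nonneg_nonneg zero_le_power2)
  qed
qed

text \<open>The same case distinction, with the bounds \<open>y\<^sup>2\<close> and \<open>y\<close>.\<close>

lemma exp_linear_remainder:
  fixes y :: real
  assumes \<epsilon>: "0 < \<epsilon>" "\<epsilon> \<le> 1" and y: "0 \<le> y"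
  shows "\<bar>exp (- y) - (1 - y)\<bar> \<le> \<epsilon> * y + 2 / \<epsilon> * chi y"
proof -
  have lo: "0 \<le> exp (- y) - (1 - y)" using exp_ge_add_one_self[of "-y"] by simp
  have hi: "exp (- y) - (1 - y) \<le> y" using y by simp
  have sq: "exp (- y) - (1 - y) \<le> y\<^sup>2"
  proof -
    have "exp (- y) \<le> 1 / (1 + y)"
      using exp_ge_add_one_self[of y] y by (simp add: exp_minus inverse_eq_divide divide_simps add_pos_nonneg)
    also have "\<dots> \<le> 1 - y + y\<^sup>2"
      using y by (simp add: divide_simps) (simp add: algebra_simps power2_eq_square)
    finally show ?thesis by simp
  qed
  have c: "0 \<le> chi y" using y by (simp add: chi_nonneg)
  show ?thesis
  proof (cases "y \<le> \<epsilon>")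
    case True
    then have "y\<^sup>2 \<le> \<epsilon> * y" using y by (simp add: power2_eq_square mult_right_mono)
    then show ?thesis using lo sq c \<epsilon> by (smt (verit) divide_nonneg_nonneg mult_nonneg_nonneg)
  next
    case False
    have "\<epsilon> * (1 + y) \<le> 2 * y"
      using False \<epsilon> mult_left_le_one_le[OF y, of \<epsilon>] unfolding distrib_left by linarith
    then have "y * (\<epsilon> * (1 + y)) \<le> y * (2 * y)" using y by (rule mult_left_mono)
    then have "y \<le> 2 / \<epsilon> * chi y"
      using \<epsilon> y by (simp add: chi_def field_simps add_pos_nonneg power2_eq_square)
    then show ?thesis using lo hi \<epsilon> y by (smt (verit) mult_nonneg_nonneg)
  qed
qed

text \<open>With \<open>q = u\<^sup>2 / 2\<close> this is the factor that turns \<open>iexp (u * S)\<close>, for a partial sum \<open>S\<close> with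
  accumulated conditional variance \<open>x\<close>, into a quantity whose mean hardly changes from one step to
  the next. Capping at \<open>x = 1\<close> keeps it below \<open>1\<close> even when the conditional variances are
  unbounded, and so takes the place of a stopping time.\<close>

definition psi :: "real \<Rightarrow> real \<Rightarrow> real" where
  "psi q x = exp (- q * (1 - min x 1))"

lemma measurable_psi [measurable]: "psi q \<in> borel_measurable borel"
  unfolding psi_def by measurable

lemma psi_pos: "0 < psi q x"
  by (simp add: psi_def)

lemma psi_le_1: "0 \<le> q \<Longrightarrow> psi q x \<le> 1"
  by (simp add: psi_def)

lemma psi_ge: "0 \<le> q \<Longrightarrow> 1 - psi q x \<le> q * max (1 - x) 0"
  using exp_ge_add_one_self[of "- q * (1 - min x 1)"]
  by (auto simp: psi_def min_def max_def algebra_simps)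

text \<open>Below the cap, \<open>psi q a = psi q (a + s) * exp (- q * s)\<close>, and the error is that of a first-order
  expansion. The part \<open>\<delta>\<close> of the step that lies above the cap costs at most \<open>q * \<delta>\<close>; these costs
  telescope when the steps are added.\<close>

lemma psi_increment:
  assumes \<epsilon>: "0 < \<epsilon>" "\<epsilon> \<le> 1" and q: "0 \<le> q" and s: "0 \<le> s"
  shows "\<bar>psi q (a + s) * (1 - q * s) - psi q a\<bar>
    \<le> \<epsilon> * (q * s) + 2 / \<epsilon> * chi (q * s) + q * (max (a + s - 1) 0 - max (a - 1) 0)"
proof -
  define \<delta> where "\<delta> = max (a + s - 1) 0 - max (a - 1) 0"
  have \<delta>: "0 \<le> \<delta>" "\<delta> \<le> s" using s by (auto simp: \<delta>_def)
  have m: "min (a + s) 1 - min a 1 = s - \<delta>" by (auto simp: \<delta>_def)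
  have "psi q a = psi q (a + s) * exp (- (q * (s - \<delta>)))"
    unfolding psi_def m[symmetric] exp_add[symmetric] by (simp add: algebra_simps)
  then have "\<bar>psi q (a + s) * (1 - q * s) - psi q a\<bar> = psi q (a + s) * \<bar>(1 - q * s) - exp (- (q * (s - \<delta>)))\<bar>"
    using psi_pos[of q "a + s"] by (simp add: abs_mult right_diff_distrib[symmetric])
  also have "\<dots> \<le> \<bar>(1 - q * s) - exp (- (q * (s - \<delta>)))\<bar>"
    using psi_pos[of q "a + s"] psi_le_1[OF q, of "a + s"] by (intro mult_left_le_one_le) auto
  also have "\<dots> \<le> \<bar>exp (- (q * (s - \<delta>))) - (1 - q * (s - \<delta>))\<bar> + q * \<delta>"
    using mult_nonneg_nonneg[OF q \<delta>(1)] unfolding right_diff_distrib by linarith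
  also have "\<dots> \<le> \<epsilon> * (q * (s - \<delta>)) + 2 / \<epsilon> * chi (q * (s - \<delta>)) + q * \<delta>"
    using exp_linear_remainder[OF \<epsilon>, of "q * (s - \<delta>)"] q \<delta> by simp
  also have "\<dots> \<le> \<epsilon> * (q * s) + 2 / \<epsilon> * chi (q * s) + q * \<delta>"
    using q \<delta> \<epsilon> by (intro add_mono mult_left_mono chi_mono) auto
  finally show ?thesis by (simp add: \<delta>_def)
qed

context law
begin

text \<open>Interpolate between \<open>exp (- u\<^sup>2 / 2)\<close> and the characteristic function through
  \<open>H j = E (iexp (u * S j) * psi q (V j))\<close>, where \<open>S j\<close> and \<open>V j\<close> are the sums of the first \<open>j\<close>
  differences and of their conditional variances. As \<open>V (j + 1)\<close> is determined by the first \<open>j\<close>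
  coordinates, the first two terms of the expansion of the exponential at step \<open>j + 1\<close> can be averaged
  exactly, and only remainders are left. The last factor \<open>psi q (V N)\<close> differs from \<open>1\<close> by at most
  \<open>q * max (1 - V N) 0\<close>.\<close>

theorem martingale_char_bound:
  fixes \<xi> v :: "nat \<Rightarrow> (nat \<Rightarrow> 'x) \<Rightarrow> real" and N :: nat and u \<epsilon> :: real
  defines "\<Omega> \<equiv> sample {1..N}"
  assumes \<epsilon>: "0 < \<epsilon>" "\<epsilon> \<le> 1"
    and meas: "\<And>t. t \<in> {1..N} \<Longrightarrow> \<xi> t \<in> borel_measurable \<Omega>"
    and adapted: "\<And>t s w y. t \<in> {1..N} \<Longrightarrow> s \<in> {1..N} \<Longrightarrow> t < s \<Longrightarrow> w \<in> space \<Omega> \<Longrightarrow>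
      y \<in> space L \<Longrightarrow> \<xi> t (w(s := y)) = \<xi> t w"
    and sq: "\<And>t. t \<in> {1..N} \<Longrightarrow> integrable \<Omega> (\<lambda>w. (\<xi> t w)\<^sup>2)"
    and mean: "\<And>t w. t \<in> {1..N} \<Longrightarrow> w \<in> space \<Omega> \<Longrightarrow> (\<integral>y. \<xi> t (w(t := y)) \<partial>L) = 0"
    and var: "\<And>t w. t \<in> {1..N} \<Longrightarrow> w \<in> space \<Omega> \<Longrightarrow> (\<integral>y. (\<xi> t (w(t := y)))\<^sup>2 \<partial>L) = v t w"
  shows "cmod ((\<integral>w. iexp (u * (\<Sum>t=1..N. \<xi> t w)) \<partial>\<Omega>) - exp (- (u\<^sup>2 / 2)))
    \<le> u\<^sup>2 / 2 * (\<integral>w. \<bar>(\<Sum>t=1..N. v t w) - 1\<bar> \<partial>\<Omega>)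
      + 2 * \<epsilon> * u\<^sup>2 * (\<Sum>t=1..N. \<integral>w. (\<xi> t w)\<^sup>2 \<partial>\<Omega>)
      + 4 / \<epsilon>\<^sup>2 * (\<Sum>t=1..N. \<integral>w. chi ((u * \<xi> t w)\<^sup>2) \<partial>\<Omega>)"
proof -
  interpret \<Omega>: prob_space \<Omega> unfolding \<Omega>_def by (rule prob_space_sample)
  define q where "q = u\<^sup>2 / 2"
  have q: "0 \<le> q" by (simp add: q_def)
  define S where "S j w = (\<Sum>t=1..j. \<xi> t w)" for j w
  define V where "V j w = (\<Sum>t=1..j. v t w)" for j w

  have res: "w(t := y) \<in> space \<Omega>" if "t \<in> {1..N}" "w \<in> space \<Omega>" "y \<in> space L" for t w y
    using that space_resample[of t "{1..N}" w y] by (simp add: \<Omega>_def)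
  have v_int: "integrable \<Omega> (v t)" if t: "t \<in> {1..N}" for t
  proof -
    have "integrable \<Omega> (\<lambda>w. \<integral>y. (\<xi> t (w(t := y)))\<^sup>2 \<partial>L)"
      using integrable_resample[OF t sq[OF t, unfolded \<Omega>_def]] by (simp add: \<Omega>_def)
    then show ?thesis
      by (rule Bochner_Integration.integrable_cong[THEN iffD1, rotated 2]) (auto simp: var[OF t])
  qed
  have v_nn: "0 \<le> v t w" if "t \<in> {1..N}" "w \<in> space \<Omega>" for t w
    unfolding var[OF that, symmetric] by simp
  have v_mean: "(\<integral>w. v t w \<partial>\<Omega>) = (\<integral>w. (\<xi> t w)\<^sup>2 \<partial>\<Omega>)" if t: "t \<in> {1..N}" for t
    using integral_resample[OF t sq[OF t, unfolded \<Omega>_def]] var[OF t]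
    by (simp add: \<Omega>_def cong: Bochner_Integration.integral_cong)
  have \<xi>_int: "integrable \<Omega> (\<xi> t)" if t: "t \<in> {1..N}" for t
    by (rule \<Omega>.square_integrable_imp_integrable[OF meas[OF t] sq[OF t]])
  have v_inv: "v i (w(t := y)) = v i w"
    if "i \<in> {1..N}" "t \<in> {1..N}" "i \<le> t" "w \<in> space \<Omega>" "y \<in> space L" for i t w y
  proof -
    have "\<xi> i ((w(t := y))(i := z)) = \<xi> i (w(i := z))" if "z \<in> space L" for z
    proof (cases "i = t")
      case False
      then have "(w(t := y))(i := z) = (w(i := z))(t := y)" by (simp add: fun_upd_twist)
      then show ?thesis using adapted[of i t "w(i := z)" y] res[of i w z] that \<open>z \<in> space L\<close> False
        \<open>i \<in> _\<close> \<open>t \<in> _\<close> \<open>i \<le> t\<close> \<open>w \<in> _\<close> \<open>y \<in> _\<close> by simp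
    qed simp
    then show ?thesis
      using that res[of t w y]
      by (simp add: var[symmetric] cong: Bochner_Integration.integral_cong)
  qed
  have S_meas [measurable]: "S j \<in> borel_measurable \<Omega>" if "j \<le> N" for j
    unfolding S_def using that meas by (intro borel_measurable_sum) auto
  have V_int: "integrable \<Omega> (V j)" if "j \<le> N" for j
    unfolding V_def using that v_int by (intro Bochner_Integration.integrable_sum) auto
  have V_meas [measurable]: "V j \<in> borel_measurable \<Omega>" if "j \<le> N" for j
    using V_int[OF that] by auto
  have max_int: "integrable \<Omega> (\<lambda>w. max (V j w - 1) 0)" if "j \<le> N" for j
    using V_int[OF that] by (intro integrable_max) auto
  have chi_int: "integrable \<Omega> (\<lambda>w. chi (c * (\<xi> t w)\<^sup>2))" if "0 \<le> c" "t \<in> {1..N}" for t c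
    using sq[OF that(2)] that(1) by (intro \<Omega>.chi_expectation_le(2)) auto
  have chiv_int: "integrable \<Omega> (\<lambda>w. chi (q * v t w))" if "t \<in> {1..N}" for t
    using v_int[OF that] q v_nn[OF that] by (intro \<Omega>.chi_expectation_le(2) AE_I2) auto
  define H where "H j = (\<integral>w. iexp (u * S j w) * psi q (V j w) \<partial>\<Omega>)" for j

  have step: "cmod (H (Suc j) - H j)
      \<le> (\<integral>w. \<epsilon> * (u * \<xi> (Suc j) w)\<^sup>2 + 2 / \<epsilon>\<^sup>2 * chi ((u * \<xi> (Suc j) w)\<^sup>2) \<partial>\<Omega>)
       + (\<integral>w. \<epsilon> * (q * v (Suc j) w) + 2 / \<epsilon> * chi (q * v (Suc j) w) \<partial>\<Omega>)
       + q * ((\<integral>w. max (V (Suc j) w - 1) 0 \<partial>\<Omega>) - (\<integral>w. max (V j w - 1) 0 \<partial>\<Omega>))"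
    if j: "j < N" for j
  proof -
    define t where "t = Suc j"
    have t: "t \<in> {1..N}" and tN: "t \<le> N" and jN: "j \<le> N" using j by (auto simp: t_def)
    have [measurable]: "\<xi> t \<in> borel_measurable \<Omega>" "v t \<in> borel_measurable \<Omega>"
      "S j \<in> borel_measurable \<Omega>" "V j \<in> borel_measurable \<Omega>" "V t \<in> borel_measurable \<Omega>"
      using meas[OF t] v_int[OF t] S_meas[OF jN] V_meas[OF jN] V_meas[OF tN] by auto
    have St: "S t w = S j w + \<xi> t w" and Vt: "V t w = V j w + v t w" for w
      by (simp_all add: S_def V_def t_def)
    define A where "A w = iexp (u * S j w)" for w
    \<comment> \<open>The current exponential, damped by the variance that already includes step \<open>t\<close>.\<close>
    define B where "B w = A w * psi q (V t w)" for w
    have [measurable]: "A \<in> borel_measurable \<Omega>" "B \<in> borel_measurable \<Omega>"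
      unfolding B_def A_def by measurable
    have nA: "cmod (A w) = 1" for w by (simp add: A_def)
    have nB: "cmod (B w) \<le> 1" for w
      using psi_pos[of q "V t w"] psi_le_1[OF q, of "V t w"] by (simp add: B_def norm_mult nA)
    have B_inv: "B (w(t := y)) = B w" if "w \<in> space \<Omega>" "y \<in> space L" for w y
    proof -
      have "S j (w(t := y)) = S j w"
        unfolding S_def using that t jN by (intro sum.cong refl adapted) (auto simp: t_def)
      moreover have "V t (w(t := y)) = V t w"
        unfolding V_def using that t tN by (intro sum.cong refl v_inv) auto
      ultimately show ?thesis by (simp add: B_def A_def)
    qed
    have bd: "integrable \<Omega> (\<lambda>w. B w * complex_of_real (f w))" if "integrable \<Omega> f" for f
    proof (rule Bochner_Integration.integrable_bound[OF that])
      show "AE x in \<Omega>. cmod (B x * complex_of_real (f x)) \<le> norm (f x)"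
        using nB by (auto simp: norm_mult mult_left_le_one_le)
    qed (use that in auto)
    have B1: "(\<integral>w. B w * complex_of_real (\<xi> t w) \<partial>\<Omega>) = 0"
    proof -
      have "(\<integral>w. B w * complex_of_real (\<xi> t w) \<partial>\<Omega>) = (\<integral>w. B w * 0 \<partial>\<Omega>)"
        unfolding \<Omega>_def using bd[OF \<xi>_int[OF t]] B_inv mean[OF t]
        by (intro integral_integrate_out[OF t]) (auto simp: \<Omega>_def)
      then show ?thesis by simp
    qed
    have B2: "(\<integral>w. B w * complex_of_real ((\<xi> t w)\<^sup>2) \<partial>\<Omega>) = (\<integral>w. B w * complex_of_real (v t w) \<partial>\<Omega>)"
      unfolding \<Omega>_def using bd[OF sq[OF t]] B_inv var[OF t]
      by (intro integral_integrate_out[OF t]) (auto simp: \<Omega>_def simp del: of_real_power)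
    define R where "R w = iexp (u * \<xi> t w) - (1 + \<i> * complex_of_real (u * \<xi> t w) - (complex_of_real (u * \<xi> t w))\<^sup>2 / 2)" for w
    have R_le: "cmod (R w) \<le> \<epsilon> * (u * \<xi> t w)\<^sup>2 + 2 / \<epsilon>\<^sup>2 * chi ((u * \<xi> t w)\<^sup>2)" for w
      unfolding R_def using iexp_quadratic_remainder[OF \<epsilon>, of "u * \<xi> t w"] by simp
    have R_meas [measurable]: "R \<in> borel_measurable \<Omega>" unfolding R_def by measurable
    have bound_int: "integrable \<Omega> (\<lambda>w. \<epsilon> * (u * \<xi> t w)\<^sup>2 + 2 / \<epsilon>\<^sup>2 * chi ((u * \<xi> t w)\<^sup>2))"
      using sq[OF t] chi_int[of "u\<^sup>2" t] t by (simp add: power_mult_distrib)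
    have BR_int: "integrable \<Omega> (\<lambda>w. B w * R w)"
    proof (rule Bochner_Integration.integrable_bound[OF bound_int])
      show "AE x in \<Omega>. cmod (B x * R x) \<le> norm (\<epsilon> * (u * \<xi> t x)\<^sup>2 + 2 / \<epsilon>\<^sup>2 * chi ((u * \<xi> t x)\<^sup>2))"
      proof (rule AE_I2)
        fix x
        have "cmod (B x * R x) \<le> cmod (R x)" using nB[of x] by (simp add: norm_mult mult_left_le_one_le)
        also have "\<dots> \<le> norm (\<epsilon> * (u * \<xi> t x)\<^sup>2 + 2 / \<epsilon>\<^sup>2 * chi ((u * \<xi> t x)\<^sup>2))"
          using R_le[of x] by simp
        finally show "cmod (B x * R x) \<le> norm (\<epsilon> * (u * \<xi> t x)\<^sup>2 + 2 / \<epsilon>\<^sup>2 * chi ((u * \<xi> t x)\<^sup>2))" .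
      qed
    qed simp
    have B_int: "integrable \<Omega> B"
      by (rule \<Omega>.integrable_const_bound[of _ 1]) (use nB in auto)
    have Apsi_int: "integrable \<Omega> (\<lambda>w. A w * psi q (V j w))"
      by (rule \<Omega>.integrable_const_bound[of _ 1])
         (use psi_pos psi_le_1[OF q] in \<open>auto simp: norm_mult nA less_imp_le\<close>)
    have "H t = (\<integral>w. B w * R w + B w + (\<i> * u) * (B w * complex_of_real (\<xi> t w))
        - q * (B w * complex_of_real ((\<xi> t w)\<^sup>2)) \<partial>\<Omega>)"
      unfolding H_def
      by (intro Bochner_Integration.integral_cong refl)
         (simp add: B_def A_def R_def St q_def distrib_left exp_add algebra_simps power2_eq_square)
    also have "\<dots> = (\<integral>w. B w * R w \<partial>\<Omega>) + (\<integral>w. B w \<partial>\<Omega>) - q * (\<integral>w. B w * complex_of_real (v t w) \<partial>\<Omega>)"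
      using BR_int B_int bd[OF \<xi>_int[OF t]] bd[OF sq[OF t]] B1 B2 by (simp del: of_real_power)
    finally have Ht: "H t = (\<integral>w. B w * R w \<partial>\<Omega>) + (\<integral>w. B w \<partial>\<Omega>) - q * (\<integral>w. B w * complex_of_real (v t w) \<partial>\<Omega>)" .
    \<comment> \<open>What remains after averaging the linear and quadratic terms over coordinate \<open>t\<close>.\<close>
    define D where "D w = B w - q * (B w * complex_of_real (v t w)) - A w * psi q (V j w)" for w
    have D_eq: "D w = A w * complex_of_real (psi q (V j w + v t w) * (1 - q * v t w) - psi q (V j w))" for w
      by (simp add: D_def B_def Vt algebra_simps)
    have D_int: "integrable \<Omega> D"
      unfolding D_def using B_int bd[OF v_int[OF t]] Apsi_int by auto
    have diff: "H t - H j = (\<integral>w. B w * R w \<partial>\<Omega>) + (\<integral>w. D w \<partial>\<Omega>)"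
      unfolding Ht D_def using B_int bd[OF v_int[OF t]] Apsi_int by (simp add: H_def A_def)
    have "cmod (\<integral>w. B w * R w \<partial>\<Omega>) \<le> (\<integral>w. cmod (B w * R w) \<partial>\<Omega>)"
      by (rule integral_norm_bound)
    also have "\<dots> \<le> (\<integral>w. \<epsilon> * (u * \<xi> t w)\<^sup>2 + 2 / \<epsilon>\<^sup>2 * chi ((u * \<xi> t w)\<^sup>2) \<partial>\<Omega>)"
    proof (rule integral_mono[OF _ bound_int])
      fix w
      have "cmod (B w * R w) \<le> cmod (R w)" using nB[of w] by (simp add: norm_mult mult_left_le_one_le)
      then show "cmod (B w * R w) \<le> \<epsilon> * (u * \<xi> t w)\<^sup>2 + 2 / \<epsilon>\<^sup>2 * chi ((u * \<xi> t w)\<^sup>2)"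
        using R_le[of w] by linarith
    qed (use BR_int in auto)
    finally have 1: "cmod (\<integral>w. B w * R w \<partial>\<Omega>)
      \<le> (\<integral>w. \<epsilon> * (u * \<xi> t w)\<^sup>2 + 2 / \<epsilon>\<^sup>2 * chi ((u * \<xi> t w)\<^sup>2) \<partial>\<Omega>)" .
    have lin_int: "integrable \<Omega> (\<lambda>w. \<epsilon> * (q * v t w) + 2 / \<epsilon> * chi (q * v t w))"
      using v_int[OF t] chiv_int[OF t] by auto
    have "cmod (\<integral>w. D w \<partial>\<Omega>) \<le> (\<integral>w. cmod (D w) \<partial>\<Omega>)"
      by (rule integral_norm_bound)
    also have "\<dots> \<le> (\<integral>w. (\<epsilon> * (q * v t w) + 2 / \<epsilon> * chi (q * v t w))
        + q * (max (V t w - 1) 0 - max (V j w - 1) 0) \<partial>\<Omega>)"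
    proof (rule integral_mono)
      fix w assume w: "w \<in> space \<Omega>"
      show "cmod (D w) \<le> (\<epsilon> * (q * v t w) + 2 / \<epsilon> * chi (q * v t w)) + q * (max (V t w - 1) 0 - max (V j w - 1) 0)"
        using psi_increment[OF \<epsilon> q v_nn[OF t w], of "V j w"]
        by (simp only: D_eq norm_mult nA norm_of_real Vt mult_1_left)
    qed (use D_int lin_int max_int[OF tN] max_int[OF jN] in auto)
    also have "\<dots> = (\<integral>w. \<epsilon> * (q * v t w) + 2 / \<epsilon> * chi (q * v t w) \<partial>\<Omega>)
        + q * ((\<integral>w. max (V t w - 1) 0 \<partial>\<Omega>) - (\<integral>w. max (V j w - 1) 0 \<partial>\<Omega>))"
      using lin_int max_int[OF tN] max_int[OF jN] by (simp del: max.bounded_iff)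
    finally have 2: "cmod (\<integral>w. D w \<partial>\<Omega>) \<le> \<dots>" .
    show ?thesis
      using norm_triangle_ineq[of "\<integral>w. B w * R w \<partial>\<Omega>" "\<integral>w. D w \<partial>\<Omega>"] 1 2
      unfolding diff[symmetric] t_def[symmetric] by linarith
  qed

  have jensen: "(\<integral>w. chi (q * v t w) \<partial>\<Omega>) \<le> (\<integral>w. chi ((u * \<xi> t w)\<^sup>2) \<partial>\<Omega>)" if t: "t \<in> {1..N}" for t
  proof -
    have i2: "integrable \<Omega> (\<lambda>w. q * (\<xi> t w)\<^sup>2)" and ic: "integrable \<Omega> (\<lambda>w. chi (q * (\<xi> t w)\<^sup>2))"
      using sq[OF t] chi_int[OF q t] by auto
    have "(\<integral>w. chi (q * v t w) \<partial>\<Omega>) \<le> (\<integral>w. (\<integral>y. chi (q * (\<xi> t (w(t := y)))\<^sup>2) \<partial>L) \<partial>\<Omega>)"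
    proof (rule integral_mono_AE[OF chiv_int[OF t]])
      show "integrable \<Omega> (\<lambda>w. \<integral>y. chi (q * (\<xi> t (w(t := y)))\<^sup>2) \<partial>L)"
        using integrable_resample[OF t ic[unfolded \<Omega>_def]] by (simp add: \<Omega>_def)
      have "AE w in \<Omega>. integrable L (\<lambda>y. q * (\<xi> t (w(t := y)))\<^sup>2)"
        using AE_integrable_resample[OF t i2[unfolded \<Omega>_def]] unfolding \<Omega>_def .
      then show "AE w in \<Omega>. chi (q * v t w) \<le> (\<integral>y. chi (q * (\<xi> t (w(t := y)))\<^sup>2) \<partial>L)"
      proof (rule AE_mp, intro AE_I2 impI)
        fix w assume w: "w \<in> space \<Omega>" and i: "integrable L (\<lambda>y. q * (\<xi> t (w(t := y)))\<^sup>2)"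
        have "chi (\<integral>y. q * (\<xi> t (w(t := y)))\<^sup>2 \<partial>L) \<le> (\<integral>y. chi (q * (\<xi> t (w(t := y)))\<^sup>2) \<partial>L)"
          using q by (intro chi_expectation_le(1)[OF i]) auto
        then show "chi (q * v t w) \<le> (\<integral>y. chi (q * (\<xi> t (w(t := y)))\<^sup>2) \<partial>L)"
          using var[OF t w] by simp
      qed
    qed
    also have "\<dots> = (\<integral>w. chi (q * (\<xi> t w)\<^sup>2) \<partial>\<Omega>)"
      using integral_resample[OF t ic[unfolded \<Omega>_def]] by (simp add: \<Omega>_def)
    also have "\<dots> \<le> (\<integral>w. chi ((u * \<xi> t w)\<^sup>2) \<partial>\<Omega>)"
    proof (rule integral_mono[OF ic])
      show "integrable \<Omega> (\<lambda>w. chi ((u * \<xi> t w)\<^sup>2))"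
        using chi_int[of "u\<^sup>2" t] t by (simp add: power_mult_distrib)
      show "chi (q * (\<xi> t w)\<^sup>2) \<le> chi ((u * \<xi> t w)\<^sup>2)" for w
        using q by (intro chi_mono) (auto simp: q_def power_mult_distrib)
    qed
    finally show ?thesis .
  qed

  have step': "cmod (H (Suc j) - H j)
      \<le> 2 * \<epsilon> * u\<^sup>2 * (\<integral>w. (\<xi> (Suc j) w)\<^sup>2 \<partial>\<Omega>) + 4 / \<epsilon>\<^sup>2 * (\<integral>w. chi ((u * \<xi> (Suc j) w)\<^sup>2) \<partial>\<Omega>)
       + q * ((\<integral>w. max (V (Suc j) w - 1) 0 \<partial>\<Omega>) - (\<integral>w. max (V j w - 1) 0 \<partial>\<Omega>))"
    if j: "j < N" for j
  proof -
    define t where "t = Suc j"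
    have t: "t \<in> {1..N}" using j by (auto simp: t_def)
    have a: "(\<integral>w. \<epsilon> * (u * \<xi> t w)\<^sup>2 + 2 / \<epsilon>\<^sup>2 * chi ((u * \<xi> t w)\<^sup>2) \<partial>\<Omega>)
      = \<epsilon> * u\<^sup>2 * (\<integral>w. (\<xi> t w)\<^sup>2 \<partial>\<Omega>) + 2 / \<epsilon>\<^sup>2 * (\<integral>w. chi ((u * \<xi> t w)\<^sup>2) \<partial>\<Omega>)"
      using sq[OF t] chi_int[of "u\<^sup>2" t] t by (simp add: power_mult_distrib)
    have b: "(\<integral>w. \<epsilon> * (q * v t w) + 2 / \<epsilon> * chi (q * v t w) \<partial>\<Omega>)
      = \<epsilon> * q * (\<integral>w. (\<xi> t w)\<^sup>2 \<partial>\<Omega>) + 2 / \<epsilon> * (\<integral>w. chi (q * v t w) \<partial>\<Omega>)"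
      using v_int[OF t] chiv_int[OF t] by (simp add: v_mean[OF t])
    have "2 / \<epsilon> * (\<integral>w. chi (q * v t w) \<partial>\<Omega>) \<le> 2 / \<epsilon> * (\<integral>w. chi ((u * \<xi> t w)\<^sup>2) \<partial>\<Omega>)"
      using jensen[OF t] \<epsilon> by (intro mult_left_mono) auto
    also have "\<dots> \<le> 2 / \<epsilon>\<^sup>2 * (\<integral>w. chi ((u * \<xi> t w)\<^sup>2) \<partial>\<Omega>)"
    proof (rule mult_right_mono)
      show "2 / \<epsilon> \<le> 2 / \<epsilon>\<^sup>2" using \<epsilon> by (simp add: power2_eq_square divide_simps)
    qed (auto intro!: integral_nonneg_AE chi_nonneg)
    finally have c: "2 / \<epsilon> * (\<integral>w. chi (q * v t w) \<partial>\<Omega>) \<le> 2 / \<epsilon>\<^sup>2 * (\<integral>w. chi ((u * \<xi> t w)\<^sup>2) \<partial>\<Omega>)" .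
    have d: "\<epsilon> * q * (\<integral>w. (\<xi> t w)\<^sup>2 \<partial>\<Omega>) \<le> \<epsilon> * u\<^sup>2 * (\<integral>w. (\<xi> t w)\<^sup>2 \<partial>\<Omega>)"
      using \<epsilon> by (intro mult_right_mono mult_left_mono) (auto simp: q_def)
    show ?thesis
      using step[OF j] a b c d unfolding t_def[symmetric] by simp
  qed

  have "H N - H 0 = (\<Sum>j<N. H (Suc j) - H j)"
    by (simp add: sum_lessThan_telescope)
  then have "cmod (H N - H 0) \<le> (\<Sum>j<N. cmod (H (Suc j) - H j))"
    by (simp add: norm_sum)
  also have "\<dots> \<le> (\<Sum>j<N. 2 * \<epsilon> * u\<^sup>2 * (\<integral>w. (\<xi> (Suc j) w)\<^sup>2 \<partial>\<Omega>) + 4 / \<epsilon>\<^sup>2 * (\<integral>w. chi ((u * \<xi> (Suc j) w)\<^sup>2) \<partial>\<Omega>)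
       + q * ((\<integral>w. max (V (Suc j) w - 1) 0 \<partial>\<Omega>) - (\<integral>w. max (V j w - 1) 0 \<partial>\<Omega>)))"
    by (intro sum_mono step') auto
  also have "\<dots> = 2 * \<epsilon> * u\<^sup>2 * (\<Sum>j<N. \<integral>w. (\<xi> (Suc j) w)\<^sup>2 \<partial>\<Omega>)
      + 4 / \<epsilon>\<^sup>2 * (\<Sum>j<N. \<integral>w. chi ((u * \<xi> (Suc j) w)\<^sup>2) \<partial>\<Omega>)
      + q * ((\<integral>w. max (V N w - 1) 0 \<partial>\<Omega>) - (\<integral>w. max (V 0 w - 1) 0 \<partial>\<Omega>))"
    unfolding sum.distrib sum_distrib_left[symmetric]
    by (subst sum_lessThan_telescope) simp
  also have "(\<integral>w. max (V 0 w - 1) 0 \<partial>\<Omega>) = 0" by (simp add: V_def)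
  also have "(\<Sum>j<N. \<integral>w. (\<xi> (Suc j) w)\<^sup>2 \<partial>\<Omega>) = (\<Sum>t=1..N. \<integral>w. (\<xi> t w)\<^sup>2 \<partial>\<Omega>)"
    by (rule sum.reindex_bij_witness[of _ "\<lambda>t. t - 1" Suc]) auto
  also have "(\<Sum>j<N. \<integral>w. chi ((u * \<xi> (Suc j) w)\<^sup>2) \<partial>\<Omega>) = (\<Sum>t=1..N. \<integral>w. chi ((u * \<xi> t w)\<^sup>2) \<partial>\<Omega>)"
    by (rule sum.reindex_bij_witness[of _ "\<lambda>t. t - 1" Suc]) auto
  finally have main: "cmod (H N - H 0) \<le> 2 * \<epsilon> * u\<^sup>2 * (\<Sum>t=1..N. \<integral>w. (\<xi> t w)\<^sup>2 \<partial>\<Omega>)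
      + 4 / \<epsilon>\<^sup>2 * (\<Sum>t=1..N. \<integral>w. chi ((u * \<xi> t w)\<^sup>2) \<partial>\<Omega>) + q * (\<integral>w. max (V N w - 1) 0 \<partial>\<Omega>)" by simp

  have H0: "H 0 = exp (- (u\<^sup>2 / 2))"
    by (simp add: H_def S_def V_def psi_def \<Omega>.prob_space q_def)

  have iS: "integrable \<Omega> (\<lambda>w. iexp (u * S N w))"
    by (rule \<Omega>.integrable_const_bound[of _ 1]) auto
  have iH: "integrable \<Omega> (\<lambda>w. iexp (u * S N w) * psi q (V N w))"
    by (rule \<Omega>.integrable_const_bound[of _ 1])
       (use psi_pos psi_le_1[OF q] in \<open>auto simp: norm_mult less_imp_le\<close>)
  have imax: "integrable \<Omega> (\<lambda>w. q * max (1 - V N w) 0)"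
    using V_int[of N] by (intro integrable_mult_right integrable_max) auto
  have "cmod ((\<integral>w. iexp (u * S N w) \<partial>\<Omega>) - H N)
      = cmod (\<integral>w. iexp (u * S N w) - iexp (u * S N w) * psi q (V N w) \<partial>\<Omega>)"
    using iS iH by (simp add: H_def)
  also have "\<dots> \<le> (\<integral>w. cmod (iexp (u * S N w) - iexp (u * S N w) * psi q (V N w)) \<partial>\<Omega>)"
    by (rule integral_norm_bound)
  also have "\<dots> \<le> (\<integral>w. q * max (1 - V N w) 0 \<partial>\<Omega>)"
  proof (rule integral_mono[OF _ imax])
    fix w
    have "iexp (u * S N w) - iexp (u * S N w) * psi q (V N w) = iexp (u * S N w) * complex_of_real (1 - psi q (V N w))"
      by (simp add: algebra_simps)
    then have "cmod (iexp (u * S N w) - iexp (u * S N w) * psi q (V N w)) = 1 - psi q (V N w)"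
      using psi_le_1[OF q, of "V N w"] by (simp only: norm_mult norm_of_real) simp
    then show "cmod (iexp (u * S N w) - iexp (u * S N w) * psi q (V N w)) \<le> q * max (1 - V N w) 0"
      using psi_ge[OF q, of "V N w"] by simp
  qed (use iS iH in auto)
  finally have tail: "cmod ((\<integral>w. iexp (u * S N w) \<partial>\<Omega>) - H N) \<le> q * (\<integral>w. max (1 - V N w) 0 \<partial>\<Omega>)" by simp

  \<comment> \<open>The telescoped cost of capping and the final correction combine to \<open>\<bar>V N - 1\<bar>\<close>.\<close>
  have "(\<integral>w. max (V N w - 1) 0 \<partial>\<Omega>) + (\<integral>w. max (1 - V N w) 0 \<partial>\<Omega>)
      = (\<integral>w. max (V N w - 1) 0 + max (1 - V N w) 0 \<partial>\<Omega>)"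
    using V_int[of N] by (intro Bochner_Integration.integral_add[symmetric] integrable_max) auto
  also have "\<dots> = (\<integral>w. \<bar>V N w - 1\<bar> \<partial>\<Omega>)"
    by (intro Bochner_Integration.integral_cong) auto
  finally have "q * (\<integral>w. max (V N w - 1) 0 \<partial>\<Omega>) + q * (\<integral>w. max (1 - V N w) 0 \<partial>\<Omega>) = q * (\<integral>w. \<bar>V N w - 1\<bar> \<partial>\<Omega>)"
    by (simp only: distrib_left[symmetric])
  moreover have "cmod ((\<integral>w. iexp (u * S N w) \<partial>\<Omega>) - H 0) \<le> cmod ((\<integral>w. iexp (u * S N w) \<partial>\<Omega>) - H N) + cmod (H N - H 0)"
    using norm_triangle_ineq[of "(\<integral>w. iexp (u * S N w) \<partial>\<Omega>) - H N" "H N - H 0"] by simp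
  ultimately have "cmod ((\<integral>w. iexp (u * S N w) \<partial>\<Omega>) - H 0)
    \<le> q * (\<integral>w. \<bar>V N w - 1\<bar> \<partial>\<Omega>) + 2 * \<epsilon> * u\<^sup>2 * (\<Sum>t=1..N. \<integral>w. (\<xi> t w)\<^sup>2 \<partial>\<Omega>)
      + 4 / \<epsilon>\<^sup>2 * (\<Sum>t=1..N. \<integral>w. chi ((u * \<xi> t w)\<^sup>2) \<partial>\<Omega>)"
    using main tail by linarith
  then show ?thesis by (simp add: H0 S_def V_def q_def)
qed

end

section \<open>Degenerate kernels and second moments\<close>

definition pairs :: "nat \<Rightarrow> (nat \<times> nat) set" where
  "pairs N = {(s, t). 1 \<le> s \<and> s < t \<and> t \<le> N}"

lemma pairs_Sigma: "pairs N = (\<lambda>(t, s). (s, t)) ` (SIGMA t:{1..N}. {1..<t})"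
  by (auto simp: pairs_def image_def)

lemma pairs_subset: "pairs N \<subseteq> {1..N} \<times> {1..N}"
  by (auto simp: pairs_def)

lemma finite_pairs [simp]: "finite (pairs N)"
  by (rule finite_subset[OF pairs_subset]) simp

lemma sum_pairs: "(\<Sum>p\<in>pairs N. f (fst p) (snd p)) = (\<Sum>t=1..N. \<Sum>s=1..<t. f s t)"
  unfolding pairs_Sigma
  by (subst sum.reindex) (auto simp: inj_on_def sum.Sigma case_prod_unfold)

lemma card_pairs_le: "card (pairs N) \<le> N\<^sup>2"
  using card_mono[OF _ pairs_subset, of N] by (simp add: power2_eq_square)

lemma (in prob_space) power2_expectation_le:
  fixes X :: "'a \<Rightarrow> real"
  assumes "X \<in> borel_measurable M" "integrable M (\<lambda>w. (X w)\<^sup>2)"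
  shows "(expectation X)\<^sup>2 \<le> expectation (\<lambda>w. (X w)\<^sup>2)"
  using variance_eq[OF square_integrable_imp_integrable[OF assms] assms(2)]
    variance_positive[of X] by linarith

lemma (in prob_space) expectation_abs_le_sqrt:
  fixes X :: "'a \<Rightarrow> real"
  assumes X: "X \<in> borel_measurable M" "integrable M (\<lambda>w. (X w)\<^sup>2)"
  shows "expectation (\<lambda>w. \<bar>X w\<bar>) \<le> sqrt (expectation (\<lambda>w. (X w)\<^sup>2))"
  using power2_expectation_le[of "\<lambda>w. \<bar>X w\<bar>"] X by (intro real_le_rsqrt) simp

lemma abs_mult_le_squares: "\<bar>a * b\<bar> \<le> a\<^sup>2 + (b\<^sup>2 :: real)"
proof -
  have "2 * (\<bar>a\<bar> * \<bar>b\<bar>) \<le> \<bar>a\<bar>\<^sup>2 + \<bar>b\<bar>\<^sup>2"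
    using sum_squares_bound[of "\<bar>a\<bar>" "\<bar>b\<bar>"] by simp
  moreover have "0 \<le> \<bar>a\<bar> * \<bar>b\<bar>" by simp
  ultimately show ?thesis unfolding abs_mult power2_abs by linarith
qed

context law
begin

lemma integrable_pair_prod:
  fixes f g :: "'x \<Rightarrow> real"
  assumes f: "integrable L f" and g: "integrable L g"
  shows "integrable (L \<Otimes>\<^sub>M L) (\<lambda>z. f (fst z) * g (snd z))"
proof -
  interpret LL: pair_prob_space L L ..
  have [measurable]: "f \<in> borel_measurable L" "g \<in> borel_measurable L" using f g by auto
  show ?thesis
    by (rule LL.Fubini_integrable) (use f g in \<open>auto simp: abs_mult\<close>)
qed

lemma measurable_kernel_comp:
  assumes "(\<lambda>z. h (fst z) (snd z)) \<in> borel_measurable (L \<Otimes>\<^sub>M L)"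
    and "f \<in> A \<rightarrow>\<^sub>M L" "g \<in> A \<rightarrow>\<^sub>M L"
  shows "(\<lambda>a. h (f a) (g a)) \<in> borel_measurable A"
  using measurable_compose[OF measurable_Pair[OF assms(2,3)] assms(1)] by simp

lemma measurable_coordinate [measurable (raw)]: "i \<in> I \<Longrightarrow> (\<lambda>w. w i) \<in> sample I \<rightarrow>\<^sub>M L"
  by (rule measurable_component_singleton)

end

text \<open>Square integrability and degeneracy are required at every point, so that sections of \<open>h\<close> can be
  integrated for every sample. A kernel for which they hold only almost everywhere is first set to
  zero on a null set.\<close>

locale degenerate_kernel = law L for L :: "'x measure" +
  fixes h :: "'x \<Rightarrow> 'x \<Rightarrow> real"
  assumes h_meas: "(\<lambda>z. h (fst z) (snd z)) \<in> borel_measurable (L \<Otimes>\<^sub>M L)"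
    and h_sym: "\<And>x y. x \<in> space L \<Longrightarrow> y \<in> space L \<Longrightarrow> h x y = h y x"
    and h_sq: "\<And>x. x \<in> space L \<Longrightarrow> integrable L (\<lambda>y. (h x y)\<^sup>2)"
    and h_mean: "\<And>x. x \<in> space L \<Longrightarrow> (\<integral>y. h x y \<partial>L) = 0"
    and h_sq_int: "integrable (L \<Otimes>\<^sub>M L) (\<lambda>z. (h (fst z) (snd z))\<^sup>2)"
begin

lemmas h_comp [measurable (raw)] = measurable_kernel_comp[OF h_meas]

definition sq_norm :: real where "sq_norm = (\<integral>z. (h (fst z) (snd z))\<^sup>2 \<partial>(L \<Otimes>\<^sub>M L))"

lemma
  assumes "s \<in> I" "t \<in> I" "s \<noteq> t"
  shows integrable_h_sq: "integrable (sample I) (\<lambda>w. (h (w s) (w t))\<^sup>2)"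
    and integral_h_sq: "(\<integral>w. (h (w s) (w t))\<^sup>2 \<partial>sample I) = sq_norm"
  using integrable_two_coordinates[OF assms, of "\<lambda>z. (h (fst z) (snd z))\<^sup>2"]
    integral_two_coordinates[OF assms, of "\<lambda>z. (h (fst z) (snd z))\<^sup>2"] h_sq_int h_meas
  by (auto simp: sq_norm_def)

lemma integral_mult_degenerate:
  assumes st: "s \<in> I" "t \<in> I" "s \<noteq> t"
    and int: "integrable (sample I) (\<lambda>w. B w * h (w s) (w t))"
    and B: "\<And>w y. w \<in> space (sample I) \<Longrightarrow> y \<in> space L \<Longrightarrow> B (w(t := y)) = B w"
  shows "(\<integral>w. B w * h (w s) (w t) \<partial>sample I) = 0"
proof -
  have "(\<integral>w. B w * h (w s) (w t) \<partial>sample I) = (\<integral>w. B w * 0 \<partial>sample I)"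
    using st space_coordinate[OF st(1)] h_mean
    by (intro integral_integrate_out[OF st(2) int] B) auto
  then show ?thesis by simp
qed

lemma integrable_h_prod:
  assumes "s \<in> I" "t \<in> I" "s \<noteq> t" "s' \<in> I" "t' \<in> I" "s' \<noteq> t'"
  shows "integrable (sample I) (\<lambda>w. h (w s) (w t) * h (w s') (w t'))"
proof (rule Bochner_Integration.integrable_bound)
  show "integrable (sample I) (\<lambda>w. (h (w s) (w t))\<^sup>2 + (h (w s') (w t'))\<^sup>2)"
    using assms by (intro Bochner_Integration.integrable_add integrable_h_sq)
  show "(\<lambda>w. h (w s) (w t) * h (w s') (w t')) \<in> borel_measurable (sample I)"
    using assms by measurable
  show "AE w in sample I. norm (h (w s) (w t) * h (w s') (w t')) \<le> norm ((h (w s) (w t))\<^sup>2 + (h (w s') (w t'))\<^sup>2)"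
    by (simp add: abs_mult_le_squares)
qed

text \<open>One of the four indices occurs in one pair only; averaging over that coordinate gives zero.\<close>

lemma h_orthogonal:
  assumes st: "s \<in> I" "t \<in> I" "s < t" "s' \<in> I" "t' \<in> I" "s' < t'" and ne: "(s, t) \<noteq> (s', t')"
  shows "(\<integral>w. h (w s) (w t) * h (w s') (w t') \<partial>sample I) = 0"
proof -
  have *: "(\<integral>w. h (w a) (w b) * h (w c) (w d) \<partial>sample I) = 0"
    if "a \<in> I" "b \<in> I" "c \<in> I" "d \<in> I" "a \<noteq> b" "c \<noteq> d" "d \<noteq> a" "d \<noteq> b" for a b c d
    using that by (intro integral_mult_degenerate integrable_h_prod) auto
  show ?thesis
  proof (cases "t' = s \<or> t' = t")
    case False
    then show ?thesis using st by (intro *) auto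
  next
    case True
    then have "s' \<noteq> s \<and> s' \<noteq> t" using st ne by auto
    then have "(\<integral>w. h (w s) (w t) * h (w t') (w s') \<partial>sample I) = 0" using st by (intro *) auto
    moreover have "(\<integral>w. h (w s) (w t) * h (w t') (w s') \<partial>sample I) = (\<integral>w. h (w s) (w t) * h (w s') (w t') \<partial>sample I)"
      using st h_sym space_coordinate[of _ I] by (intro Bochner_Integration.integral_cong) auto
    ultimately show ?thesis by simp
  qed
qed

lemma
  assumes fin: "finite P" and P: "\<And>p. p \<in> P \<Longrightarrow> fst p \<in> I \<and> snd p \<in> I \<and> fst p < snd p"
  shows integrable_sum_h_sq: "integrable (sample I) (\<lambda>w. (\<Sum>p\<in>P. \<beta> p * h (w (fst p)) (w (snd p)))\<^sup>2)"
    and integral_sum_h_sq: "(\<integral>w. (\<Sum>p\<in>P. \<beta> p * h (w (fst p)) (w (snd p)))\<^sup>2 \<partial>sample I) = (\<Sum>p\<in>P. (\<beta> p)\<^sup>2) * sq_norm"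
proof -
  have eq: "(\<Sum>p\<in>P. \<beta> p * h (w (fst p)) (w (snd p)))\<^sup>2
     = (\<Sum>p\<in>P. \<Sum>q\<in>P. (\<beta> p * \<beta> q) * (h (w (fst p)) (w (snd p)) * h (w (fst q)) (w (snd q))))" for w
    by (simp add: power2_eq_square sum_product mult_ac)
  have int: "integrable (sample I) (\<lambda>w. (\<beta> p * \<beta> q) * (h (w (fst p)) (w (snd p)) * h (w (fst q)) (w (snd q))))"
    if "p \<in> P" "q \<in> P" for p q
    using P[OF that(1)] P[OF that(2)] by (intro integrable_mult_right integrable_h_prod) auto
  show "integrable (sample I) (\<lambda>w. (\<Sum>p\<in>P. \<beta> p * h (w (fst p)) (w (snd p)))\<^sup>2)"
    unfolding eq using int by (intro Bochner_Integration.integrable_sum)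
  have "(\<integral>w. (\<Sum>p\<in>P. \<beta> p * h (w (fst p)) (w (snd p)))\<^sup>2 \<partial>sample I)
     = (\<Sum>p\<in>P. \<Sum>q\<in>P. \<integral>w. (\<beta> p * \<beta> q) * (h (w (fst p)) (w (snd p)) * h (w (fst q)) (w (snd q))) \<partial>sample I)"
    unfolding eq using int
    by (subst Bochner_Integration.integral_sum)
       (auto intro!: Bochner_Integration.integrable_sum sum.cong Bochner_Integration.integral_sum)
  also have "\<dots> = (\<Sum>p\<in>P. \<Sum>q\<in>P. if p = q then (\<beta> p)\<^sup>2 * sq_norm else 0)"
  proof (intro sum.cong refl)
    fix p q assume pq: "p \<in> P" "q \<in> P"
    show "(\<integral>w. (\<beta> p * \<beta> q) * (h (w (fst p)) (w (snd p)) * h (w (fst q)) (w (snd q))) \<partial>sample I)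
      = (if p = q then (\<beta> p)\<^sup>2 * sq_norm else 0)"
    proof (cases "p = q")
      case True
      have "(\<integral>w. (h (w (fst p)) (w (snd p)))\<^sup>2 \<partial>sample I) = sq_norm"
        using P[OF pq(1)] by (intro integral_h_sq) auto
      then show ?thesis using True by (simp add: power2_eq_square)
    next
      case False
      then have "(\<integral>w. h (w (fst p)) (w (snd p)) * h (w (fst q)) (w (snd q)) \<partial>sample I) = 0"
        using P[OF pq(1)] P[OF pq(2)] by (intro h_orthogonal) (auto simp: prod_eq_iff)
      then show ?thesis using False by simp
    qed
  qed
  also have "\<dots> = (\<Sum>p\<in>P. (\<beta> p)\<^sup>2) * sq_norm"
    using fin by (simp add: sum.delta' sum_distrib_right)
  finally show "(\<integral>w. (\<Sum>p\<in>P. \<beta> p * h (w (fst p)) (w (snd p)))\<^sup>2 \<partial>sample I) = (\<Sum>p\<in>P. (\<beta> p)\<^sup>2) * sq_norm" .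
qed

text \<open>The kernel of the square of the integral operator with kernel \<open>h\<close>. Also the covariance
  of \<open>h x Z\<close> and \<open>h y Z\<close> for an observation \<open>Z\<close>.\<close>

definition G :: "'x \<Rightarrow> 'x \<Rightarrow> real" where "G x y = (\<integral>z. h x z * h y z \<partial>L)"

lemma G_diag_nonneg: "0 \<le> G x x"
  by (simp add: G_def)

lemma integrable_hh: "x \<in> space L \<Longrightarrow> y \<in> space L \<Longrightarrow> integrable L (\<lambda>z. h x z * h y z)"
proof (rule Bochner_Integration.integrable_bound[where f = "\<lambda>z. (h x z)\<^sup>2 + (h y z)\<^sup>2"])
  assume x: "x \<in> space L" and y: "y \<in> space L"
  show "integrable L (\<lambda>z. (h x z)\<^sup>2 + (h y z)\<^sup>2)" using h_sq[OF x] h_sq[OF y] by auto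
  show "(\<lambda>z. h x z * h y z) \<in> borel_measurable L" using x y by measurable
  show "AE z in L. norm (h x z * h y z) \<le> norm ((h x z)\<^sup>2 + (h y z)\<^sup>2)"
    by (simp add: abs_mult_le_squares)
qed

lemma G_meas: "(\<lambda>z. G (fst z) (snd z)) \<in> borel_measurable (L \<Otimes>\<^sub>M L)"
  unfolding G_def by measurable

lemmas G_comp [measurable (raw)] = measurable_kernel_comp[OF G_meas]

lemma G_sym: "G x y = G y x"
  by (simp add: G_def mult.commute)

lemma G_diag: "G x x = (\<integral>y. (h x y)\<^sup>2 \<partial>L)"
  by (simp add: G_def power2_eq_square)

lemma
  shows integrable_G_diag: "integrable L (\<lambda>x. G x x)"
    and integral_G_diag: "(\<integral>x. G x x \<partial>L) = sq_norm"
proof -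
  interpret LL: pair_prob_space L L ..
  have i: "integrable (L \<Otimes>\<^sub>M L) (\<lambda>(x, y). (h x y)\<^sup>2)" using h_sq_int by (simp add: case_prod_unfold)
  show "integrable L (\<lambda>x. G x x)" unfolding G_diag by (rule LL.integrable_fst[OF i])
  show "(\<integral>x. G x x \<partial>L) = sq_norm"
    unfolding G_diag sq_norm_def using LL.integral_fst[OF i] by (simp add: case_prod_unfold)
qed

text \<open>The Cauchy-Schwarz inequality, from nonnegativity of the quadratic polynomial
  \<open>c \<mapsto> E (h x Z + c * h y Z)\<^sup>2\<close>.\<close>

lemma G_sq_le:
  assumes x: "x \<in> space L" and y: "y \<in> space L"
  shows "(G x y)\<^sup>2 \<le> G x x * G y y"
proof -
  have q: "0 \<le> G x x + 2 * c * G x y + c\<^sup>2 * G y y" for c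
  proof -
    have "0 \<le> (\<integral>z. (h x z + c * h y z)\<^sup>2 \<partial>L)" by simp
    also have "\<dots> = (\<integral>z. h x z * h x z + 2 * c * (h x z * h y z) + c\<^sup>2 * (h y z * h y z) \<partial>L)"
      by (simp add: power2_eq_square algebra_simps)
    also have "\<dots> = G x x + 2 * c * G x y + c\<^sup>2 * G y y"
      using x y integrable_hh by (simp add: G_def)
    finally show ?thesis .
  qed
  show ?thesis
  proof (cases "G y y = 0")
    case True
    have "G x y = 0"
    proof (rule ccontr)
      assume "G x y \<noteq> 0"
      then have "2 * (- (G x x + 1) / (2 * G x y)) * G x y = - (G x x + 1)" by (simp add: field_simps)
      then show False using q[of "- (G x x + 1) / (2 * G x y)"] True by simp
    qed
    then show ?thesis using True by simp
  next
    case False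
    then have p: "0 < G y y" using G_diag_nonneg[of y] by simp
    have "0 \<le> G x x + 2 * (- G x y / G y y) * G x y + (- G x y / G y y)\<^sup>2 * G y y" by (rule q)
    also have "\<dots> = G x x - (G x y)\<^sup>2 / G y y"
      using False by (simp add: power2_eq_square divide_simps)
    finally show ?thesis using p by (simp add: divide_simps mult.commute)
  qed
qed

text \<open>This makes the orthogonality relations available for the off-diagonal part of the conditional
  variances as well.\<close>

lemma degenerate_kernel_G: "degenerate_kernel L G"
proof (unfold_locales)
  interpret LL: pair_prob_space L L ..
  show "(\<lambda>z. G (fst z) (snd z)) \<in> borel_measurable (L \<Otimes>\<^sub>M L)" by (rule G_meas)
  show "G x y = G y x" for x y by (rule G_sym)
  show "integrable L (\<lambda>y. (G x y)\<^sup>2)" if x: "x \<in> space L" for x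
  proof (rule Bochner_Integration.integrable_bound[where f = "\<lambda>y. G x x * G y y"])
    show "integrable L (\<lambda>y. G x x * G y y)" using integrable_G_diag by simp
    show "(\<lambda>y. (G x y)\<^sup>2) \<in> borel_measurable L" using x by measurable
    show "AE y in L. norm ((G x y)\<^sup>2) \<le> norm (G x x * G y y)"
      using G_sq_le[OF x] G_diag_nonneg by (intro AE_I2) auto
  qed
  show "integrable (L \<Otimes>\<^sub>M L) (\<lambda>z. (G (fst z) (snd z))\<^sup>2)"
  proof (rule Bochner_Integration.integrable_bound[where f = "\<lambda>z. G (fst z) (fst z) * G (snd z) (snd z)"])
    show "integrable (L \<Otimes>\<^sub>M L) (\<lambda>z. G (fst z) (fst z) * G (snd z) (snd z))"
      using integrable_G_diag integrable_G_diag by (rule integrable_pair_prod)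
    show "(\<lambda>z. (G (fst z) (snd z))\<^sup>2) \<in> borel_measurable (L \<Otimes>\<^sub>M L)" by measurable
    show "AE z in L \<Otimes>\<^sub>M L. norm ((G (fst z) (snd z))\<^sup>2) \<le> norm (G (fst z) (fst z) * G (snd z) (snd z))"
      using G_sq_le G_diag_nonneg by (intro AE_I2) (auto simp: space_pair_measure)
  qed
  show "(\<integral>y. G x y \<partial>L) = 0" if x: "x \<in> space L" for x
  proof -
    have i: "integrable (L \<Otimes>\<^sub>M L) (\<lambda>(y, z). h x z * h y z)"
    proof (rule Bochner_Integration.integrable_bound[where f = "\<lambda>p. (h x (snd p))\<^sup>2 + (h (fst p) (snd p))\<^sup>2"])
      have "integrable (L \<Otimes>\<^sub>M L) (\<lambda>p. (h x (snd p))\<^sup>2)"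
        using integrable_pair_prod[of "\<lambda>_. 1" "\<lambda>z. (h x z)\<^sup>2"] h_sq[OF x] by simp
      then show "integrable (L \<Otimes>\<^sub>M L) (\<lambda>p. (h x (snd p))\<^sup>2 + (h (fst p) (snd p))\<^sup>2)"
        using h_sq_int by auto
      show "(\<lambda>(y, z). h x z * h y z) \<in> borel_measurable (L \<Otimes>\<^sub>M L)"
        using x by measurable
      show "AE p in L \<Otimes>\<^sub>M L. norm (case p of (y, z) \<Rightarrow> h x z * h y z) \<le> norm ((h x (snd p))\<^sup>2 + (h (fst p) (snd p))\<^sup>2)"
        by (simp add: case_prod_unfold abs_mult_le_squares)
    qed
    have "(\<integral>y. G x y \<partial>L) = (\<integral>z. (\<integral>y. h x z * h y z \<partial>L) \<partial>L)"
      unfolding G_def using LL.Fubini_integral[OF i] by simp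
    also have "\<dots> = (\<integral>z. 0 \<partial>L)"
    proof (rule Bochner_Integration.integral_cong)
      fix z assume z: "z \<in> space L"
      have "(\<integral>y. h y z \<partial>L) = (\<integral>y. h z y \<partial>L)"
        using z h_sym by (intro Bochner_Integration.integral_cong) auto
      then show "(\<integral>y. h x z * h y z \<partial>L) = 0" using h_mean[OF z] by simp
    qed simp
    finally show ?thesis by simp
  qed
qed

end

section \<open>A weak law of large numbers for weighted pair averages\<close>

lemma card_overlapping_pairs:
  "card {q \<in> pairs N. {fst q, snd q} \<inter> {a, b} \<noteq> {}} \<le> 4 * N"
proof -
  let ?Q = "{q \<in> pairs N. {fst q, snd q} \<inter> {a, b} \<noteq> {}}"
  have "?Q \<subseteq> ((\<lambda>j. (a, j)) ` {1..N} \<union> (\<lambda>j. (b, j)) ` {1..N}) \<union> ((\<lambda>j. (j, a)) ` {1..N} \<union> (\<lambda>j. (j, b)) ` {1..N})"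
    by (auto simp: pairs_def image_iff)
  then have "card ?Q \<le> card (((\<lambda>j. (a, j)) ` {1..N} \<union> (\<lambda>j. (b, j)) ` {1..N}) \<union> ((\<lambda>j. (j, a)) ` {1..N} \<union> (\<lambda>j. (j, b)) ` {1..N}))"
    by (intro card_mono) auto
  also have "\<dots> \<le> (card ((\<lambda>j. (a, j)) ` {1..N}) + card ((\<lambda>j. (b, j)) ` {1..N}))
     + (card ((\<lambda>j. (j, a)) ` {1..N}) + card ((\<lambda>j. (j, b)) ` {1..N}))"
    by (intro order_trans[OF card_Un_le] add_mono card_Un_le)
  also have "\<dots> \<le> (N + N) + (N + N)"
    by (intro add_mono order_trans[OF card_image_le]) auto
  finally show ?thesis by simp
qed

context law
begin

text \<open>Terms belonging to disjoint pairs are uncorrelated: average over the two coordinates of one of the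
  pairs. At most \<open>4 * N\<close> pairs meet a given one, and there are at most \<open>N\<^sup>2\<close> pairs.\<close>

lemma bounded_pair_average_variance:
  fixes g :: "'x \<Rightarrow> 'x \<Rightarrow> real" and c :: "nat \<times> nat \<Rightarrow> real"
  assumes g_meas: "(\<lambda>z. g (fst z) (snd z)) \<in> borel_measurable (L \<Otimes>\<^sub>M L)"
    and bd: "\<And>x y. x \<in> space L \<Longrightarrow> y \<in> space L \<Longrightarrow> \<bar>g x y\<bar> \<le> C"
    and mean: "(\<integral>z. g (fst z) (snd z) \<partial>(L \<Otimes>\<^sub>M L)) = 0"
    and c: "\<And>p. p \<in> pairs N \<Longrightarrow> 0 \<le> c p \<and> c p \<le> W"
  defines "\<Omega> \<equiv> sample {1..N}"
  shows "(\<integral>w. (\<Sum>p\<in>pairs N. c p * g (w (fst p)) (w (snd p)))\<^sup>2 \<partial>\<Omega>)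
    \<le> 4 * real N ^ 3 * W\<^sup>2 * (\<integral>z. (g (fst z) (snd z))\<^sup>2 \<partial>(L \<Otimes>\<^sub>M L))"
proof -
  interpret \<Omega>: prob_space \<Omega> unfolding \<Omega>_def by (rule prob_space_sample)
  note g_comp [measurable (raw)] = measurable_kernel_comp[OF g_meas]
  define Q where "Q = (\<integral>z. (g (fst z) (snd z))\<^sup>2 \<partial>(L \<Otimes>\<^sub>M L))"
  have Q: "0 \<le> Q" by (simp add: Q_def)
  have pos: "fst p \<in> {1..N}" "snd p \<in> {1..N}" "fst p \<noteq> snd p" if "p \<in> pairs N" for p
    using that by (auto simp: pairs_def)
  have bd': "\<bar>g (w (fst p)) (w (snd p))\<bar> \<le> C" if "p \<in> pairs N" "w \<in> space \<Omega>" for p w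
    using pos[OF that(1)] that(2) space_coordinate[of _ "{1..N}" w] by (intro bd) (auto simp: \<Omega>_def)
  obtain x where "x \<in> space L" using not_empty by blast
  then have C: "0 \<le> C" using bd[of x x] by linarith
  have meas: "(\<lambda>w. g (w (fst p)) (w (snd p))) \<in> borel_measurable \<Omega>" if "p \<in> pairs N" for p
    using pos[OF that] unfolding \<Omega>_def by measurable
  have int: "integrable \<Omega> (\<lambda>w. g (w (fst p)) (w (snd p)) * g (w (fst q)) (w (snd q)))"
    if pq: "p \<in> pairs N" "q \<in> pairs N" for p q
  proof (rule \<Omega>.integrable_const_bound[where B = "C * C"])
    show "AE w in \<Omega>. norm (g (w (fst p)) (w (snd p)) * g (w (fst q)) (w (snd q))) \<le> C * C"
      using bd'[OF pq(1)] bd'[OF pq(2)] C by (auto simp: abs_mult intro!: AE_I2 mult_mono)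
    show "(\<lambda>w. g (w (fst p)) (w (snd p)) * g (w (fst q)) (w (snd q))) \<in> borel_measurable \<Omega>"
      using meas[OF pq(1)] meas[OF pq(2)] by measurable
  qed
  have sqE: "(\<integral>w. (g (w (fst p)) (w (snd p)))\<^sup>2 \<partial>\<Omega>) = Q" if "p \<in> pairs N" for p
    unfolding \<Omega>_def Q_def
    using integral_two_coordinates[OF pos[OF that], of "\<lambda>z. (g (fst z) (snd z))\<^sup>2"] g_meas by simp
  have cross: "c p * c q * (\<integral>w. g (w (fst p)) (w (snd p)) * g (w (fst q)) (w (snd q)) \<partial>\<Omega>)
      \<le> (if {fst q, snd q} \<inter> {fst p, snd p} \<noteq> {} then W\<^sup>2 * Q else 0)"
    if pq: "p \<in> pairs N" "q \<in> pairs N" for p q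
  proof (cases "{fst q, snd q} \<inter> {fst p, snd p} = {}")
    case True
    obtain s t s' t' where st: "p = (s, t)" "q = (s', t')" by (cases p, cases q) auto
    have ne: "s \<in> {1..N}" "t \<in> {1..N}" "s \<noteq> t" "s' \<in> {1..N}" "t' \<in> {1..N}" "s' \<noteq> t'"
      "s \<noteq> s'" "s \<noteq> t'" "t \<noteq> s'" "t \<noteq> t'"
      using pos[OF pq(1)] pos[OF pq(2)] True by (auto simp: st)
    define g1 where "g1 y = (\<integral>x. g x y \<partial>L)" for y
    have [measurable]: "g1 \<in> borel_measurable L" unfolding g1_def by measurable
    have g1_mean: "(\<integral>y. g1 y \<partial>L) = 0"
    proof -
      interpret LL: pair_prob_space L L ..
      have i: "integrable (L \<Otimes>\<^sub>M L) (\<lambda>(x, y). g x y)"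
        by (rule LL.P.integrable_const_bound[where B = C])
           (use bd g_meas in \<open>auto simp: space_pair_measure case_prod_unfold\<close>)
      show ?thesis unfolding g1_def using LL.integral_snd[OF i] mean by (simp add: case_prod_unfold)
    qed
    have "(\<integral>w. g (w s') (w t') * g (w s) (w t) \<partial>\<Omega>) = (\<integral>w. g (w s') (w t') * g1 (w t) \<partial>\<Omega>)"
      unfolding \<Omega>_def
    proof (rule integral_integrate_out[OF ne(1)])
      show "integrable (sample {1..N}) (\<lambda>w. g (w s') (w t') * g (w s) (w t))"
        using int[OF pq(2,1)] by (simp add: st \<Omega>_def)
    qed (use ne in \<open>auto simp: g1_def\<close>)
    also have "\<dots> = (\<integral>w. g (w s') (w t') * 0 \<partial>\<Omega>)"
      unfolding \<Omega>_def
    proof (rule integral_integrate_out[OF ne(2)])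
      have "integrable (sample {1..N}) (\<lambda>w. g (w s') (w t') * g1 (w t))"
        by (rule integrable_integrate_out[OF ne(1), where f = "\<lambda>w. g (w s) (w t)"])
           (use ne int[OF pq(2,1)] in \<open>auto simp: g1_def st \<Omega>_def\<close>)
      then show "integrable (sample {1..N}) (\<lambda>w. g (w s') (w t') * g1 (w t))" .
    qed (use ne g1_mean in auto)
    finally have "(\<integral>w. g (w s) (w t) * g (w s') (w t') \<partial>\<Omega>) = 0" by (simp add: mult.commute)
    then show ?thesis using True by (simp add: st)
  next
    case False
    have "(\<integral>w. g (w (fst p)) (w (snd p)) * g (w (fst q)) (w (snd q)) \<partial>\<Omega>)
      \<le> (\<integral>w. ((g (w (fst p)) (w (snd p)))\<^sup>2 + (g (w (fst q)) (w (snd q)))\<^sup>2) / 2 \<partial>\<Omega>)"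
    proof (rule integral_mono[OF int[OF pq]])
      show "integrable \<Omega> (\<lambda>w. ((g (w (fst p)) (w (snd p)))\<^sup>2 + (g (w (fst q)) (w (snd q)))\<^sup>2) / 2)"
        using int[OF pq(1,1)] int[OF pq(2,2)] by (simp add: power2_eq_square)
      show "g (w (fst p)) (w (snd p)) * g (w (fst q)) (w (snd q))
         \<le> ((g (w (fst p)) (w (snd p)))\<^sup>2 + (g (w (fst q)) (w (snd q)))\<^sup>2) / 2" for w
        using sum_squares_bound[of "g (w (fst p)) (w (snd p))" "g (w (fst q)) (w (snd q))"] by simp
    qed
    also have "\<dots> = Q"
      using int[OF pq(1,1)] int[OF pq(2,2)] sqE[OF pq(1)] sqE[OF pq(2)] by (simp add: power2_eq_square)
    finally have le: "(\<integral>w. g (w (fst p)) (w (snd p)) * g (w (fst q)) (w (snd q)) \<partial>\<Omega>) \<le> Q" .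
    have "c p * c q * (\<integral>w. g (w (fst p)) (w (snd p)) * g (w (fst q)) (w (snd q)) \<partial>\<Omega>) \<le> c p * c q * Q"
      using le c[OF pq(1)] c[OF pq(2)] by (intro mult_left_mono) auto
    also have "\<dots> \<le> (W * W) * Q"
      using c[OF pq(1)] c[OF pq(2)] Q by (intro mult_right_mono mult_mono) auto
    finally show ?thesis using False by (simp add: power2_eq_square)
  qed
  have "(\<integral>w. (\<Sum>p\<in>pairs N. c p * g (w (fst p)) (w (snd p)))\<^sup>2 \<partial>\<Omega>)
     = (\<integral>w. (\<Sum>p\<in>pairs N. \<Sum>q\<in>pairs N. c p * c q * (g (w (fst p)) (w (snd p)) * g (w (fst q)) (w (snd q)))) \<partial>\<Omega>)"
    by (simp add: power2_eq_square sum_product mult_ac)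
  also have "\<dots> = (\<Sum>p\<in>pairs N. \<Sum>q\<in>pairs N. c p * c q * (\<integral>w. g (w (fst p)) (w (snd p)) * g (w (fst q)) (w (snd q)) \<partial>\<Omega>))"
    using int by (subst Bochner_Integration.integral_sum)
       (auto intro!: Bochner_Integration.integrable_sum sum.cong simp: Bochner_Integration.integral_sum)
  also have "\<dots> \<le> (\<Sum>p\<in>pairs N. \<Sum>q\<in>pairs N. if {fst q, snd q} \<inter> {fst p, snd p} \<noteq> {} then W\<^sup>2 * Q else 0)"
    by (intro sum_mono cross)
  also have "\<dots> = (\<Sum>p\<in>pairs N. real (card {q \<in> pairs N. {fst q, snd q} \<inter> {fst p, snd p} \<noteq> {}}) * (W\<^sup>2 * Q))"
    by (intro sum.cong refl) (subst sum.inter_filter[symmetric], auto)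
  also have "\<dots> \<le> (\<Sum>p\<in>pairs N. real (4 * N) * (W\<^sup>2 * Q))"
    using Q card_overlapping_pairs by (intro sum_mono mult_right_mono of_nat_mono) auto
  also have "\<dots> = real (card (pairs N)) * (real (4 * N) * (W\<^sup>2 * Q))" by simp
  also have "\<dots> \<le> real (N\<^sup>2) * (real (4 * N) * (W\<^sup>2 * Q))"
    using Q card_pairs_le[of N] by (intro mult_right_mono of_nat_mono) auto
  also have "\<dots> = 4 * real N ^ 3 * W\<^sup>2 * Q"
    by (simp add: power2_eq_square power3_eq_cube)
  finally show ?thesis by (simp add: Q_def)
qed

text \<open>The smooth truncation \<open>f' = f / (1 + f / N)\<close> is bounded by \<open>N\<close> and satisfies
  \<open>f - f' = N * chi (f / N)\<close> and \<open>f'\<^sup>2 \<le> N\<^sup>2 * chi (f / N)\<close>. So one quantity, \<open>\<Lambda>\<close>, controls both the mean of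
  the removed part and the variance of the average of the part that is kept.\<close>

lemma pair_average_law_of_large_numbers:
  fixes f :: "'x \<Rightarrow> 'x \<Rightarrow> real" and c :: "nat \<times> nat \<Rightarrow> real"
  assumes f_meas: "(\<lambda>z. f (fst z) (snd z)) \<in> borel_measurable (L \<Otimes>\<^sub>M L)"
    and f_nn: "\<And>x y. x \<in> space L \<Longrightarrow> y \<in> space L \<Longrightarrow> 0 \<le> f x y"
    and f_int: "integrable (L \<Otimes>\<^sub>M L) (\<lambda>z. f (fst z) (snd z))"
    and N: "0 < N"
    and c: "\<And>p. p \<in> pairs N \<Longrightarrow> 0 \<le> c p \<and> c p \<le> D / (real N)\<^sup>2" and D: "0 \<le> D"
  defines "\<Omega> \<equiv> sample {1..N}"
    and "\<mu> \<equiv> (\<integral>z. f (fst z) (snd z) \<partial>(L \<Otimes>\<^sub>M L))"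
    and "\<Lambda> \<equiv> real N * (\<integral>z. chi (f (fst z) (snd z) / real N) \<partial>(L \<Otimes>\<^sub>M L))"
  shows "integrable \<Omega> (\<lambda>w. \<Sum>p\<in>pairs N. c p * (f (w (fst p)) (w (snd p)) - \<mu>))"
    and "(\<integral>w. \<bar>\<Sum>p\<in>pairs N. c p * (f (w (fst p)) (w (snd p)) - \<mu>)\<bar> \<partial>\<Omega>) \<le> 2 * D * (sqrt \<Lambda> + \<Lambda>)"
proof -
  interpret \<Omega>: prob_space \<Omega> unfolding \<Omega>_def by (rule prob_space_sample)
  interpret LL: pair_prob_space L L ..
  have N': "0 < real N" using N by simp
  define f' where "f' x y = f x y / (1 + f x y / real N)" for x y
  define \<mu>' where "\<mu>' = (\<integral>z. f' (fst z) (snd z) \<partial>(L \<Otimes>\<^sub>M L))"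
  have [measurable]: "(\<lambda>z. f (fst z) (snd z)) \<in> borel_measurable (L \<Otimes>\<^sub>M L)" by (rule f_meas)
  have f'_meas [measurable]: "(\<lambda>z. f' (fst z) (snd z)) \<in> borel_measurable (L \<Otimes>\<^sub>M L)"
    unfolding f'_def by measurable
  note f_comp [measurable (raw)] = measurable_kernel_comp[OF f_meas]
  note f'_comp [measurable (raw)] = measurable_kernel_comp[OF f'_meas]
  have pos: "fst p \<in> {1..N}" "snd p \<in> {1..N}" "fst p \<noteq> snd p" if "p \<in> pairs N" for p
    using that by (auto simp: pairs_def)

  have f'_nn: "0 \<le> f' x y" and f'_le: "f' x y \<le> real N" and f'_diff: "f x y - f' x y = real N * chi (f x y / real N)"
    and f'_sq: "(f' x y)\<^sup>2 \<le> (real N)\<^sup>2 * chi (f x y / real N)"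
    if "x \<in> space L" "y \<in> space L" for x y
  proof -
    define a where "a = f x y / real N"
    have a: "0 \<le> a" using f_nn[OF that] by (simp add: a_def)
    have fa: "f x y = real N * a" using N' by (simp add: a_def)
    have f'a: "f' x y = real N * (a / (1 + a))" unfolding f'_def a_def[symmetric] fa by simp
    show "0 \<le> f' x y" using a by (simp add: f'a)
    have "real N * (a / (1 + a)) \<le> real N * 1" using a by (intro mult_left_mono) auto
    then show "f' x y \<le> real N" by (simp add: f'a)
    have "a - a / (1 + a) = chi a" using a by (simp add: chi_eq divide_simps) (simp add: algebra_simps)
    then have "f x y - f' x y = real N * chi a"
      unfolding f'a fa by (simp only: right_diff_distrib[symmetric])
    then show "f x y - f' x y = real N * chi (f x y / real N)" by (simp add: a_def)
    have "(a / (1 + a))\<^sup>2 \<le> chi a"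
    proof -
      have "a\<^sup>2 / ((1 + a) * (1 + a)) \<le> a\<^sup>2 / (1 + a)"
        using a mult_left_mono[of 1 "1 + a" "1 + a"] by (intro divide_left_mono) auto
      then show ?thesis by (simp add: chi_def power_divide power2_eq_square)
    qed
    then show "(f' x y)\<^sup>2 \<le> (real N)\<^sup>2 * chi (f x y / real N)"
      unfolding f'a a_def[symmetric] power_mult_distrib by (rule mult_left_mono) simp
  qed
  have \<Lambda>_int: "integrable (L \<Otimes>\<^sub>M L) (\<lambda>z. chi (f (fst z) (snd z) / real N))"
    using f_int f_nn by (intro LL.P.chi_expectation_le(2)) (auto simp: space_pair_measure)
  have \<Lambda>: "0 \<le> \<Lambda>"
    unfolding \<Lambda>_def by (intro mult_nonneg_nonneg integral_nonneg_AE AE_I2 chi_nonneg)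
      (auto simp: space_pair_measure f_nn)
  have f'_int: "integrable (L \<Otimes>\<^sub>M L) (\<lambda>z. f' (fst z) (snd z))"
    by (rule LL.P.integrable_const_bound[where B = "real N"])
       (use f'_nn f'_le in \<open>auto simp: space_pair_measure\<close>)
  have f'sq_int: "integrable (L \<Otimes>\<^sub>M L) (\<lambda>z. (f' (fst z) (snd z))\<^sup>2)"
    by (rule LL.P.integrable_const_bound[where B = "(real N)\<^sup>2"])
       (use f'_nn f'_le in \<open>auto simp: space_pair_measure intro!: power_mono\<close>)
  have \<mu>_diff: "\<mu> - \<mu>' = \<Lambda>"
  proof -
    have "\<mu> - \<mu>' = (\<integral>z. f (fst z) (snd z) - f' (fst z) (snd z) \<partial>(L \<Otimes>\<^sub>M L))"
      using f_int f'_int by (simp add: \<mu>_def \<mu>'_def)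
    also have "\<dots> = (\<integral>z. real N * chi (f (fst z) (snd z) / real N) \<partial>(L \<Otimes>\<^sub>M L))"
      by (intro Bochner_Integration.integral_cong refl f'_diff) (auto simp: space_pair_measure)
    finally show ?thesis by (simp add: \<Lambda>_def)
  qed
  have var: "(\<integral>z. (f' (fst z) (snd z) - \<mu>')\<^sup>2 \<partial>(L \<Otimes>\<^sub>M L)) \<le> real N * \<Lambda>"
  proof -
    have "(\<integral>z. (f' (fst z) (snd z) - \<mu>')\<^sup>2 \<partial>(L \<Otimes>\<^sub>M L)) = (\<integral>z. (f' (fst z) (snd z))\<^sup>2 \<partial>(L \<Otimes>\<^sub>M L)) - \<mu>'\<^sup>2"
      unfolding \<mu>'_def using f'_int f'sq_int by (rule LL.P.variance_eq)
    also have "\<dots> \<le> (\<integral>z. (f' (fst z) (snd z))\<^sup>2 \<partial>(L \<Otimes>\<^sub>M L))" by simp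
    also have "\<dots> \<le> (\<integral>z. (real N)\<^sup>2 * chi (f (fst z) (snd z) / real N) \<partial>(L \<Otimes>\<^sub>M L))"
      using f'sq_int \<Lambda>_int f'_sq by (intro integral_mono) (auto simp: space_pair_measure)
    finally show ?thesis by (simp add: \<Lambda>_def power2_eq_square)
  qed

  have fi: "integrable \<Omega> (\<lambda>w. f (w (fst p)) (w (snd p)))" if "p \<in> pairs N" for p
    using integrable_two_coordinates[OF pos[OF that], of "\<lambda>z. f (fst z) (snd z)"] f_int by (simp add: \<Omega>_def)
  have fE: "(\<integral>w. f (w (fst p)) (w (snd p)) \<partial>\<Omega>) = \<mu>" if "p \<in> pairs N" for p
    using integral_two_coordinates[OF pos[OF that], of "\<lambda>z. f (fst z) (snd z)"] by (simp add: \<Omega>_def \<mu>_def)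
  have f'i: "integrable \<Omega> (\<lambda>w. f' (w (fst p)) (w (snd p)))" if "p \<in> pairs N" for p
    using integrable_two_coordinates[OF pos[OF that], of "\<lambda>z. f' (fst z) (snd z)"] f'_int by (simp add: \<Omega>_def)
  have f'E: "(\<integral>w. f' (w (fst p)) (w (snd p)) \<partial>\<Omega>) = \<mu>'" if "p \<in> pairs N" for p
    using integral_two_coordinates[OF pos[OF that], of "\<lambda>z. f' (fst z) (snd z)"] by (simp add: \<Omega>_def \<mu>'_def)
  show int: "integrable \<Omega> (\<lambda>w. \<Sum>p\<in>pairs N. c p * (f (w (fst p)) (w (snd p)) - \<mu>))"
    using fi by (intro Bochner_Integration.integrable_sum) auto
  define A where "A w = (\<Sum>p\<in>pairs N. c p * (f' (w (fst p)) (w (snd p)) - \<mu>'))" for w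
  define B where "B w = (\<Sum>p\<in>pairs N. c p * (f (w (fst p)) (w (snd p)) - f' (w (fst p)) (w (snd p))))" for w
  define s where "s = (\<Sum>p\<in>pairs N. c p)"
  have s0: "0 \<le> s" unfolding s_def using c by (intro sum_nonneg) auto
  have s1: "s \<le> D"
  proof -
    have "s \<le> (\<Sum>p\<in>pairs N. D / (real N)\<^sup>2)" unfolding s_def using c by (intro sum_mono) auto
    also have "\<dots> = real (card (pairs N)) * (D / (real N)\<^sup>2)" by simp
    also have "\<dots> \<le> real (N\<^sup>2) * (D / (real N)\<^sup>2)"
      using card_pairs_le[of N] D by (intro mult_right_mono of_nat_mono) auto
    finally show ?thesis using N by simp
  qed
  \<comment> \<open>Centred truncated part, removed part, and the mean of the removed part.\<close>
  have dec: "(\<Sum>p\<in>pairs N. c p * (f (w (fst p)) (w (snd p)) - \<mu>)) = A w + B w - s * \<Lambda>" for w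
    unfolding A_def B_def s_def \<mu>_diff[symmetric] sum_distrib_right sum.distrib[symmetric] sum_subtractf[symmetric]
    by (intro sum.cong refl) (simp add: algebra_simps)
  have A_int: "integrable \<Omega> A" unfolding A_def using f'i by (intro Bochner_Integration.integrable_sum) auto
  have B_int: "integrable \<Omega> B" unfolding B_def using fi f'i by (intro Bochner_Integration.integrable_sum) auto
  have B_nn: "0 \<le> B w" if w: "w \<in> space \<Omega>" for w
    unfolding B_def
  proof (intro sum_nonneg mult_nonneg_nonneg)
    fix p assume p: "p \<in> pairs N"
    show "0 \<le> c p" using c[OF p] by simp
    have sp: "w (fst p) \<in> space L" "w (snd p) \<in> space L"
      using pos[OF p] w space_coordinate[of _ "{1..N}" w] by (auto simp: \<Omega>_def)
    show "0 \<le> f (w (fst p)) (w (snd p)) - f' (w (fst p)) (w (snd p))"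
      unfolding f'_diff[OF sp] using f_nn[OF sp] by (simp add: chi_nonneg)
  qed
  have EB: "(\<integral>w. B w \<partial>\<Omega>) = s * \<Lambda>"
  proof -
    have "(\<integral>w. B w \<partial>\<Omega>) = (\<Sum>p\<in>pairs N. c p * (\<mu> - \<mu>'))"
      unfolding B_def using fi f'i by (subst Bochner_Integration.integral_sum) (auto simp: fE f'E)
    then show ?thesis by (simp add: \<mu>_diff s_def sum_distrib_right)
  qed
  have Asq: "(\<integral>w. (A w)\<^sup>2 \<partial>\<Omega>) \<le> 4 * D\<^sup>2 * \<Lambda>"
  proof -
    have "(\<integral>w. (A w)\<^sup>2 \<partial>\<Omega>) \<le> 4 * real N ^ 3 * (D / (real N)\<^sup>2)\<^sup>2 * (\<integral>z. (f' (fst z) (snd z) - \<mu>')\<^sup>2 \<partial>(L \<Otimes>\<^sub>M L))"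
      unfolding A_def \<Omega>_def
    proof (rule bounded_pair_average_variance[where g = "\<lambda>x y. f' x y - \<mu>'" and C = "real N + \<bar>\<mu>'\<bar>"])
      show "(\<integral>z. f' (fst z) (snd z) - \<mu>' \<partial>(L \<Otimes>\<^sub>M L)) = 0"
        using f'_int by (simp add: \<mu>'_def LL.P.prob_space)
      show "\<bar>f' x y - \<mu>'\<bar> \<le> real N + \<bar>\<mu>'\<bar>" if "x \<in> space L" "y \<in> space L" for x y
        using f'_nn[OF that] f'_le[OF that] by linarith
    qed (use c in auto)
    also have "\<dots> \<le> 4 * real N ^ 3 * (D / (real N)\<^sup>2)\<^sup>2 * (real N * \<Lambda>)"
      using var by (intro mult_left_mono) auto
    also have "\<dots> = 4 * D\<^sup>2 * \<Lambda>"
      using N' by (simp add: field_simps power2_eq_square power3_eq_cube)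
    finally show ?thesis .
  qed
  have A_sq_int: "integrable \<Omega> (\<lambda>w. (A w)\<^sup>2)"
  proof (rule \<Omega>.integrable_const_bound)
    show "AE w in \<Omega>. norm ((A w)\<^sup>2) \<le> (\<Sum>p\<in>pairs N. c p * (real N + \<bar>\<mu>'\<bar>))\<^sup>2"
    proof (rule AE_I2)
      fix w assume w: "w \<in> space \<Omega>"
      have "\<bar>A w\<bar> \<le> (\<Sum>p\<in>pairs N. \<bar>c p * (f' (w (fst p)) (w (snd p)) - \<mu>')\<bar>)" unfolding A_def by (rule sum_abs)
      also have "\<dots> \<le> (\<Sum>p\<in>pairs N. c p * (real N + \<bar>\<mu>'\<bar>))"
      proof (rule sum_mono)
        fix p assume p: "p \<in> pairs N"
        have sp: "w (fst p) \<in> space L" "w (snd p) \<in> space L"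
          using pos[OF p] w space_coordinate[of _ "{1..N}" w] by (auto simp: \<Omega>_def)
        have "\<bar>f' (w (fst p)) (w (snd p)) - \<mu>'\<bar> \<le> real N + \<bar>\<mu>'\<bar>"
          using f'_nn[OF sp] f'_le[OF sp] by linarith
        then show "\<bar>c p * (f' (w (fst p)) (w (snd p)) - \<mu>')\<bar> \<le> c p * (real N + \<bar>\<mu>'\<bar>)"
          using c[OF p] by (auto simp: abs_mult intro!: mult_left_mono)
      qed
      finally have "\<bar>A w\<bar>\<^sup>2 \<le> (\<Sum>p\<in>pairs N. c p * (real N + \<bar>\<mu>'\<bar>))\<^sup>2" by (rule power_mono) simp
      then show "norm ((A w)\<^sup>2) \<le> (\<Sum>p\<in>pairs N. c p * (real N + \<bar>\<mu>'\<bar>))\<^sup>2" by simp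
    qed
    show "(\<lambda>w. (A w)\<^sup>2) \<in> borel_measurable \<Omega>" using A_int by auto
  qed
  have EA: "(\<integral>w. \<bar>A w\<bar> \<partial>\<Omega>) \<le> 2 * D * sqrt \<Lambda>"
  proof -
    have "(\<integral>w. \<bar>A w\<bar> \<partial>\<Omega>) \<le> sqrt (\<integral>w. (A w)\<^sup>2 \<partial>\<Omega>)"
      using A_int A_sq_int by (intro \<Omega>.expectation_abs_le_sqrt) auto
    also have "\<dots> \<le> sqrt (4 * D\<^sup>2 * \<Lambda>)" using Asq by (rule real_sqrt_le_mono)
    also have "\<dots> = 2 * D * sqrt \<Lambda>" using D by (simp add: real_sqrt_mult)
    finally show ?thesis .
  qed
  have "(\<integral>w. \<bar>\<Sum>p\<in>pairs N. c p * (f (w (fst p)) (w (snd p)) - \<mu>)\<bar> \<partial>\<Omega>) \<le> (\<integral>w. \<bar>A w\<bar> + B w + s * \<Lambda> \<partial>\<Omega>)"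
  proof (rule integral_mono)
    show "integrable \<Omega> (\<lambda>w. \<bar>\<Sum>p\<in>pairs N. c p * (f (w (fst p)) (w (snd p)) - \<mu>)\<bar>)" using int by auto
    show "integrable \<Omega> (\<lambda>w. \<bar>A w\<bar> + B w + s * \<Lambda>)" using A_int B_int by auto
    show "\<bar>\<Sum>p\<in>pairs N. c p * (f (w (fst p)) (w (snd p)) - \<mu>)\<bar> \<le> \<bar>A w\<bar> + B w + s * \<Lambda>" if "w \<in> space \<Omega>" for w
      unfolding dec using B_nn[OF that] mult_nonneg_nonneg[OF s0 \<Lambda>] by linarith
  qed
  also have "\<dots> = (\<integral>w. \<bar>A w\<bar> \<partial>\<Omega>) + s * \<Lambda> + s * \<Lambda>"
    using A_int B_int EB by (simp add: \<Omega>.prob_space)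
  also have "\<dots> \<le> 2 * D * sqrt \<Lambda> + D * \<Lambda> + D * \<Lambda>"
    using EA s1 \<Lambda> by (intro add_mono mult_right_mono) auto
  finally show "(\<integral>w. \<bar>\<Sum>p\<in>pairs N. c p * (f (w (fst p)) (w (snd p)) - \<mu>)\<bar> \<partial>\<Omega>) \<le> 2 * D * (sqrt \<Lambda> + \<Lambda>)"
    by (simp add: algebra_simps)
qed

end

section \<open>The conditional variances\<close>

lemma sum_square_pairs:
  fixes F :: "nat \<Rightarrow> nat \<Rightarrow> real"
  assumes sym: "\<And>s t. F s t = F t s"
  shows "(\<Sum>s=1..n. \<Sum>t=1..n. F s t) = (\<Sum>s=1..n. F s s) + 2 * (\<Sum>p\<in>pairs n. F (fst p) (snd p))"
proof (induction n)
  case 0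
  have "pairs 0 = {}" by (auto simp: pairs_def)
  then show ?case by simp
next
  case (Suc n)
  have "(\<Sum>t=1..n. F (Suc n) t) = (\<Sum>s=1..n. F s (Suc n))" by (simp add: sym)
  moreover have "{1..<Suc n} = {1..n}" by auto
  ultimately show ?case using Suc by (simp add: sum_pairs sum.distrib)
qed

lemma sum_pairs_swap:
  fixes f :: "nat \<Rightarrow> nat \<times> nat \<Rightarrow> real"
  shows "(\<Sum>t=1..N. \<Sum>p\<in>pairs (t - 1). f t p) = (\<Sum>p\<in>pairs N. \<Sum>t\<in>{snd p<..N}. f t p)"
proof -
  have "(\<Sum>t\<in>{1..N}. \<Sum>p\<in>pairs (t - 1). f t p) = (\<Sum>t\<in>{1..N}. \<Sum>p | p \<in> pairs N \<and> snd p < t. f t p)"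
    by (intro sum.cong refl) (auto simp: pairs_def)
  also have "\<dots> = (\<Sum>p\<in>pairs N. \<Sum>t | t \<in> {1..N} \<and> snd p < t. f t p)"
    by (rule sum.swap_restrict) auto
  also have "\<dots> = (\<Sum>p\<in>pairs N. \<Sum>t\<in>{snd p<..N}. f t p)"
    by (intro sum.cong refl) (auto simp: pairs_def)
  finally show ?thesis .
qed

context degenerate_kernel
begin

text \<open>Of the order of \<open>E (h\<^sup>2 * min (h\<^sup>2 / N) 1)\<close>, hence of the Lindeberg sum of the normalised terms.\<close>

definition lindeberg :: "nat \<Rightarrow> real" where
  "lindeberg N = real N * (\<integral>z. chi ((h (fst z) (snd z))\<^sup>2 / real N) \<partial>(L \<Otimes>\<^sub>M L))"

text \<open>The fourth power of the Schatten-4 norm of the integral operator with kernel \<open>h\<close>.\<close>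

definition G_sq_norm :: real where
  "G_sq_norm = (\<integral>z. (G (fst z) (snd z))\<^sup>2 \<partial>(L \<Otimes>\<^sub>M L))"

lemma G_sq_norm_nonneg: "0 \<le> G_sq_norm" by (simp add: G_sq_norm_def)

lemma lindeberg_nonneg: "0 \<le> lindeberg N"
  unfolding lindeberg_def by (intro mult_nonneg_nonneg integral_nonneg_AE AE_I2 chi_nonneg) auto

lemma integrable_chi_h: "integrable (L \<Otimes>\<^sub>M L) (\<lambda>z. chi ((h (fst z) (snd z))\<^sup>2 / real N))"
proof -
  interpret LL: pair_prob_space L L ..
  show ?thesis using h_sq_int by (intro LL.P.chi_expectation_le(2)) auto
qed

lemma integrable_chi_G: "integrable L (\<lambda>x. chi (G x x / real N))"
  using integrable_G_diag G_diag_nonneg by (intro chi_expectation_le(2)) auto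

text \<open>Jensen's inequality for the average over the second argument of \<open>h\<close>.\<close>

lemma chi_G_le_lindeberg: "real N * (\<integral>x. chi (G x x / real N) \<partial>L) \<le> lindeberg N"
proof -
  interpret LL: pair_prob_space L L ..
  have i: "integrable (L \<Otimes>\<^sub>M L) (\<lambda>(x, y). chi ((h x y)\<^sup>2 / real N))"
    using integrable_chi_h by (simp add: case_prod_unfold)
  have "(\<integral>x. chi (G x x / real N) \<partial>L) \<le> (\<integral>x. (\<integral>y. chi ((h x y)\<^sup>2 / real N) \<partial>L) \<partial>L)"
  proof (rule integral_mono[OF integrable_chi_G LL.integrable_fst[OF i]])
    fix x assume x: "x \<in> space L"
    have "chi (\<integral>y. (h x y)\<^sup>2 / real N \<partial>L) \<le> (\<integral>y. chi ((h x y)\<^sup>2 / real N) \<partial>L)"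
      using h_sq[OF x] by (intro chi_expectation_le(1)) auto
    then show "chi (G x x / real N) \<le> (\<integral>y. chi ((h x y)\<^sup>2 / real N) \<partial>L)" by (simp add: G_diag)
  qed
  also have "\<dots> = (\<integral>z. chi ((h (fst z) (snd z))\<^sup>2 / real N) \<partial>(L \<Otimes>\<^sub>M L))"
    using LL.integral_fst[OF i] by (simp add: case_prod_unfold)
  finally show ?thesis unfolding lindeberg_def by (intro mult_left_mono) auto
qed

text \<open>Conditional variance of the \<open>t\<close>-th increment, given the first \<open>t - 1\<close> observations.\<close>

definition cond_var :: "(nat \<times> nat \<Rightarrow> real) \<Rightarrow> nat \<Rightarrow> (nat \<Rightarrow> 'x) \<Rightarrow> real" where
  "cond_var b t w = (\<Sum>r=1..<t. \<Sum>s=1..<t. (b (r, t) * b (s, t)) * G (w r) (w s))"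

lemma integral_increment_sq:
  assumes t: "t \<in> {1..N}" and w: "w \<in> space (sample {1..N})"
  shows "(\<integral>y. (\<Sum>s=1..<t. b (s, t) * h ((w(t := y)) s) ((w(t := y)) t))\<^sup>2 \<partial>L) = cond_var b t w"
proof -
  have sp: "w s \<in> space L" if "s \<in> {1..<t}" for s
    using that t w by (intro space_coordinate[of _ "{1..N}"]) auto
  have "(\<integral>y. (\<Sum>s=1..<t. b (s, t) * h ((w(t := y)) s) ((w(t := y)) t))\<^sup>2 \<partial>L)
     = (\<integral>y. (\<Sum>r=1..<t. \<Sum>s=1..<t. (b (r, t) * b (s, t)) * (h (w r) y * h (w s) y)) \<partial>L)"
    by (intro Bochner_Integration.integral_cong refl)
       (auto simp: power2_eq_square sum_product mult_ac intro!: sum.cong)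
  also have "\<dots> = (\<Sum>r=1..<t. \<Sum>s=1..<t. (b (r, t) * b (s, t)) * G (w r) (w s))"
    using sp integrable_hh unfolding G_def
    by (subst Bochner_Integration.integral_sum)
       (auto intro!: Bochner_Integration.integrable_sum sum.cong simp: Bochner_Integration.integral_sum)
  finally show ?thesis by (simp add: cond_var_def)
qed

text \<open>The diagonal terms \<open>G (w s) (w s)\<close> have mean \<open>1\<close> and weights that add up to \<open>1\<close>, so the law of large
  numbers applies. The weights \<open>\<beta>\<close> of the off-diagonal terms are at most \<open>K\<^sup>2 / N\<close>, and orthogonality
  leaves \<open>\<Sum> \<beta>\<^sup>2 * G_sq_norm \<le> K\<^sup>4 * G_sq_norm\<close> for their second moment.\<close>

lemma cond_var_concentration:
  assumes N: "0 < N" and K: "0 \<le> K" and sq_norm: "sq_norm = 1"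
    and b: "\<And>p. p \<in> pairs N \<Longrightarrow> \<bar>b p\<bar> \<le> K / real N"
    and b1: "(\<Sum>p\<in>pairs N. (b p)\<^sup>2) = 1"
  shows "(\<integral>w. \<bar>(\<Sum>t=1..N. cond_var b t w) - 1\<bar> \<partial>sample {1..N}) \<le> 2 * K\<^sup>2 * (sqrt (lindeberg N) + lindeberg N + sqrt G_sq_norm)"
proof -
  define \<Omega> where "\<Omega> = sample {1..N}"
  interpret \<Omega>: prob_space \<Omega> unfolding \<Omega>_def by (rule prob_space_sample)
  interpret LL: pair_prob_space L L ..
  interpret G: degenerate_kernel L G by (rule degenerate_kernel_G)
  have G_sq_norm: "G_sq_norm = G.sq_norm" by (simp add: G_sq_norm_def G.sq_norm_def)
  have N': "0 < real N" using N by simp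
  have pos: "fst p \<in> {1..N} \<and> snd p \<in> {1..N} \<and> fst p < snd p" if "p \<in> pairs N" for p
    using that by (auto simp: pairs_def)
  have bsq: "0 \<le> (b p)\<^sup>2 \<and> (b p)\<^sup>2 \<le> K\<^sup>2 / (real N)\<^sup>2" if "p \<in> pairs N" for p
    using power_mono[OF b[OF that], of 2] by (simp add: power_divide)
  define \<beta> where "\<beta> p = (\<Sum>t\<in>{snd p<..N}. b (fst p, t) * b (snd p, t))" for p
  have \<beta>: "\<bar>\<beta> p\<bar> \<le> K\<^sup>2 / real N" if p: "p \<in> pairs N" for p
  proof -
    have "\<bar>\<beta> p\<bar> \<le> (\<Sum>t\<in>{snd p<..N}. \<bar>b (fst p, t) * b (snd p, t)\<bar>)" unfolding \<beta>_def by (rule sum_abs)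
    also have "\<dots> \<le> (\<Sum>t\<in>{snd p<..N}. (K / real N) * (K / real N))"
      unfolding abs_mult using p K by (intro sum_mono mult_mono b) (auto simp: pairs_def)
    also have "\<dots> = real (N - snd p) * ((K / real N) * (K / real N))" by simp
    also have "\<dots> \<le> real N * ((K / real N) * (K / real N))"
      using K by (intro mult_right_mono) auto
    also have "\<dots> = K\<^sup>2 / real N" using N' by (simp add: power2_eq_square)
    finally show ?thesis .
  qed
  define A where "A w = (\<Sum>p\<in>pairs N. (b p)\<^sup>2 * (G (w (fst p)) (w (fst p)) - 1))" for w
  define C where "C w = (\<Sum>p\<in>pairs N. \<beta> p * G (w (fst p)) (w (snd p)))" for w
  have dec: "(\<Sum>t=1..N. cond_var b t w) - 1 = A w + 2 * C w" for w
  proof -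
    have cv: "cond_var b t w = (\<Sum>s=1..<t. (b (s, t))\<^sup>2 * G (w s) (w s))
        + 2 * (\<Sum>p\<in>pairs (t - 1). (b (fst p, t) * b (snd p, t)) * G (w (fst p)) (w (snd p)))" if "t \<in> {1..N}" for t
    proof -
      have "{1..<t} = {1..t - 1}" using that by auto
      then show ?thesis
        using sum_square_pairs[of "\<lambda>r s. (b (r, t) * b (s, t)) * G (w r) (w s)" "t - 1"]
        by (simp add: cond_var_def power2_eq_square G_sym mult_ac)
    qed
    have "(\<Sum>t=1..N. cond_var b t w) = (\<Sum>t=1..N. \<Sum>s=1..<t. (b (s, t))\<^sup>2 * G (w s) (w s))
        + 2 * (\<Sum>t=1..N. \<Sum>p\<in>pairs (t - 1). (b (fst p, t) * b (snd p, t)) * G (w (fst p)) (w (snd p)))"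
      by (simp add: cv sum.distrib sum_distrib_left)
    also have "(\<Sum>t=1..N. \<Sum>s=1..<t. (b (s, t))\<^sup>2 * G (w s) (w s)) = (\<Sum>p\<in>pairs N. (b p)\<^sup>2 * G (w (fst p)) (w (fst p)))"
      using sum_pairs[of "\<lambda>s t. (b (s, t))\<^sup>2 * G (w s) (w s)" N] by simp
    also have "(\<Sum>t=1..N. \<Sum>p\<in>pairs (t - 1). (b (fst p, t) * b (snd p, t)) * G (w (fst p)) (w (snd p))) = C w"
      unfolding sum_pairs_swap C_def \<beta>_def by (simp add: sum_distrib_right)
    finally show ?thesis using b1 by (simp add: A_def sum_subtractf right_diff_distrib)
  qed
  have diag_int: "integrable (L \<Otimes>\<^sub>M L) (\<lambda>z. G (fst z) (fst z))"
    using integrable_pair_prod[OF integrable_G_diag, of "\<lambda>_. 1"] by simp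
  have diag_mean: "(\<integral>z. G (fst z) (fst z) \<partial>(L \<Otimes>\<^sub>M L)) = 1"
    using LL.integral_fst[of "\<lambda>x y. G x x"] diag_int integral_G_diag sq_norm prob_space
    by (simp add: case_prod_unfold)
  have diag_chi: "(\<integral>z. chi (G (fst z) (fst z) / real N) \<partial>(L \<Otimes>\<^sub>M L)) = (\<integral>x. chi (G x x / real N) \<partial>L)"
    using LL.integral_fst[of "\<lambda>x y. chi (G x x / real N)"]
      integrable_pair_prod[OF integrable_chi_G, of "\<lambda>_. 1"] prob_space
    by (simp add: case_prod_unfold)
  define \<Lambda>' where "\<Lambda>' = real N * (\<integral>x. chi (G x x / real N) \<partial>L)"
  have \<Lambda>': "\<Lambda>' \<le> lindeberg N" unfolding \<Lambda>'_def by (rule chi_G_le_lindeberg)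
  have A_int: "integrable \<Omega> A" and EA: "(\<integral>w. \<bar>A w\<bar> \<partial>\<Omega>) \<le> 2 * K\<^sup>2 * (sqrt \<Lambda>' + \<Lambda>')"
    using pair_average_law_of_large_numbers[of "\<lambda>x y. G x x" N "\<lambda>p. (b p)\<^sup>2" "K\<^sup>2"] G_diag_nonneg diag_int N bsq
    unfolding diag_mean diag_chi \<Lambda>'_def[symmetric] A_def[symmetric] \<Omega>_def[symmetric] by auto
  have C_sq: "integrable \<Omega> (\<lambda>w. (C w)\<^sup>2)" and EC: "(\<integral>w. (C w)\<^sup>2 \<partial>\<Omega>) = (\<Sum>p\<in>pairs N. (\<beta> p)\<^sup>2) * G_sq_norm"
    using G.integrable_sum_h_sq[OF finite_pairs pos] G.integral_sum_h_sq[OF finite_pairs pos]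
    unfolding C_def \<Omega>_def G_sq_norm by auto
  have C_meas: "C \<in> borel_measurable \<Omega>"
    unfolding C_def
  proof (intro borel_measurable_sum borel_measurable_times borel_measurable_const)
    fix p assume "p \<in> pairs N"
    then have "fst p \<in> {1..N}" "snd p \<in> {1..N}" using pos by auto
    then show "(\<lambda>w. G (w (fst p)) (w (snd p))) \<in> borel_measurable \<Omega>"
      unfolding \<Omega>_def by measurable
  qed
  have "(\<Sum>p\<in>pairs N. (\<beta> p)\<^sup>2) \<le> (\<Sum>p\<in>pairs N. (K\<^sup>2 / real N)\<^sup>2)"
  proof (rule sum_mono)
    fix p assume "p \<in> pairs N"
    then show "(\<beta> p)\<^sup>2 \<le> (K\<^sup>2 / real N)\<^sup>2" using power_mono[OF \<beta>[of p], of 2] by simp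
  qed
  also have "\<dots> = real (card (pairs N)) * (K\<^sup>2 / real N)\<^sup>2" by simp
  also have "\<dots> \<le> real (N\<^sup>2) * (K\<^sup>2 / real N)\<^sup>2"
    using card_pairs_le[of N] by (intro mult_right_mono of_nat_mono) auto
  also have "\<dots> = (K\<^sup>2)\<^sup>2" using N' by (simp add: power_divide)
  finally have "(\<integral>w. (C w)\<^sup>2 \<partial>\<Omega>) \<le> (K\<^sup>2)\<^sup>2 * G_sq_norm"
    unfolding EC using G_sq_norm_nonneg by (intro mult_right_mono)
  then have "sqrt (\<integral>w. (C w)\<^sup>2 \<partial>\<Omega>) \<le> K\<^sup>2 * sqrt G_sq_norm"
    using real_sqrt_le_mono[of "\<integral>w. (C w)\<^sup>2 \<partial>\<Omega>" "(K\<^sup>2)\<^sup>2 * G_sq_norm"]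
    by (simp only: real_sqrt_mult real_sqrt_abs) simp
  then have EC': "(\<integral>w. \<bar>C w\<bar> \<partial>\<Omega>) \<le> K\<^sup>2 * sqrt G_sq_norm"
    using \<Omega>.expectation_abs_le_sqrt[OF C_meas C_sq] by linarith
  have C_int: "integrable \<Omega> C"
    by (rule \<Omega>.square_integrable_imp_integrable[OF C_meas C_sq])
  have "(\<integral>w. \<bar>(\<Sum>t=1..N. cond_var b t w) - 1\<bar> \<partial>\<Omega>) \<le> (\<integral>w. \<bar>A w\<bar> + 2 * \<bar>C w\<bar> \<partial>\<Omega>)"
    unfolding dec using A_int C_int by (intro integral_mono) auto
  also have "\<dots> = (\<integral>w. \<bar>A w\<bar> \<partial>\<Omega>) + 2 * (\<integral>w. \<bar>C w\<bar> \<partial>\<Omega>)"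
    using A_int C_int by simp
  also have "\<dots> \<le> 2 * K\<^sup>2 * (sqrt \<Lambda>' + \<Lambda>') + 2 * (K\<^sup>2 * sqrt G_sq_norm)"
    using EA EC' by linarith
  also have "\<dots> \<le> 2 * K\<^sup>2 * (sqrt (lindeberg N) + lindeberg N) + 2 * (K\<^sup>2 * sqrt G_sq_norm)"
    using \<Lambda>' by (intro add_mono mult_left_mono real_sqrt_le_mono) auto
  finally show ?thesis by (simp add: \<Omega>_def algebra_simps)
qed

end

section \<open>The Lindeberg condition\<close>

text \<open>The derivative of \<open>x \<mapsto> chi (x\<^sup>2)\<close>.\<close>

definition chi_sq_deriv :: "real \<Rightarrow> real" where "chi_sq_deriv x = 2 * x - 2 * x / (1 + x\<^sup>2)\<^sup>2"

lemma measurable_chi_sq_deriv [measurable]: "chi_sq_deriv \<in> borel_measurable borel"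
  unfolding chi_sq_deriv_def by measurable

lemma abs_chi_sq_deriv_le: "\<bar>chi_sq_deriv x\<bar> \<le> 2 * \<bar>x\<bar>"
proof -
  have "chi_sq_deriv x = 2 * x * (1 - 1 / (1 + x\<^sup>2)\<^sup>2)" by (simp add: chi_sq_deriv_def algebra_simps)
  moreover have "1 / (1 + x\<^sup>2)\<^sup>2 \<le> 1"
    using one_le_power[of "1 + x\<^sup>2" 2] by (simp add: divide_le_eq_1)
  ultimately show ?thesis
    by (auto simp: abs_mult intro!: mult_left_le)
qed

text \<open>The second derivative of \<open>x \<mapsto> chi (x\<^sup>2)\<close> is at most a multiple of \<open>min (x\<^sup>2) 1\<close>. Instead of Taylor's
  formula, the remainder is computed exactly as \<open>y\<^sup>2 * T\<close> with a rational function \<open>T\<close>, which is then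
  bounded by \<open>16 * (min (S\<^sup>2) 1 + min (y\<^sup>2) 1)\<close>.\<close>

lemma chi_square_increment:
  "chi ((S + y)\<^sup>2) \<le> chi (S\<^sup>2) + chi_sq_deriv S * y + 16 * (min (S\<^sup>2) 1 * y\<^sup>2) + 32 * chi (y\<^sup>2)"
proof -
  define A where "A = 1 + S\<^sup>2"
  define B where "B = 1 + (S + y)\<^sup>2"
  define T where "T = 1 + (3 * S\<^sup>2 - 1 + 2 * S * y) / (A\<^sup>2 * B)"
  have A1: "1 \<le> A" and B1: "1 \<le> B" by (simp_all add: A_def B_def)
  have A2: "A \<le> A\<^sup>2" using A1 self_le_power[of A 2] by simp
  have AB1: "1 \<le> A\<^sup>2 * B" using A1 A2 B1 mult_mono[of 1 "A\<^sup>2" 1 B] by simp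
  have ex: "chi ((S + y)\<^sup>2) - chi (S\<^sup>2) - chi_sq_deriv S * y = y\<^sup>2 * T"
  proof -
    have By: "B = A + 2 * S * y + y\<^sup>2" by (simp add: A_def B_def power2_eq_square algebra_simps)
    have c1: "chi ((S + y)\<^sup>2) = B - 2 + 1 / B" and c2: "chi (S\<^sup>2) = A - 2 + 1 / A"
      by (simp_all add: chi_eq A_def B_def)
    have "chi ((S + y)\<^sup>2) - chi (S\<^sup>2) - chi_sq_deriv S * y = y\<^sup>2 + (1 / B - 1 / A + 2 * S * y / A\<^sup>2)"
      unfolding c1 c2 chi_sq_deriv_def A_def[symmetric] using By A1 by (simp add: algebra_simps)
    also have "1 / B - 1 / A + 2 * S * y / A\<^sup>2 = y\<^sup>2 * (3 * S\<^sup>2 - 1 + 2 * S * y) / (A\<^sup>2 * B)"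
    proof -
      have "1 / B - 1 / A + 2 * S * y / A\<^sup>2 = (A\<^sup>2 - A * B + 2 * S * y * B) / (A\<^sup>2 * B)"
        using A1 B1 by (simp add: divide_simps power2_eq_square) (simp add: algebra_simps)
      also have "A\<^sup>2 - A * B + 2 * S * y * B = y\<^sup>2 * (3 * S\<^sup>2 - 1 + 2 * S * y)"
        unfolding By by (simp add: A_def power2_eq_square algebra_simps)
      finally show ?thesis .
    qed
    finally show ?thesis by (simp add: T_def algebra_simps)
  qed
  have T: "T \<le> 16 * (min (S\<^sup>2) 1 + min (y\<^sup>2) 1)"
  proof (cases "S\<^sup>2 \<le> 1 \<and> y\<^sup>2 \<le> 1")
    case True
    have s: "S\<^sup>2 \<le> 1" and y: "y\<^sup>2 \<le> 1" using True by auto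
    have "S\<^sup>2 * S\<^sup>2 \<le> S\<^sup>2" using s mult_left_le_one_le[of "S\<^sup>2" "S\<^sup>2"] by simp
    then have Asq: "A\<^sup>2 \<le> 1 + 3 * S\<^sup>2" by (simp add: A_def power2_eq_square algebra_simps)
    have xy: "2 * S * y \<le> S\<^sup>2 + y\<^sup>2" by (rule sum_squares_bound)
    have Bb: "B - 1 \<le> 2 * S\<^sup>2 + 2 * y\<^sup>2" using xy by (simp add: B_def power2_eq_square algebra_simps)
    have "A\<^sup>2 * (B - 1) \<le> 4 * (2 * S\<^sup>2 + 2 * y\<^sup>2)"
      using Asq s Bb B1 by (intro mult_mono) auto
    then have "A\<^sup>2 * B \<le> A\<^sup>2 + 8 * S\<^sup>2 + 8 * y\<^sup>2" by (simp add: algebra_simps)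
    then have num: "A\<^sup>2 * B - 1 + 3 * S\<^sup>2 + 2 * S * y \<le> 16 * (S\<^sup>2 + y\<^sup>2)"
      using Asq xy zero_le_power2[of y] zero_le_power2[of S] unfolding distrib_left by linarith
    have "T = (A\<^sup>2 * B - 1 + 3 * S\<^sup>2 + 2 * S * y) / (A\<^sup>2 * B)"
      using A1 B1 by (simp add: T_def divide_simps)
    also have "\<dots> \<le> 16 * (S\<^sup>2 + y\<^sup>2) / (A\<^sup>2 * B)"
      using num AB1 by (intro divide_right_mono) auto
    also have "\<dots> \<le> 16 * (S\<^sup>2 + y\<^sup>2) / 1"
      using AB1 by (intro divide_left_mono) auto
    finally show ?thesis using s y by simp
  next
    case False
    have "0 \<le> (S - (S + y))\<^sup>2" by simp
    then have "3 * S\<^sup>2 - 1 + 2 * S * y \<le> 2 * A + B"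
      using zero_le_power2[of S] zero_le_power2[of "S + y"] zero_le_power2[of y]
      by (simp add: A_def B_def power2_eq_square algebra_simps)
    also have "\<dots> \<le> 3 * (A\<^sup>2 * B)"
    proof -
      have "A * 1 \<le> A\<^sup>2 * B" using A1 A2 B1 by (intro mult_mono) auto
      moreover have "1 * B \<le> A\<^sup>2 * B" using A1 A2 B1 by (intro mult_right_mono) auto
      ultimately show ?thesis by simp
    qed
    finally have "(3 * S\<^sup>2 - 1 + 2 * S * y) / (A\<^sup>2 * B) \<le> 3"
      using AB1 by (subst pos_divide_le_eq) auto
    then have "T \<le> 16 * 1" by (simp add: T_def)
    also have "\<dots> \<le> 16 * (min (S\<^sup>2) 1 + min (y\<^sup>2) 1)"
      using False by (intro mult_left_mono) auto
    finally show ?thesis .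
  qed
  have "min a 1 * a \<le> 2 * chi a" if a: "0 \<le> a" for a
  proof -
    have "min a 1 * (1 + a) \<le> 2 * a"
      using a mult_left_le_one_le[of a a] by (cases "a \<le> 1") (auto simp: distrib_left)
    then have "min a 1 * (1 + a) * a / (1 + a) \<le> 2 * a * a / (1 + a)"
      using a by (intro divide_right_mono mult_right_mono) auto
    then show ?thesis using a by (simp add: chi_def power2_eq_square)
  qed
  from this[of "y\<^sup>2"] have "min (y\<^sup>2) 1 * y\<^sup>2 \<le> 2 * chi (y\<^sup>2)" by simp
  moreover have "y\<^sup>2 * T \<le> y\<^sup>2 * (16 * (min (S\<^sup>2) 1 + min (y\<^sup>2) 1))" using T by (intro mult_left_mono) auto
  ultimately show ?thesis using ex by (simp add: algebra_simps)
qed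

context degenerate_kernel
begin

text \<open>In the expanded square, a mixed term contains \<open>h (w s) (w t)\<close> as its only factor that depends on
  \<open>w s\<close>, so it averages to zero; the square of this factor averages to \<open>G (w t) (w t)\<close>.\<close>

lemma weighted_second_moment:
  fixes g :: "'x \<Rightarrow> real"
  assumes t: "t \<in> I" and F: "finite F" "F \<subseteq> I - {t}"
    and g_meas [measurable]: "g \<in> borel_measurable L"
    and g: "\<And>x. x \<in> space L \<Longrightarrow> 0 \<le> g x \<and> g x \<le> C"
  shows "integrable (sample I) (\<lambda>w. (\<Sum>s\<in>F. \<beta> s * h (w s) (w t))\<^sup>2 * g (w t))"
    and "(\<integral>w. (\<Sum>s\<in>F. \<beta> s * h (w s) (w t))\<^sup>2 * g (w t) \<partial>sample I) = (\<Sum>s\<in>F. (\<beta> s)\<^sup>2) * (\<integral>x. g x * G x x \<partial>L)"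
proof -
  have F': "s \<in> I" "s \<noteq> t" if "s \<in> F" for s using F that by auto
  have gb: "\<bar>g (w t)\<bar> \<le> C" if "w \<in> space (sample I)" for w
    using g[OF space_coordinate[OF t that]] by auto
  have eq: "(\<Sum>s\<in>F. \<beta> s * h (w s) (w t))\<^sup>2 * g (w t)
     = (\<Sum>r\<in>F. \<Sum>s\<in>F. (\<beta> r * \<beta> s) * (g (w t) * h (w r) (w t) * h (w s) (w t)))" for w
    by (simp only: power2_eq_square sum_product) (simp add: sum_distrib_left mult_ac)
  have int: "integrable (sample I) (\<lambda>w. g (w t) * h (w r) (w t) * h (w s) (w t))" if rs: "r \<in> F" "s \<in> F" for r s
  proof (rule Bochner_Integration.integrable_bound[where f = "\<lambda>w. C * (h (w r) (w t) * h (w s) (w t))"])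
    show "integrable (sample I) (\<lambda>w. C * (h (w r) (w t) * h (w s) (w t)))"
      using F'[OF rs(1)] F'[OF rs(2)] t by (intro integrable_mult_right integrable_h_prod) auto
    show "(\<lambda>w. g (w t) * h (w r) (w t) * h (w s) (w t)) \<in> borel_measurable (sample I)"
      using F'[OF rs(1)] F'[OF rs(2)] t by measurable
    show "AE w in sample I. norm (g (w t) * h (w r) (w t) * h (w s) (w t)) \<le> norm (C * (h (w r) (w t) * h (w s) (w t)))"
    proof (rule AE_I2)
      fix w assume "w \<in> space (sample I)"
      from gb[OF this] have "\<bar>g (w t)\<bar> \<le> \<bar>C\<bar>" by linarith
      then show "norm (g (w t) * h (w r) (w t) * h (w s) (w t)) \<le> norm (C * (h (w r) (w t) * h (w s) (w t)))"
        by (simp add: abs_mult mult.assoc mult_right_mono)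
    qed
  qed
  have val: "(\<integral>w. g (w t) * h (w r) (w t) * h (w s) (w t) \<partial>sample I) = (if r = s then \<integral>x. g x * G x x \<partial>L else 0)"
    if rs: "r \<in> F" "s \<in> F" for r s
  proof (cases "r = s")
    case False
    have "(\<integral>w. g (w t) * h (w r) (w t) * h (w t) (w s) \<partial>sample I) = 0"
    proof (rule integral_mult_degenerate)
      show "integrable (sample I) (\<lambda>w. g (w t) * h (w r) (w t) * h (w t) (w s))"
        by (rule Bochner_Integration.integrable_cong[THEN iffD1, OF refl _ int[OF rs]])
           (use F'[OF rs(2)] t h_sym space_coordinate[of _ I] in auto)
    qed (use F'[OF rs(1)] F'[OF rs(2)] t False in auto)
    moreover have "(\<integral>w. g (w t) * h (w r) (w t) * h (w t) (w s) \<partial>sample I)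
        = (\<integral>w. g (w t) * h (w r) (w t) * h (w s) (w t) \<partial>sample I)"
      using F'[OF rs(2)] t h_sym space_coordinate[of _ I]
      by (intro Bochner_Integration.integral_cong) auto
    ultimately show ?thesis using False by simp
  next
    case True
    have "(\<integral>w. g (w t) * (h (w s) (w t))\<^sup>2 \<partial>sample I) = (\<integral>w. g (w t) * G (w t) (w t) \<partial>sample I)"
    proof (rule integral_integrate_out[OF F'(1)[OF rs(2)]])
      show "integrable (sample I) (\<lambda>w. g (w t) * (h (w s) (w t))\<^sup>2)"
        using int[OF rs(2,2)] by (simp add: power2_eq_square mult.assoc)
      show "(\<integral>y. (h ((w(s := y)) s) ((w(s := y)) t))\<^sup>2 \<partial>L) = G (w t) (w t)" if "w \<in> space (sample I)" for w
      proof -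
        have "(\<integral>y. (h y (w t))\<^sup>2 \<partial>L) = (\<integral>y. (h (w t) y)\<^sup>2 \<partial>L)"
          using h_sym space_coordinate[OF t that] by (intro Bochner_Integration.integral_cong) auto
        then show ?thesis using F'(2)[OF rs(2)] by (simp add: G_diag)
      qed
    qed (use F'[OF rs(2)] in auto)
    also have "\<dots> = (\<integral>x. g x * G x x \<partial>L)"
      by (rule integral_one_coordinate[OF t]) measurable
    finally show ?thesis using True by (simp add: power2_eq_square mult.assoc)
  qed
  show "integrable (sample I) (\<lambda>w. (\<Sum>s\<in>F. \<beta> s * h (w s) (w t))\<^sup>2 * g (w t))"
    unfolding eq using int by (intro Bochner_Integration.integrable_sum integrable_mult_right)
  have "(\<integral>w. (\<Sum>s\<in>F. \<beta> s * h (w s) (w t))\<^sup>2 * g (w t) \<partial>sample I)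
     = (\<Sum>r\<in>F. \<Sum>s\<in>F. (\<beta> r * \<beta> s) * (\<integral>w. g (w t) * h (w r) (w t) * h (w s) (w t) \<partial>sample I))"
    unfolding eq using int
    by (subst Bochner_Integration.integral_sum)
       (auto intro!: Bochner_Integration.integrable_sum sum.cong simp: Bochner_Integration.integral_sum)
  also have "\<dots> = (\<Sum>r\<in>F. \<Sum>s\<in>F. if r = s then (\<beta> r)\<^sup>2 * (\<integral>x. g x * G x x \<partial>L) else 0)"
    by (intro sum.cong refl) (auto simp: val power2_eq_square)
  also have "\<dots> = (\<Sum>s\<in>F. (\<beta> s)\<^sup>2) * (\<integral>x. g x * G x x \<partial>L)"
    using F(1) by (simp add: sum.delta' sum_distrib_right)
  finally show "(\<integral>w. (\<Sum>s\<in>F. \<beta> s * h (w s) (w t))\<^sup>2 * g (w t) \<partial>sample I) = (\<Sum>s\<in>F. (\<beta> s)\<^sup>2) * (\<integral>x. g x * G x x \<partial>L)" .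
qed

lemma increment_square_integrable:
  assumes t: "t \<in> I" and F: "finite F" "F \<subseteq> I - {t}"
  shows "integrable (sample I) (\<lambda>w. (\<Sum>s\<in>F. \<beta> s * h (w s) (w t))\<^sup>2)"
    and "(\<integral>w. (\<Sum>s\<in>F. \<beta> s * h (w s) (w t))\<^sup>2 \<partial>sample I) = (\<Sum>s\<in>F. (\<beta> s)\<^sup>2) * sq_norm"
  using weighted_second_moment[OF assms, of "\<lambda>_. 1" 1 \<beta>] integral_G_diag by auto

text \<open>After averaging over \<open>w s\<close> the integrand is \<open>min (S\<^sup>2) 1 * G (w t) (w t)\<close>. A second moment of
  \<open>G (w t) (w t)\<close> need not exist, so \<open>G\<close> is split into the bounded part \<open>g = G / (1 + G / N)\<close>, against which
  \<open>S\<^sup>2\<close> can be integrated, and \<open>N * chi (G / N)\<close>, for which the bound \<open>1\<close> on the first factor suffices.\<close>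

lemma truncated_variance_mass:
  assumes N: "0 < N" and t: "t \<in> I" and s: "s \<in> I" "s \<noteq> t" and F: "finite F" "F \<subseteq> I - {t, s}"
    and K: "0 \<le> K" and \<beta>: "(\<Sum>r\<in>F. (\<beta> r)\<^sup>2) \<le> K\<^sup>2 / real N"
  defines "S \<equiv> \<lambda>w. \<Sum>r\<in>F. \<beta> r * h (w r) (w t)"
  shows "integrable (sample I) (\<lambda>w. min ((S w)\<^sup>2) 1 * (h (w s) (w t))\<^sup>2)"
    and "(\<integral>w. min ((S w)\<^sup>2) 1 * (h (w s) (w t))\<^sup>2 \<partial>sample I) \<le> (K\<^sup>2 + 1) * lindeberg N"
proof -
  have N': "0 < real N" using N by simp
  define g where "g x = G x x / (1 + G x x / real N)" for x
  have [measurable]: "(\<lambda>x. G x x) \<in> borel_measurable L" by measurable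
  have [measurable]: "g \<in> borel_measurable L" unfolding g_def by measurable
  have g: "0 \<le> g x \<and> g x \<le> real N" and g_dec: "G x x = g x + real N * chi (G x x / real N)"
    and gG: "g x * G x x = (real N)\<^sup>2 * chi (G x x / real N)" for x
  proof -
    define a where "a = G x x / real N"
    have a: "0 \<le> a" using G_diag_nonneg[of x] by (simp add: a_def)
    have Ga: "G x x = real N * a" using N' by (simp add: a_def)
    have ga: "g x = real N * (a / (1 + a))" unfolding g_def a_def[symmetric] by (simp add: Ga)
    have "real N * (a / (1 + a)) \<le> real N * 1" using a by (intro mult_left_mono) auto
    then show "0 \<le> g x \<and> g x \<le> real N" using a by (simp add: ga)
    have "a = a / (1 + a) + chi a" using a by (simp add: chi_eq divide_simps) (simp add: algebra_simps)
    then have "real N * a = real N * (a / (1 + a)) + real N * chi a" by (metis distrib_left)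
    then show "G x x = g x + real N * chi (G x x / real N)" using N' by (simp add: ga Ga)
    show "g x * G x x = (real N)\<^sup>2 * chi (G x x / real N)"
      unfolding a_def[symmetric] ga by (simp add: Ga chi_def power2_eq_square)
  qed
  have S_meas [measurable]: "S \<in> borel_measurable (sample I)"
    unfolding S_def using F t
    by (intro borel_measurable_sum borel_measurable_times borel_measurable_const h_comp measurable_coordinate) auto
  show int: "integrable (sample I) (\<lambda>w. min ((S w)\<^sup>2) 1 * (h (w s) (w t))\<^sup>2)"
  proof (rule Bochner_Integration.integrable_bound[OF integrable_h_sq[OF s(1) t s(2)]])
    show "(\<lambda>w. min ((S w)\<^sup>2) 1 * (h (w s) (w t))\<^sup>2) \<in> borel_measurable (sample I)"
      using s t by measurable
  qed (auto simp: abs_mult intro!: AE_I2 mult_left_le_one_le)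
  have out: "(\<integral>w. min ((S w)\<^sup>2) 1 * (h (w s) (w t))\<^sup>2 \<partial>sample I) = (\<integral>w. min ((S w)\<^sup>2) 1 * G (w t) (w t) \<partial>sample I)"
    and out_int: "integrable (sample I) (\<lambda>w. min ((S w)\<^sup>2) 1 * G (w t) (w t))"
  proof -
    have B: "min ((S (w(s := y)))\<^sup>2) 1 = min ((S w)\<^sup>2) 1" for w y
    proof -
      have "S (w(s := y)) = S w" unfolding S_def using F s by (intro sum.cong refl) auto
      then show ?thesis by simp
    qed
    have o: "(\<integral>y. (h ((w(s := y)) s) ((w(s := y)) t))\<^sup>2 \<partial>L) = G (w t) (w t)" if "w \<in> space (sample I)" for w
    proof -
      have "(\<integral>y. (h y (w t))\<^sup>2 \<partial>L) = (\<integral>y. (h (w t) y)\<^sup>2 \<partial>L)"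
        using h_sym space_coordinate[OF t that] by (intro Bochner_Integration.integral_cong) auto
      then show ?thesis using s by (simp add: G_diag)
    qed
    show "(\<integral>w. min ((S w)\<^sup>2) 1 * (h (w s) (w t))\<^sup>2 \<partial>sample I) = (\<integral>w. min ((S w)\<^sup>2) 1 * G (w t) (w t) \<partial>sample I)"
      by (rule integral_integrate_out[OF s(1) int B o])
    show "integrable (sample I) (\<lambda>w. min ((S w)\<^sup>2) 1 * G (w t) (w t))"
      by (rule integrable_integrate_out[OF s(1) int B o])
  qed
  have F_t: "F \<subseteq> I - {t}" using F by auto
  have W: "integrable (sample I) (\<lambda>w. (S w)\<^sup>2 * g (w t))"
    "(\<integral>w. (S w)\<^sup>2 * g (w t) \<partial>sample I) = (\<Sum>r\<in>F. (\<beta> r)\<^sup>2) * (\<integral>x. g x * G x x \<partial>L)"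
    using weighted_second_moment[OF t F(1) F_t, of g "real N" \<beta>] g by (simp_all add: S_def)
  have chi_int: "integrable (sample I) (\<lambda>w. chi (G (w t) (w t) / real N))"
    using integrable_one_coordinate[OF t, of "\<lambda>x. chi (G x x / real N)"] integrable_chi_G by simp
  have chi_E: "(\<integral>w. chi (G (w t) (w t) / real N) \<partial>sample I) = (\<integral>x. chi (G x x / real N) \<partial>L)"
    by (rule integral_one_coordinate[OF t]) measurable
  have "(\<integral>w. min ((S w)\<^sup>2) 1 * G (w t) (w t) \<partial>sample I)
      \<le> (\<integral>w. (S w)\<^sup>2 * g (w t) + real N * chi (G (w t) (w t) / real N) \<partial>sample I)"
  proof (rule integral_mono[OF out_int])
    show "integrable (sample I) (\<lambda>w. (S w)\<^sup>2 * g (w t) + real N * chi (G (w t) (w t) / real N))"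
      using W(1) g chi_int by (intro Bochner_Integration.integrable_add integrable_mult_right) auto
    fix w
    have "min ((S w)\<^sup>2) 1 * G (w t) (w t)
        = min ((S w)\<^sup>2) 1 * g (w t) + min ((S w)\<^sup>2) 1 * (real N * chi (G (w t) (w t) / real N))"
      by (subst g_dec) (rule distrib_left)
    also have "\<dots> \<le> (S w)\<^sup>2 * g (w t) + 1 * (real N * chi (G (w t) (w t) / real N))"
      using g[of "w t"] G_diag_nonneg[of "w t"] by (intro add_mono mult_right_mono) (auto intro!: mult_nonneg_nonneg chi_nonneg)
    finally show "min ((S w)\<^sup>2) 1 * G (w t) (w t) \<le> (S w)\<^sup>2 * g (w t) + real N * chi (G (w t) (w t) / real N)" by simp
  qed
  also have "\<dots> = (\<Sum>r\<in>F. (\<beta> r)\<^sup>2) * (\<integral>x. g x * G x x \<partial>L) + real N * (\<integral>x. chi (G x x / real N) \<partial>L)"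
    using W g chi_int by (simp add: chi_E)
  also have "(\<integral>x. g x * G x x \<partial>L) = real N * (real N * (\<integral>x. chi (G x x / real N) \<partial>L))"
    unfolding gG by (simp add: power2_eq_square)
  also have "(\<Sum>r\<in>F. (\<beta> r)\<^sup>2) * (real N * (real N * (\<integral>x. chi (G x x / real N) \<partial>L))) + real N * (\<integral>x. chi (G x x / real N) \<partial>L)
     \<le> (K\<^sup>2 / real N) * (real N * lindeberg N) + lindeberg N"
    using \<beta> chi_G_le_lindeberg[of N] lindeberg_nonneg[of N]
    by (intro add_mono mult_mono mult_left_mono) (auto intro!: mult_nonneg_nonneg integral_nonneg_AE AE_I2 chi_nonneg divide_nonneg_nonneg G_diag_nonneg)
  also have "\<dots> = (K\<^sup>2 + 1) * lindeberg N" using N' by (simp add: algebra_simps)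
  finally show "(\<integral>w. min ((S w)\<^sup>2) 1 * (h (w s) (w t))\<^sup>2 \<partial>sample I) \<le> (K\<^sup>2 + 1) * lindeberg N" unfolding out .
qed

text \<open>The argument is at most \<open>K\<^sup>2 / N\<close> times \<open>h\<^sup>2 / N\<close>; \<open>chi\<close> grows at most quadratically in the factor \<open>K\<^sup>2 \<ge> 1\<close>
  and, being convex, shrinks at least linearly in the factor \<open>1 / N\<close>.\<close>

lemma chi_single_term:
  assumes N: "0 < N" and st: "s \<in> I" "t \<in> I" "s \<noteq> t" and K: "1 \<le> K" and c: "\<bar>c\<bar> \<le> K / real N"
  shows "integrable (sample I) (\<lambda>w. chi ((c * h (w s) (w t))\<^sup>2))"
    and "(\<integral>w. chi ((c * h (w s) (w t))\<^sup>2) \<partial>sample I) \<le> K ^ 4 * lindeberg N / (real N)\<^sup>2"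
proof -
  interpret S: prob_space "sample I" by (rule prob_space_sample)
  have N': "0 < real N" using N by simp
  show i: "integrable (sample I) (\<lambda>w. chi ((c * h (w s) (w t))\<^sup>2))"
    using integrable_h_sq[OF st] by (intro S.chi_expectation_le(2)) (auto simp: power_mult_distrib)
  have ic: "integrable (sample I) (\<lambda>w. chi ((h (w s) (w t))\<^sup>2 / real N))"
    using integrable_two_coordinates[OF st, of "\<lambda>z. chi ((h (fst z) (snd z))\<^sup>2 / real N)"] integrable_chi_h[of N] by simp
  have "(\<integral>w. chi ((c * h (w s) (w t))\<^sup>2) \<partial>sample I) \<le> (\<integral>w. (K ^ 4 / real N) * chi ((h (w s) (w t))\<^sup>2 / real N) \<partial>sample I)"
  proof (rule integral_mono[OF i])
    show "integrable (sample I) (\<lambda>w. (K ^ 4 / real N) * chi ((h (w s) (w t))\<^sup>2 / real N))" using ic by simp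
    fix w
    define a where "a = (h (w s) (w t))\<^sup>2 / real N"
    have a: "0 \<le> a" by (simp add: a_def)
    have "c\<^sup>2 \<le> (K / real N)\<^sup>2" using power_mono[OF c, of 2] by simp
    then have "(c * h (w s) (w t))\<^sup>2 \<le> (K / real N)\<^sup>2 * (h (w s) (w t))\<^sup>2"
      by (simp add: power_mult_distrib mult_right_mono)
    also have "\<dots> = K\<^sup>2 * ((1 / real N) * a)" by (simp add: a_def power_divide power2_eq_square)
    finally have "chi ((c * h (w s) (w t))\<^sup>2) \<le> chi (K\<^sup>2 * ((1 / real N) * a))" by (intro chi_mono) auto
    also have "\<dots> \<le> (K\<^sup>2)\<^sup>2 * chi ((1 / real N) * a)"
      using K a N' one_le_power[OF K, of 2] by (intro chi_scale_up) auto
    also have "\<dots> \<le> (K\<^sup>2)\<^sup>2 * ((1 / real N) * chi a)"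
      using a N by (intro mult_left_mono chi_scale_down) auto
    finally show "chi ((c * h (w s) (w t))\<^sup>2) \<le> (K ^ 4 / real N) * chi ((h (w s) (w t))\<^sup>2 / real N)"
      by (simp add: a_def)
  qed
  also have "\<dots> = (K ^ 4 / real N) * (lindeberg N / real N)"
    using integral_two_coordinates[OF st, of "\<lambda>z. chi ((h (fst z) (snd z))\<^sup>2 / real N)"] h_meas N' by (simp add: lindeberg_def)
  finally show "(\<integral>w. chi ((c * h (w s) (w t))\<^sup>2) \<partial>sample I) \<le> K ^ 4 * lindeberg N / (real N)\<^sup>2"
    by (simp add: power2_eq_square)
qed

text \<open>The sum is built up one term at a time. The first-order term of the expansion vanishes in the mean,
  because the preceding partial sum does not see the new coordinate.\<close>

lemma chi_increment_le:
  assumes N: "0 < N" and t: "t \<in> {1..N}" and K: "1 \<le> K"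
    and b: "\<And>s. s \<in> {1..<t} \<Longrightarrow> \<bar>\<beta> s\<bar> \<le> K / real N" and j: "j < t"
  shows "(\<integral>w. chi ((\<Sum>s=1..j. \<beta> s * h (w s) (w t))\<^sup>2) \<partial>sample {1..N})
    \<le> (\<Sum>s=1..j. 16 * ((\<beta> s)\<^sup>2 * ((K\<^sup>2 + 1) * lindeberg N)) + 32 * (K ^ 4 * lindeberg N / (real N)\<^sup>2))"
  using j
proof (induction j)
  case 0
  then show ?case by simp
next
  case (Suc j)
  let ?\<Omega> = "sample {1..N}"
  interpret \<Omega>: prob_space ?\<Omega> by (rule prob_space_sample)
  have N': "0 < real N" using N by simp
  define s where "s = Suc j"
  define S where "S w = (\<Sum>r=1..j. \<beta> r * h (w r) (w t))" for w
  have s: "s \<in> {1..N}" "s \<noteq> t" "s \<in> {1..<t}" using Suc.prems t by (auto simp: s_def)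
  have F: "{1..j} \<subseteq> {1..N} - {t, s}" "{1..j} \<subseteq> {1..N} - {t}" using Suc.prems t by (auto simp: s_def)
  have S_meas [measurable]: "S \<in> borel_measurable ?\<Omega>"
    unfolding S_def using F t
    by (intro borel_measurable_sum borel_measurable_times borel_measurable_const h_comp measurable_coordinate) auto
  have hst_meas [measurable]: "(\<lambda>w. h (w s) (w t)) \<in> borel_measurable ?\<Omega>" using s t by measurable
  have S_sq: "integrable ?\<Omega> (\<lambda>w. (S w)\<^sup>2)"
    unfolding S_def by (rule increment_square_integrable(1)[OF t finite_atLeastAtMost F(2)])
  have S'_sq: "integrable ?\<Omega> (\<lambda>w. (\<Sum>r=1..Suc j. \<beta> r * h (w r) (w t))\<^sup>2)"
    using Suc.prems t by (intro increment_square_integrable(1)) auto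
  have h_sq': "integrable ?\<Omega> (\<lambda>w. (h (w s) (w t))\<^sup>2)" by (rule integrable_h_sq[OF s(1) t s(2)])
  have sumb: "(\<Sum>r=1..j. (\<beta> r)\<^sup>2) \<le> K\<^sup>2 / real N"
  proof -
    have "(\<Sum>r=1..j. (\<beta> r)\<^sup>2) \<le> (\<Sum>r=1..j. (K / real N)\<^sup>2)"
    proof (rule sum_mono)
      fix r assume "r \<in> {1..j}"
      then show "(\<beta> r)\<^sup>2 \<le> (K / real N)\<^sup>2" using Suc.prems power_mono[OF b[of r], of 2] by simp
    qed
    also have "\<dots> = real j * (K / real N)\<^sup>2" by simp
    also have "\<dots> \<le> real N * (K / real N)\<^sup>2" using Suc.prems t by (intro mult_right_mono) auto
    also have "\<dots> = K\<^sup>2 / real N" using N' by (simp add: power2_eq_square)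
    finally show ?thesis .
  qed
  have K0: "0 \<le> K" using K by simp
  note T = truncated_variance_mass[OF N t s(1,2) finite_atLeastAtMost F(1) K0 sumb, folded S_def]
  note C = chi_single_term[OF N s(1) t s(2) K b[OF s(3)]]
  have D_int: "integrable ?\<Omega> (\<lambda>w. chi_sq_deriv (S w) * h (w s) (w t))"
  proof (rule Bochner_Integration.integrable_bound[where f = "\<lambda>w. 2 * ((S w)\<^sup>2 + (h (w s) (w t))\<^sup>2)"])
    show "integrable ?\<Omega> (\<lambda>w. 2 * ((S w)\<^sup>2 + (h (w s) (w t))\<^sup>2))" using S_sq h_sq' by auto
    show "AE w in ?\<Omega>. norm (chi_sq_deriv (S w) * h (w s) (w t)) \<le> norm (2 * ((S w)\<^sup>2 + (h (w s) (w t))\<^sup>2))"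
    proof (rule AE_I2)
      fix w
      have "\<bar>chi_sq_deriv (S w)\<bar> * \<bar>h (w s) (w t)\<bar> \<le> (2 * \<bar>S w\<bar>) * \<bar>h (w s) (w t)\<bar>"
        by (intro mult_right_mono abs_chi_sq_deriv_le) simp
      also have "\<dots> = 2 * \<bar>S w * h (w s) (w t)\<bar>" by (simp add: abs_mult)
      also have "\<dots> \<le> 2 * ((S w)\<^sup>2 + (h (w s) (w t))\<^sup>2)" by (intro mult_left_mono abs_mult_le_squares) simp
      finally show "norm (chi_sq_deriv (S w) * h (w s) (w t)) \<le> norm (2 * ((S w)\<^sup>2 + (h (w s) (w t))\<^sup>2))"
        by (simp add: abs_mult)
    qed
  qed measurable
  have D0: "(\<integral>w. chi_sq_deriv (S w) * h (w s) (w t) \<partial>?\<Omega>) = 0"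
  proof -
    have eq: "chi_sq_deriv (S w) * h (w s) (w t) = chi_sq_deriv (S w) * h (w t) (w s)" if "w \<in> space ?\<Omega>" for w
      using h_sym[of "w s" "w t"] space_coordinate[OF s(1) that] space_coordinate[OF t that] by simp
    have z: "(\<integral>w. chi_sq_deriv (S w) * h (w t) (w s) \<partial>?\<Omega>) = 0"
    proof (rule integral_mult_degenerate)
      show "integrable ?\<Omega> (\<lambda>w. chi_sq_deriv (S w) * h (w t) (w s))"
        using D_int eq by (subst (asm) Bochner_Integration.integrable_cong) auto
      show "chi_sq_deriv (S (w(s := y))) = chi_sq_deriv (S w)" for w y
      proof -
        have "S (w(s := y)) = S w" unfolding S_def using F(1) s by (intro sum.cong refl) auto
        then show ?thesis by simp
      qed
    qed (use s t in auto)
    show ?thesis by (rule trans[OF Bochner_Integration.integral_cong[OF refl eq] z])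
  qed
  have chiS: "integrable ?\<Omega> (\<lambda>w. chi ((S w)\<^sup>2))" by (rule \<Omega>.chi_expectation_le(2)[OF S_sq]) simp
  have "(\<integral>w. chi ((\<Sum>r=1..Suc j. \<beta> r * h (w r) (w t))\<^sup>2) \<partial>?\<Omega>)
     \<le> (\<integral>w. chi ((S w)\<^sup>2) + \<beta> s * (chi_sq_deriv (S w) * h (w s) (w t))
         + 16 * ((\<beta> s)\<^sup>2 * (min ((S w)\<^sup>2) 1 * (h (w s) (w t))\<^sup>2)) + 32 * chi ((\<beta> s * h (w s) (w t))\<^sup>2) \<partial>?\<Omega>)"
  proof (rule integral_mono)
    show "integrable ?\<Omega> (\<lambda>w. chi ((\<Sum>r=1..Suc j. \<beta> r * h (w r) (w t))\<^sup>2))"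
      by (rule \<Omega>.chi_expectation_le(2)[OF S'_sq]) simp
    show "integrable ?\<Omega> (\<lambda>w. chi ((S w)\<^sup>2) + \<beta> s * (chi_sq_deriv (S w) * h (w s) (w t))
         + 16 * ((\<beta> s)\<^sup>2 * (min ((S w)\<^sup>2) 1 * (h (w s) (w t))\<^sup>2)) + 32 * chi ((\<beta> s * h (w s) (w t))\<^sup>2))"
      using chiS D_int T(1) C(1) by (intro Bochner_Integration.integrable_add integrable_mult_right)
    show "chi ((\<Sum>r=1..Suc j. \<beta> r * h (w r) (w t))\<^sup>2) \<le> chi ((S w)\<^sup>2) + \<beta> s * (chi_sq_deriv (S w) * h (w s) (w t))
         + 16 * ((\<beta> s)\<^sup>2 * (min ((S w)\<^sup>2) 1 * (h (w s) (w t))\<^sup>2)) + 32 * chi ((\<beta> s * h (w s) (w t))\<^sup>2)" for w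
    proof -
      have e1: "(\<Sum>r=1..Suc j. \<beta> r * h (w r) (w t)) = S w + \<beta> s * h (w s) (w t)"
        by (simp add: S_def s_def)
      have e2: "chi_sq_deriv (S w) * (\<beta> s * h (w s) (w t)) = \<beta> s * (chi_sq_deriv (S w) * h (w s) (w t))" by simp
      have e3: "min ((S w)\<^sup>2) 1 * (\<beta> s * h (w s) (w t))\<^sup>2 = (\<beta> s)\<^sup>2 * (min ((S w)\<^sup>2) 1 * (h (w s) (w t))\<^sup>2)"
        unfolding power_mult_distrib by (rule mult.left_commute)
      show ?thesis
        using chi_square_increment[of "S w" "\<beta> s * h (w s) (w t)"] unfolding e1 e2 e3 .
    qed
  qed
  also have "\<dots> = (\<integral>w. chi ((S w)\<^sup>2) \<partial>?\<Omega>) + 16 * ((\<beta> s)\<^sup>2 * (\<integral>w. min ((S w)\<^sup>2) 1 * (h (w s) (w t))\<^sup>2 \<partial>?\<Omega>))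
      + 32 * (\<integral>w. chi ((\<beta> s * h (w s) (w t))\<^sup>2) \<partial>?\<Omega>)"
    using chiS D_int D0 T(1) C(1) by simp
  also have "\<dots> \<le> (\<Sum>s=1..j. 16 * ((\<beta> s)\<^sup>2 * ((K\<^sup>2 + 1) * lindeberg N)) + 32 * (K ^ 4 * lindeberg N / (real N)\<^sup>2))
      + 16 * ((\<beta> s)\<^sup>2 * ((K\<^sup>2 + 1) * lindeberg N)) + 32 * (K ^ 4 * lindeberg N / (real N)\<^sup>2)"
    using Suc T(2) C(2) unfolding S_def by (intro add_mono mult_left_mono) auto
  finally show ?case by (simp add: s_def)
qed

lemma lindeberg_sum_le:
  assumes N: "0 < N" and K: "1 \<le> K"
    and b: "\<And>p. p \<in> pairs N \<Longrightarrow> \<bar>b p\<bar> \<le> K / real N"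
    and b1: "(\<Sum>p\<in>pairs N. (b p)\<^sup>2) = 1"
  shows "(\<Sum>t=1..N. \<integral>w. chi ((\<Sum>s=1..<t. b (s, t) * h (w s) (w t))\<^sup>2) \<partial>sample {1..N}) \<le> 64 * K ^ 4 * lindeberg N"
proof -
  have N': "0 < real N" using N by simp
  have "(\<Sum>t=1..N. \<integral>w. chi ((\<Sum>s=1..<t. b (s, t) * h (w s) (w t))\<^sup>2) \<partial>sample {1..N})
    \<le> (\<Sum>t=1..N. \<Sum>s=1..<t. 16 * ((b (s, t))\<^sup>2 * ((K\<^sup>2 + 1) * lindeberg N)) + 32 * (K ^ 4 * lindeberg N / (real N)\<^sup>2))"
  proof (rule sum_mono)
    fix t assume t: "t \<in> {1..N}"
    have "{1..<t} = {1..t - 1}" using t by auto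
    then show "(\<integral>w. chi ((\<Sum>s=1..<t. b (s, t) * h (w s) (w t))\<^sup>2) \<partial>sample {1..N})
       \<le> (\<Sum>s=1..<t. 16 * ((b (s, t))\<^sup>2 * ((K\<^sup>2 + 1) * lindeberg N)) + 32 * (K ^ 4 * lindeberg N / (real N)\<^sup>2))"
      using chi_increment_le[OF N t K, of "\<lambda>s. b (s, t)" "t - 1", OF b] t by (simp add: pairs_def)
  qed
  also have "\<dots> = (\<Sum>p\<in>pairs N. 16 * ((b p)\<^sup>2 * ((K\<^sup>2 + 1) * lindeberg N)) + 32 * (K ^ 4 * lindeberg N / (real N)\<^sup>2))"
    using sum_pairs[of "\<lambda>s t. 16 * ((b (s, t))\<^sup>2 * ((K\<^sup>2 + 1) * lindeberg N)) + 32 * (K ^ 4 * lindeberg N / (real N)\<^sup>2)" N] by simp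
  also have "\<dots> = 16 * ((\<Sum>p\<in>pairs N. (b p)\<^sup>2) * ((K\<^sup>2 + 1) * lindeberg N)) + real (card (pairs N)) * (32 * (K ^ 4 * lindeberg N / (real N)\<^sup>2))"
    by (simp only: sum.distrib sum_distrib_left[symmetric] sum_distrib_right[symmetric] sum_constant) simp
  also have "\<dots> \<le> 16 * ((K\<^sup>2 + 1) * lindeberg N) + real (N\<^sup>2) * (32 * (K ^ 4 * lindeberg N / (real N)\<^sup>2))"
    using card_pairs_le[of N] lindeberg_nonneg[of N] K unfolding b1
    by (intro add_mono mult_right_mono of_nat_mono) auto
  also have "\<dots> = 16 * ((K\<^sup>2 + 1) * lindeberg N) + 32 * (K ^ 4 * lindeberg N)" using N' by simp
  also have "\<dots> \<le> 16 * ((K ^ 4 + K ^ 4) * lindeberg N) + 32 * (K ^ 4 * lindeberg N)"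
    using lindeberg_nonneg[of N] K power_increasing[of 2 4 K]
    by (intro add_mono mult_left_mono mult_right_mono) auto
  finally show ?thesis by (simp add: algebra_simps)
qed

theorem degenerate_clt_bound:
  assumes N: "0 < N" and K: "1 \<le> K" and sq_norm: "sq_norm = 1"
    and b: "\<And>p. p \<in> pairs N \<Longrightarrow> \<bar>b p\<bar> \<le> K / real N"
    and b1: "(\<Sum>p\<in>pairs N. (b p)\<^sup>2) = 1" and \<epsilon>: "0 < \<epsilon>" "\<epsilon> \<le> 1"
  shows "cmod ((\<integral>w. iexp (u * (\<Sum>p\<in>pairs N. b p * h (w (fst p)) (w (snd p)))) \<partial>sample {1..N}) - exp (- (u\<^sup>2 / 2)))
    \<le> u\<^sup>2 * K\<^sup>2 * (sqrt (lindeberg N) + lindeberg N + sqrt G_sq_norm) + 2 * \<epsilon> * u\<^sup>2 + 256 / \<epsilon>\<^sup>2 * (1 + u\<^sup>2)\<^sup>2 * K ^ 4 * lindeberg N"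
proof -
  let ?\<Omega> = "sample {1..N}"
  interpret \<Omega>: prob_space ?\<Omega> by (rule prob_space_sample)
  define \<xi> where "\<xi> t w = (\<Sum>s=1..<t. b (s, t) * h (w s) (w t))" for t w
  have sub: "{1..<t} \<subseteq> {1..N} - {t}" if "t \<in> {1..N}" for t using that by auto
  have meas: "\<xi> t \<in> borel_measurable ?\<Omega>" if t: "t \<in> {1..N}" for t
    unfolding \<xi>_def using sub[OF t] t
    by (intro borel_measurable_sum borel_measurable_times borel_measurable_const h_comp measurable_coordinate) auto
  have sq: "integrable ?\<Omega> (\<lambda>w. (\<xi> t w)\<^sup>2)" if t: "t \<in> {1..N}" for t
    unfolding \<xi>_def by (rule increment_square_integrable(1)[OF t finite_atLeastLessThan sub[OF t]])
  have Esq: "(\<integral>w. (\<xi> t w)\<^sup>2 \<partial>?\<Omega>) = (\<Sum>s=1..<t. (b (s, t))\<^sup>2)" if t: "t \<in> {1..N}" for t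
    unfolding \<xi>_def by (subst increment_square_integrable(2)[OF t finite_atLeastLessThan sub[OF t]]) (simp add: sq_norm)
  have adapted: "\<xi> t (w(s := y)) = \<xi> t w" if "t < s" for t s w y
    unfolding \<xi>_def using that by (intro sum.cong refl) auto
  have mean: "(\<integral>y. \<xi> t (w(t := y)) \<partial>L) = 0" if t: "t \<in> {1..N}" and w: "w \<in> space ?\<Omega>" for t w
  proof -
    have sp: "w s \<in> space L" if "s \<in> {1..<t}" for s
      using that t w by (intro space_coordinate[of _ "{1..N}"]) auto
    have hi: "integrable L (h (w s))" if "s \<in> {1..<t}" for s
    proof (rule square_integrable_imp_integrable)
      show "h (w s) \<in> borel_measurable L" using sp[OF that] by measurable
      show "integrable L (\<lambda>x. (h (w s) x)\<^sup>2)" by (rule h_sq[OF sp[OF that]])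
    qed
    have "(\<integral>y. \<xi> t (w(t := y)) \<partial>L) = (\<integral>y. (\<Sum>s=1..<t. b (s, t) * h (w s) y) \<partial>L)"
      unfolding \<xi>_def by (intro Bochner_Integration.integral_cong sum.cong refl) auto
    also have "\<dots> = (\<Sum>s=1..<t. b (s, t) * (\<integral>y. h (w s) y \<partial>L))"
    proof (subst Bochner_Integration.integral_sum)
      show "integrable L (\<lambda>y. b (s, t) * h (w s) y)" if "s \<in> {1..<t}" for s
        by (rule integrable_mult_right) (rule hi[OF that])
    qed (rule sum.cong[OF refl], rule integral_mult_right_zero)
    also have "\<dots> = 0"
      by (rule sum.neutral) (simp add: h_mean[OF sp])
    finally show ?thesis .
  qed
  have var: "(\<integral>y. (\<xi> t (w(t := y)))\<^sup>2 \<partial>L) = cond_var b t w" if "t \<in> {1..N}" "w \<in> space ?\<Omega>" for t w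
    unfolding \<xi>_def by (rule integral_increment_sq[OF that])
  have S: "(\<Sum>t=1..N. \<xi> t w) = (\<Sum>p\<in>pairs N. b p * h (w (fst p)) (w (snd p)))" for w
    unfolding \<xi>_def using sum_pairs[of "\<lambda>s t. b (s, t) * h (w s) (w t)" N] by (simp only: prod.collapse)
  have Esum: "(\<Sum>t=1..N. \<integral>w. (\<xi> t w)\<^sup>2 \<partial>?\<Omega>) = 1"
  proof -
    have "(\<Sum>t=1..N. \<integral>w. (\<xi> t w)\<^sup>2 \<partial>?\<Omega>) = (\<Sum>t=1..N. \<Sum>s=1..<t. (b (s, t))\<^sup>2)"
      by (intro sum.cong refl Esq)
    also have "\<dots> = (\<Sum>p\<in>pairs N. (b p)\<^sup>2)"
      using sum_pairs[of "\<lambda>s t. (b (s, t))\<^sup>2" N] by (simp only: prod.collapse)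
    finally show ?thesis unfolding b1 .
  qed
  have chi_u: "(\<Sum>t=1..N. \<integral>w. chi ((u * \<xi> t w)\<^sup>2) \<partial>?\<Omega>) \<le> (1 + u\<^sup>2)\<^sup>2 * (64 * K ^ 4 * lindeberg N)"
  proof -
    have "(\<Sum>t=1..N. \<integral>w. chi ((u * \<xi> t w)\<^sup>2) \<partial>?\<Omega>) \<le> (\<Sum>t=1..N. (1 + u\<^sup>2)\<^sup>2 * (\<integral>w. chi ((\<xi> t w)\<^sup>2) \<partial>?\<Omega>))"
    proof (rule sum_mono)
      fix t assume t: "t \<in> {1..N}"
      have "(\<integral>w. chi ((u * \<xi> t w)\<^sup>2) \<partial>?\<Omega>) \<le> (\<integral>w. (1 + u\<^sup>2)\<^sup>2 * chi ((\<xi> t w)\<^sup>2) \<partial>?\<Omega>)"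
      proof (rule integral_mono)
        show "integrable ?\<Omega> (\<lambda>w. chi ((u * \<xi> t w)\<^sup>2))"
          using sq[OF t] by (intro \<Omega>.chi_expectation_le(2)) (auto simp: power_mult_distrib)
        show "integrable ?\<Omega> (\<lambda>w. (1 + u\<^sup>2)\<^sup>2 * chi ((\<xi> t w)\<^sup>2))"
          using sq[OF t] by (intro integrable_mult_right \<Omega>.chi_expectation_le(2)) auto
        fix w
        have "chi ((u * \<xi> t w)\<^sup>2) \<le> chi ((1 + u\<^sup>2) * (\<xi> t w)\<^sup>2)"
          by (intro chi_mono) (auto simp: power_mult_distrib algebra_simps)
        also have "\<dots> \<le> (1 + u\<^sup>2)\<^sup>2 * chi ((\<xi> t w)\<^sup>2)" by (intro chi_scale_up) auto
        finally show "chi ((u * \<xi> t w)\<^sup>2) \<le> (1 + u\<^sup>2)\<^sup>2 * chi ((\<xi> t w)\<^sup>2)" .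
      qed
      then show "(\<integral>w. chi ((u * \<xi> t w)\<^sup>2) \<partial>?\<Omega>) \<le> (1 + u\<^sup>2)\<^sup>2 * (\<integral>w. chi ((\<xi> t w)\<^sup>2) \<partial>?\<Omega>)" by simp
    qed
    also have "\<dots> = (1 + u\<^sup>2)\<^sup>2 * (\<Sum>t=1..N. \<integral>w. chi ((\<xi> t w)\<^sup>2) \<partial>?\<Omega>)" by (simp add: sum_distrib_left)
    also have "\<dots> \<le> (1 + u\<^sup>2)\<^sup>2 * (64 * K ^ 4 * lindeberg N)"
      unfolding \<xi>_def by (intro mult_left_mono lindeberg_sum_le[OF N K b b1]) auto
    finally show ?thesis .
  qed
  have "cmod ((\<integral>w. iexp (u * (\<Sum>t=1..N. \<xi> t w)) \<partial>?\<Omega>) - exp (- (u\<^sup>2 / 2)))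
    \<le> u\<^sup>2 / 2 * (\<integral>w. \<bar>(\<Sum>t=1..N. cond_var b t w) - 1\<bar> \<partial>?\<Omega>)
      + 2 * \<epsilon> * u\<^sup>2 * (\<Sum>t=1..N. \<integral>w. (\<xi> t w)\<^sup>2 \<partial>?\<Omega>)
      + 4 / \<epsilon>\<^sup>2 * (\<Sum>t=1..N. \<integral>w. chi ((u * \<xi> t w)\<^sup>2) \<partial>?\<Omega>)"
    by (rule martingale_char_bound[OF \<epsilon> meas adapted sq mean var])
  also have "\<dots> \<le> u\<^sup>2 / 2 * (2 * K\<^sup>2 * (sqrt (lindeberg N) + lindeberg N + sqrt G_sq_norm)) + 2 * \<epsilon> * u\<^sup>2 * 1
      + 4 / \<epsilon>\<^sup>2 * ((1 + u\<^sup>2)\<^sup>2 * (64 * K ^ 4 * lindeberg N))"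
    using cond_var_concentration[OF N _ sq_norm b b1] K chi_u \<epsilon> unfolding Esum
    by (intro add_mono mult_left_mono) auto
  finally show ?thesis unfolding S by (simp add: algebra_simps)
qed

end

section \<open>The test statistic as a studentised degenerate sum\<close>

lemma sum_pairs_rows: "(\<Sum>i=1..n. \<Sum>j\<in>{i<..n}. F i j) = (\<Sum>p\<in>pairs n. F (fst p) (snd p))"
proof -
  have "pairs n = (SIGMA i:{1..n}. {i<..n})" by (auto simp: pairs_def)
  then show ?thesis by (simp add: sum.Sigma case_prod_unfold)
qed

lemma sum_pairs_append:
  fixes F :: "nat \<Rightarrow> nat \<Rightarrow> real"
  shows "(\<Sum>p\<in>pairs (n + m). F (fst p) (snd p)) = (\<Sum>p\<in>pairs n. F (fst p) (snd p))
     + (\<Sum>i=1..n. \<Sum>j=1..m. F i (n + j)) + (\<Sum>p\<in>pairs m. F (n + fst p) (n + snd p))"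
proof (induction m)
  case 0
  have "pairs 0 = {}" by (auto simp: pairs_def)
  then show ?case by simp
next
  case (Suc m)
  have "{1..<n + Suc m} = {1..n} \<union> {n + 1..<n + Suc m}" by auto
  then have "(\<Sum>s=1..<n + Suc m. F s (n + Suc m)) = (\<Sum>s=1..n. F s (n + Suc m)) + (\<Sum>s=n + 1..<n + Suc m. F s (n + Suc m))"
    by (simp only:) (rule sum.union_disjoint, auto)
  also have "(\<Sum>s=n + 1..<n + Suc m. F s (n + Suc m)) = (\<Sum>i=1..<Suc m. F (n + i) (n + Suc m))"
    by (rule sum.reindex_bij_witness[of _ "\<lambda>i. n + i" "\<lambda>s. s - n"]) auto
  finally have "(\<Sum>s=1..<n + Suc m. F s (n + Suc m)) = (\<Sum>s=1..n. F s (n + Suc m)) + (\<Sum>i=1..<Suc m. F (n + i) (n + Suc m))" .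
  then show ?case
    using Suc sum_pairs[of F "n + Suc m"] sum_pairs[of F "n + m"]
      sum_pairs[of "\<lambda>s t. F (n + s) (n + t)" "Suc m"] sum_pairs[of "\<lambda>s t. F (n + s) (n + t)" m]
    by (simp add: sum.distrib del: sum.op_ivl_Suc)
qed

lemma sum_pairs_additive:
  fixes u :: "nat \<Rightarrow> real"
  shows "(\<Sum>p\<in>pairs n. u (fst p) + u (snd p)) = (real n - 1) * (\<Sum>i=1..n. u i)"
proof (induction n)
  case 0
  have "pairs 0 = {}" by (auto simp: pairs_def)
  then show ?case by simp
next
  case (Suc n)
  have "{1..<Suc n} = {1..n}" by auto
  then have "(\<Sum>s=1..<Suc n. u s + u (Suc n)) = (\<Sum>i=1..n. u i) + real n * u (Suc n)"
    by (simp add: sum.distrib)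
  then show ?case
    using Suc sum_pairs[of "\<lambda>s t. u s + u t" "Suc n"] sum_pairs[of "\<lambda>s t. u s + u t" n]
    by (simp add: algebra_simps del: sum.op_ivl_Suc)
qed

lemma card_pairs: "real (card (pairs n)) = real n * (real n - 1) / 2"
  using sum_pairs_additive[of "\<lambda>_. 1 / 2" n] by simp

lemma real_choose_two: "real (n choose 2) = real n * (real n - 1) / 2"
proof (cases n)
  case (Suc k)
  have "2 dvd n * (n - 1)" by (cases "even n") auto
  then show ?thesis using Suc by (simp add: choose_two real_of_nat_div algebra_simps)
qed simp

text \<open>The energy statistic as one weighted sum over the pairs of the pooled sample.\<close>

definition energy_coeff :: "nat \<Rightarrow> nat \<Rightarrow> nat \<times> nat \<Rightarrow> real" where
  "energy_coeff n m p = (if snd p \<le> n then - (2 / (real n * (real n - 1)))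
     else if n < fst p then - (2 / (real m * (real m - 1)))
     else 2 / (real n * real m))"

lemma sum_energy_coeff:
  fixes F :: "nat \<Rightarrow> nat \<Rightarrow> real"
  shows "(\<Sum>p\<in>pairs (n + m). f (energy_coeff n m p) * F (fst p) (snd p))
    = f (2 / (real n * real m)) * (\<Sum>i=1..n. \<Sum>j=1..m. F i (n + j))
     + f (- (2 / (real n * (real n - 1)))) * (\<Sum>p\<in>pairs n. F (fst p) (snd p))
     + f (- (2 / (real m * (real m - 1)))) * (\<Sum>p\<in>pairs m. F (n + fst p) (n + snd p))"
proof -
  have "(\<Sum>p\<in>pairs (n + m). f (energy_coeff n m p) * F (fst p) (snd p))
    = (\<Sum>p\<in>pairs (n + m). f (energy_coeff n m (fst p, snd p)) * F (fst p) (snd p))" by simp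
  also have "\<dots> = (\<Sum>p\<in>pairs n. f (energy_coeff n m (fst p, snd p)) * F (fst p) (snd p))
     + (\<Sum>i=1..n. \<Sum>j=1..m. f (energy_coeff n m (i, n + j)) * F i (n + j))
     + (\<Sum>p\<in>pairs m. f (energy_coeff n m (n + fst p, n + snd p)) * F (n + fst p) (n + snd p))"
    by (rule sum_pairs_append)
  also have "(\<Sum>p\<in>pairs n. f (energy_coeff n m (fst p, snd p)) * F (fst p) (snd p))
    = f (- (2 / (real n * (real n - 1)))) * (\<Sum>p\<in>pairs n. F (fst p) (snd p))"
    unfolding sum_distrib_left by (intro sum.cong refl) (auto simp: energy_coeff_def pairs_def)
  also have "(\<Sum>i=1..n. \<Sum>j=1..m. f (energy_coeff n m (i, n + j)) * F i (n + j))
    = f (2 / (real n * real m)) * (\<Sum>i=1..n. \<Sum>j=1..m. F i (n + j))"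
    unfolding sum_distrib_left by (intro sum.cong refl) (auto simp: energy_coeff_def)
  also have "(\<Sum>p\<in>pairs m. f (energy_coeff n m (n + fst p, n + snd p)) * F (n + fst p) (n + snd p))
    = f (- (2 / (real m * (real m - 1)))) * (\<Sum>p\<in>pairs m. F (n + fst p) (n + snd p))"
    unfolding sum_distrib_left by (intro sum.cong refl) (auto simp: energy_coeff_def pairs_def)
  finally show ?thesis by simp
qed

lemma sum_energy_coeff_sq:
  assumes "2 \<le> n" "2 \<le> m"
  shows "(\<Sum>p\<in>pairs (n + m). (energy_coeff n m p)\<^sup>2) = c_coeff n m"
proof -
  have nz: "real n \<noteq> 0" "real m \<noteq> 0" "real n - 1 \<noteq> 0" "real m - 1 \<noteq> 0" using assms by auto
  have "(\<Sum>p\<in>pairs (n + m). (energy_coeff n m p)\<^sup>2) = (2 / (real n * real m))\<^sup>2 * (real n * real m)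
     + (2 / (real n * (real n - 1)))\<^sup>2 * (real n * (real n - 1) / 2)
     + (2 / (real m * (real m - 1)))\<^sup>2 * (real m * (real m - 1) / 2)"
    using sum_energy_coeff[of "\<lambda>c. c\<^sup>2" n m "\<lambda>_ _. 1"] by (simp add: card_pairs)
  also have "\<dots> = c_coeff n m"
    unfolding c_coeff_def using nz by (simp add: power2_eq_square)
  finally show ?thesis .
qed

text \<open>The weights of the pairs that contain a given index add up to zero: for \<open>s \<le> n\<close> they are
  \<open>m * 2 / (n * m) - (n - 1) * 2 / (n * (n - 1))\<close>.\<close>

lemma sum_energy_coeff_additive:
  fixes u :: "nat \<Rightarrow> real"
  assumes "2 \<le> n" "2 \<le> m"
  shows "(\<Sum>p\<in>pairs (n + m). energy_coeff n m p * (u (fst p) + u (snd p))) = 0"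
proof -
  have nz: "real n \<noteq> 0" "real m \<noteq> 0" "real n - 1 \<noteq> 0" "real m - 1 \<noteq> 0" using assms by auto
  define U where "U = (\<Sum>i=1..n. u i)"
  define V where "V = (\<Sum>j=1..m. u (n + j))"
  have "(\<Sum>i=1..n. \<Sum>j=1..m. u i + u (n + j)) = real m * U + real n * V"
    by (simp add: sum.distrib U_def V_def sum_distrib_left)
  then have "(\<Sum>p\<in>pairs (n + m). energy_coeff n m p * (u (fst p) + u (snd p)))
     = 2 / (real n * real m) * (real m * U + real n * V)
     + - (2 / (real n * (real n - 1))) * ((real n - 1) * U)
     + - (2 / (real m * (real m - 1))) * ((real m - 1) * V)"
    using sum_energy_coeff[of "\<lambda>c. c" n m "\<lambda>s t. u s + u t"] sum_pairs_additive[of u n]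
      sum_pairs_additive[of "\<lambda>i. u (n + i)" m]
    by (simp add: U_def V_def)
  also have "\<dots> = 0"
    using nz by (simp add: divide_simps)
  finally show ?thesis .
qed

text \<open>Each weight is of the order of \<open>1 / N\<^sup>2\<close> as both samples make up at least the proportion \<open>\<kappa>\<close>, and
  \<open>c_coeff n m\<close> is at least \<open>4 / (n * m) \<ge> (2 / N)\<^sup>2\<close>.\<close>

lemma abs_energy_coeff_le:
  assumes n2: "2 \<le> n" and m2: "2 \<le> m" and \<kappa>: "0 < \<kappa>"
    and n: "\<kappa> * real (n + m) \<le> real n" and m: "\<kappa> * real (n + m) \<le> real m"
  shows "\<bar>energy_coeff n m p / sqrt (c_coeff n m)\<bar> \<le> 2 / \<kappa>\<^sup>2 / real (n + m)"
proof -
  define M where "M = \<kappa> * real (n + m)"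
  have M: "0 < M" using \<kappa> n2 by (simp add: M_def)
  have half: "2 / (real j * (real j - 1)) \<le> 4 / M\<^sup>2" if "2 \<le> j" "M \<le> real j" for j :: nat
  proof -
    have "M * (M / 2) \<le> real j * (real j - 1)" using that M by (intro mult_mono) auto
    then have "2 / (real j * (real j - 1)) \<le> 2 / (M * (M / 2))" using M by (intro divide_left_mono mult_pos_pos) (use that in auto)
    then show ?thesis by (simp add: power2_eq_square)
  qed
  have cross: "2 / (real n * real m) \<le> 4 / M\<^sup>2"
  proof -
    have "M * M \<le> real n * real m" using n m M by (intro mult_mono) (auto simp: M_def)
    then have "2 / (real n * real m) \<le> 4 / (M * M)" using M n2 m2 by (intro frac_le) auto
    then show ?thesis by (simp add: power2_eq_square)
  qed
  have c: "\<bar>energy_coeff n m p\<bar> \<le> 4 / M\<^sup>2"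
  proof -
    have nn: "0 \<le> 2 / (real n * (real n - 1))" "0 \<le> 2 / (real m * (real m - 1))" "0 \<le> 2 / (real n * real m)"
      using n2 m2 by auto
    show ?thesis
      using half[of n] half[of m] cross n2 m2 n m nn unfolding energy_coeff_def M_def by (auto split: if_splits)
  qed
  have "(2 / real (n + m))\<^sup>2 \<le> 4 / (real n * real m)"
  proof -
    have "real n * real m \<le> real (n + m) * real (n + m)" by (intro mult_mono) auto
    then have "4 / (real (n + m) * real (n + m)) \<le> 4 / (real n * real m)"
      using n2 m2 by (intro divide_left_mono mult_pos_pos) auto
    then show ?thesis by (simp add: power2_eq_square)
  qed
  also have "\<dots> \<le> c_coeff n m" unfolding c_coeff_def using n2 m2 by simp
  finally have s: "2 / real (n + m) \<le> sqrt (c_coeff n m)" by (rule real_le_rsqrt)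
  have pos: "0 < 2 / real (n + m)" using n2 by simp
  have "0 < sqrt (c_coeff n m)" using s pos by linarith
  then have "\<bar>energy_coeff n m p / sqrt (c_coeff n m)\<bar> = \<bar>energy_coeff n m p\<bar> / sqrt (c_coeff n m)"
    by (simp only: abs_divide abs_of_pos)
  also have "\<dots> \<le> (4 / M\<^sup>2) / (2 / real (n + m))"
    using c s pos M by (intro frac_le) auto
  also have "\<dots> = 2 / \<kappa>\<^sup>2 / real (n + m)"
  proof -
    have "(4 / (\<kappa> * r)\<^sup>2) / (2 / r) = 2 / \<kappa>\<^sup>2 / r" if "r \<noteq> 0" for r :: real
      using \<kappa> that by (simp add: power2_eq_square field_simps)
    from this[of "real (n + m)"] show ?thesis unfolding M_def using n2 by (simp del: of_nat_add)
  qed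
  finally show ?thesis .
qed

lemma energy_stat_eq_sum_pairs:
  fixes k :: "'x \<Rightarrow> 'x \<Rightarrow> real" and x y :: "nat \<Rightarrow> 'x"
  assumes "2 \<le> n" "2 \<le> m"
  defines "W \<equiv> pooled n x y"
  shows "energy_stat k n m x y = (\<Sum>p\<in>pairs (n + m). energy_coeff n m p * k (W (fst p)) (W (snd p)))"
proof -
  have x: "k (x i) (y j) = k (W i) (W (n + j))" if "i \<in> {1..n}" "j \<in> {1..m}" for i j
    using that by (auto simp: W_def pooled_def)
  have "(\<Sum>i=1..n. \<Sum>j=1..m. k (x i) (y j)) = (\<Sum>i=1..n. \<Sum>j=1..m. k (W i) (W (n + j)))"
    using x by (intro sum.cong refl) auto
  moreover have "(\<Sum>i=1..n. \<Sum>j\<in>{i<..n}. k (x i) (x j)) = (\<Sum>p\<in>pairs n. k (W (fst p)) (W (snd p)))"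
    unfolding sum_pairs_rows by (intro sum.cong refl) (auto simp: W_def pooled_def pairs_def)
  moreover have "(\<Sum>i=1..m. \<Sum>j\<in>{i<..m}. k (y i) (y j)) = (\<Sum>p\<in>pairs m. k (W (n + fst p)) (W (n + snd p)))"
    unfolding sum_pairs_rows by (intro sum.cong refl) (auto simp: W_def pooled_def pairs_def)
  ultimately show ?thesis
    unfolding energy_stat_def sum_energy_coeff[of "\<lambda>c. c" n m "\<lambda>s t. k (W s) (W t)"] real_choose_two by simp
qed

text \<open>The variance estimator evaluated at a symmetric matrix with zero diagonal: the normalised sum
  of the squared off-diagonal entries of its U-centering, expanded.\<close>

definition var_ratio :: "nat \<Rightarrow> (nat \<Rightarrow> nat \<Rightarrow> real) \<Rightarrow> real" where
  "var_ratio N \<eta> = 2 / (real N * (real N - 3)) * (\<Sum>p\<in>pairs N. (\<eta> (fst p) (snd p))\<^sup>2)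
     - 2 / (real N * (real N - 2) * (real N - 3)) * (\<Sum>s=1..N. (\<Sum>t=1..N. \<eta> s t)\<^sup>2)
     + (2 * (\<Sum>p\<in>pairs N. \<eta> (fst p) (snd p)))\<^sup>2 / (real N * (real N - 1) * (real N - 2) * (real N - 3))"

lemma sum_remove_one: "s \<in> {1..N::nat} \<Longrightarrow> (\<Sum>t\<in>{1..N} - {s}. f t) = (\<Sum>t=1..N. f t) - (f s :: real)"
  using sum.remove[of "{1..N}" s f] by simp

text \<open>Off the diagonal, \<open>A_star\<close> equals \<open>e - a0 / (N - 1)\<close>, where \<open>e\<close> is the U-centering of \<open>\<eta>\<close>. The
  off-diagonal row sums of \<open>e\<close> vanish. Hence the mixed terms with \<open>a0\<close> disappear and the remaining
  \<open>a0\<^sup>2\<close> is the correction that is subtracted; moreover the sum of \<open>e\<^sup>2\<close> is that of \<open>\<eta> * e\<close>.\<close>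

lemma U_centred_sum_of_squares:
  fixes a \<eta> :: "nat \<Rightarrow> nat \<Rightarrow> real"
  assumes N: "4 \<le> N"
    and off: "\<And>s t. s \<in> {1..N} \<Longrightarrow> t \<in> {1..N} \<Longrightarrow> s \<noteq> t \<Longrightarrow> a s t = \<eta> s t + u s + u t"
    and diag: "\<And>s. s \<in> {1..N} \<Longrightarrow> a s s = a0"
    and sym: "\<And>s t. \<eta> s t = \<eta> t s" and zero: "\<And>s. \<eta> s s = 0"
  shows "1 / (real N * (real N - 3)) * (\<Sum>s=1..N. \<Sum>t\<in>{1..N} - {s}. (A_star N a s t)\<^sup>2)
      - a0\<^sup>2 / ((real N - 1) * (real N - 3)) = var_ratio N \<eta>"
proof -
  define q where "q s = (\<Sum>t=1..N. \<eta> s t)" for s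
  define Q where "Q = (\<Sum>s=1..N. q s)"
  define U where "U = (\<Sum>t=1..N. u t)"
  have nz: "real N - 1 \<noteq> 0" "real N - 2 \<noteq> 0" "real N - 3 \<noteq> 0" "real N \<noteq> 0" using N by auto
  have row: "(\<Sum>t=1..N. a s t) = a0 + q s + (real N - 2) * u s + U" if s: "s \<in> {1..N}" for s
  proof -
    have "(\<Sum>t=1..N. a s t) = a s s + (\<Sum>t\<in>{1..N} - {s}. a s t)" using sum_remove_one[OF s, of "a s"] by simp
    also have "(\<Sum>t\<in>{1..N} - {s}. a s t) = (\<Sum>t\<in>{1..N} - {s}. \<eta> s t + u s + u t)"
      using off s by (intro sum.cong refl) auto
    also have "\<dots> = (\<Sum>t=1..N. \<eta> s t + u s + u t) - (\<eta> s s + u s + u s)" by (rule sum_remove_one[OF s])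
    also have "(\<Sum>t=1..N. \<eta> s t + u s + u t) = q s + real N * u s + U" by (simp add: sum.distrib q_def U_def)
    finally show ?thesis using diag[OF s] zero by (simp add: algebra_simps)
  qed
  have a_sym: "a s t = a t s" if "s \<in> {1..N}" "t \<in> {1..N}" for s t
    using off[OF that] off[OF that(2,1)] sym by (cases "s = t") auto
  have col: "(\<Sum>s=1..N. a s t) = a0 + q t + (real N - 2) * u t + U" if t: "t \<in> {1..N}" for t
    using row[OF t] a_sym t by (metis (mono_tags, lifting) sum.cong)
  have tot: "(\<Sum>s=1..N. \<Sum>t=1..N. a s t) = real N * a0 + Q + 2 * (real N - 1) * U"
  proof -
    have "(\<Sum>s=1..N. \<Sum>t=1..N. a s t) = (\<Sum>s=1..N. a0 + q s + (real N - 2) * u s + U)"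
      by (intro sum.cong refl row)
    also have "\<dots> = real N * a0 + Q + (real N - 2) * U + real N * U"
      by (simp add: sum.distrib Q_def U_def sum_distrib_left)
    finally show ?thesis by (simp add: algebra_simps)
  qed
  define e where "e s t = \<eta> s t - (q s + q t) / (real N - 2) + Q / ((real N - 1) * (real N - 2))" for s t
  have A: "A_star N a s t = e s t - a0 / (real N - 1)"
    if st: "s \<in> {1..N}" "t \<in> {1..N}" "s \<noteq> t" for s t
    unfolding A_star_def tot row[OF st(1)] col[OF st(2)] off[OF st] e_def
    using nz by (simp add: divide_simps) (simp add: algebra_simps)
  have e_row: "(\<Sum>t\<in>{1..N} - {s}. e s t) = 0" if s: "s \<in> {1..N}" for s
  proof -
    have "(\<Sum>t=1..N. e s t) = q s - (real N * q s + Q) / (real N - 2) + real N * (Q / ((real N - 1) * (real N - 2)))"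
      by (simp only: e_def sum.distrib sum_subtractf sum_divide_distrib[symmetric] sum_constant
          q_def[symmetric] Q_def[symmetric]) simp
    then have "(\<Sum>t\<in>{1..N} - {s}. e s t) = q s - (real N * q s + Q) / (real N - 2)
       + real N * (Q / ((real N - 1) * (real N - 2))) - (0 - (q s + q s) / (real N - 2) + Q / ((real N - 1) * (real N - 2)))"
      unfolding sum_remove_one[OF s] by (simp add: e_def zero)
    also have "\<dots> = 0" using nz by (simp add: divide_simps) (simp add: algebra_simps)
    finally show ?thesis .
  qed
  have per_row: "(\<Sum>t\<in>{1..N} - {s}. (A_star N a s t)\<^sup>2)
      = (\<Sum>t=1..N. (\<eta> s t)\<^sup>2) - (q s)\<^sup>2 / (real N - 2) - (\<Sum>t=1..N. \<eta> s t * q t) / (real N - 2)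
        - (\<Sum>t\<in>{1..N} - {s}. e s t * q t) / (real N - 2)
        + q s * (Q / ((real N - 1) * (real N - 2))) + (real N - 1) * (a0 / (real N - 1))\<^sup>2"
    if s: "s \<in> {1..N}" for s
  proof -
    let ?c = "Q / ((real N - 1) * (real N - 2))" and ?a = "a0 / (real N - 1)"
    have "(\<Sum>t\<in>{1..N} - {s}. (A_star N a s t)\<^sup>2) = (\<Sum>t\<in>{1..N} - {s}. (e s t - ?a)\<^sup>2)"
      using A s by (intro sum.cong refl) auto
    also have "\<dots> = (\<Sum>t\<in>{1..N} - {s}. \<eta> s t * e s t - e s t * q t / (real N - 2)
        + e s t * (?c - q s / (real N - 2) - 2 * ?a) + ?a\<^sup>2)"
    proof (intro sum.cong refl)
      fix t
      have "(e s t - ?a)\<^sup>2 = e s t * e s t - 2 * ?a * e s t + ?a\<^sup>2" by (simp add: power2_eq_square algebra_simps)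
      also have "e s t * e s t = (\<eta> s t - (q s + q t) / (real N - 2) + ?c) * e s t" by (simp add: e_def)
      finally show "(e s t - ?a)\<^sup>2 = \<eta> s t * e s t - e s t * q t / (real N - 2)
        + e s t * (?c - q s / (real N - 2) - 2 * ?a) + ?a\<^sup>2"
        by (simp add: algebra_simps add_divide_distrib)
    qed
    also have "\<dots> = (\<Sum>t\<in>{1..N} - {s}. \<eta> s t * e s t) - (\<Sum>t\<in>{1..N} - {s}. e s t * q t) / (real N - 2)
        + (\<Sum>t\<in>{1..N} - {s}. e s t) * (?c - q s / (real N - 2) - 2 * ?a) + real (card ({1..N} - {s})) * ?a\<^sup>2"
      by (simp only: sum.distrib sum_subtractf sum_divide_distrib sum_distrib_right sum_constant)
    also have "real (card ({1..N} - {s})) = real N - 1" using s N by (simp add: of_nat_diff)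
    also have "(\<Sum>t\<in>{1..N} - {s}. \<eta> s t * e s t) = (\<Sum>t=1..N. \<eta> s t * e s t)"
      unfolding sum_remove_one[OF s] by (simp add: zero)
    also have "\<dots> = (\<Sum>t=1..N. (\<eta> s t)\<^sup>2 - \<eta> s t * (q s / (real N - 2)) - \<eta> s t * q t / (real N - 2) + \<eta> s t * ?c)"
      by (intro sum.cong refl) (simp add: e_def power2_eq_square algebra_simps add_divide_distrib)
    also have "\<dots> = (\<Sum>t=1..N. (\<eta> s t)\<^sup>2) - q s * (q s / (real N - 2)) - (\<Sum>t=1..N. \<eta> s t * q t) / (real N - 2) + q s * ?c"
      by (simp only: sum.distrib sum_subtractf q_def sum_distrib_right sum_divide_distrib)
    finally show ?thesis unfolding e_row[OF s] by (simp add: power2_eq_square)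
  qed
  have s1: "(\<Sum>s=1..N. \<Sum>t=1..N. \<eta> s t * q t) = (\<Sum>s=1..N. (q s)\<^sup>2)"
    by (subst sum.swap) (simp add: sum_distrib_right[symmetric] q_def sym power2_eq_square)
  have s2: "(\<Sum>s=1..N. \<Sum>t\<in>{1..N} - {s}. e s t * q t) = 0"
  proof -
    have "(\<Sum>s=1..N. \<Sum>t\<in>{1..N} - {s}. e s t * q t) = (\<Sum>s\<in>{1..N}. \<Sum>t | t \<in> {1..N} \<and> s \<noteq> t. e s t * q t)"
      by (intro sum.cong refl) auto
    also have "\<dots> = (\<Sum>t\<in>{1..N}. \<Sum>s | s \<in> {1..N} \<and> s \<noteq> t. e s t * q t)"
      by (rule sum.swap_restrict) auto
    also have "\<dots> = (\<Sum>t\<in>{1..N}. (\<Sum>s\<in>{1..N} - {t}. e t s) * q t)"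
      unfolding sum_distrib_right by (intro sum.cong) (auto simp: e_def sym add.commute)
    also have "\<dots> = 0" using e_row by simp
    finally show ?thesis .
  qed
  have s3: "(\<Sum>s=1..N. \<Sum>t=1..N. (\<eta> s t)\<^sup>2) = 2 * (\<Sum>p\<in>pairs N. (\<eta> (fst p) (snd p))\<^sup>2)"
    using sum_square_pairs[of "\<lambda>s t. (\<eta> s t)\<^sup>2" N] sym zero by simp
  have s4: "Q = 2 * (\<Sum>p\<in>pairs N. \<eta> (fst p) (snd p))"
    using sum_square_pairs[of \<eta> N] sym zero by (simp add: Q_def q_def)
  define C where "C = (real N - 1) * (a0 / (real N - 1))\<^sup>2"
  have "(\<Sum>s=1..N. \<Sum>t\<in>{1..N} - {s}. (A_star N a s t)\<^sup>2)
      = (\<Sum>s=1..N. (\<Sum>t=1..N. (\<eta> s t)\<^sup>2) - (q s)\<^sup>2 / (real N - 2) - (\<Sum>t=1..N. \<eta> s t * q t) / (real N - 2)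
        - (\<Sum>t\<in>{1..N} - {s}. e s t * q t) / (real N - 2)
        + q s * (Q / ((real N - 1) * (real N - 2))) + C)"
    unfolding C_def by (intro sum.cong refl per_row)
  also have "\<dots> = (\<Sum>s=1..N. \<Sum>t=1..N. (\<eta> s t)\<^sup>2) - (\<Sum>s=1..N. (q s)\<^sup>2) / (real N - 2)
      - (\<Sum>s=1..N. \<Sum>t=1..N. \<eta> s t * q t) / (real N - 2) - (\<Sum>s=1..N. \<Sum>t\<in>{1..N} - {s}. e s t * q t) / (real N - 2)
      + Q * (Q / ((real N - 1) * (real N - 2))) + real N * C"
    by (simp only: sum.distrib sum_subtractf sum_divide_distrib[symmetric] sum_distrib_right[symmetric] Q_def[symmetric] sum_constant card_atLeastAtMost) simp
  also have "\<dots>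
      = 2 * (\<Sum>p\<in>pairs N. (\<eta> (fst p) (snd p))\<^sup>2) - 2 * (\<Sum>s=1..N. (q s)\<^sup>2) / (real N - 2)
        + Q\<^sup>2 / ((real N - 1) * (real N - 2)) + real N * (a0\<^sup>2 / (real N - 1))"
  proof -
    have "z * (a0 / z)\<^sup>2 = a0\<^sup>2 / z" if "z \<noteq> 0" for z :: real
      using that by (simp add: power2_eq_square)
    from this[OF nz(1)] show ?thesis unfolding s1 s2 s3 C_def by (simp add: power2_eq_square)
  qed
  finally have *: "(\<Sum>s=1..N. \<Sum>t\<in>{1..N} - {s}. (A_star N a s t)\<^sup>2)
      = 2 * (\<Sum>p\<in>pairs N. (\<eta> (fst p) (snd p))\<^sup>2) - 2 * (\<Sum>s=1..N. (q s)\<^sup>2) / (real N - 2)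
        + Q\<^sup>2 / ((real N - 1) * (real N - 2)) + real N * (a0\<^sup>2 / (real N - 1))" .
  show ?thesis
    unfolding * var_ratio_def s4[symmetric] q_def[symmetric]
    using nz by (simp add: divide_simps)
qed

lemma var_ratio_scale: "var_ratio N (\<lambda>s t. c * \<eta> s t) = c\<^sup>2 * var_ratio N \<eta>"
  unfolding var_ratio_def power_mult_distrib sum_distrib_left[symmetric]
  by (simp add: algebra_simps power_mult_distrib)

text \<open>Both the numerator and the denominator ignore the additive part \<open>u s + u t\<close>, and the scale \<open>\<sigma>\<close> cancels.\<close>

theorem T_stat_eq:
  fixes k :: "'x \<Rightarrow> 'x \<Rightarrow> real" and x y :: "nat \<Rightarrow> 'x"
  assumes n: "2 \<le> n" and m: "2 \<le> m" and \<sigma>: "0 < \<sigma>"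
  defines "W \<equiv> pooled n x y"
  assumes off: "\<And>s t. s \<in> {1..n + m} \<Longrightarrow> t \<in> {1..n + m} \<Longrightarrow> s \<noteq> t \<Longrightarrow> k (W s) (W t) = \<sigma> * \<eta> s t + u s + u t"
    and diag: "\<And>s. s \<in> {1..n + m} \<Longrightarrow> k (W s) (W s) = a0"
    and sym: "\<And>s t. \<eta> s t = \<eta> t s" and zero: "\<And>s. \<eta> s s = 0"
  shows "T_stat k a0 n m x y
    = (\<Sum>p\<in>pairs (n + m). energy_coeff n m p / sqrt (c_coeff n m) * \<eta> (fst p) (snd p)) / sqrt (var_ratio (n + m) \<eta>)"
proof -
  have "energy_stat k n m x y = (\<Sum>p\<in>pairs (n + m). energy_coeff n m p * k (W (fst p)) (W (snd p)))"
    unfolding W_def by (rule energy_stat_eq_sum_pairs[OF n m])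
  also have "\<dots> = (\<Sum>p\<in>pairs (n + m). \<sigma> * (energy_coeff n m p * \<eta> (fst p) (snd p)) + energy_coeff n m p * (u (fst p) + u (snd p)))"
  proof (intro sum.cong refl)
    fix p assume "p \<in> pairs (n + m)"
    then have "k (W (fst p)) (W (snd p)) = \<sigma> * \<eta> (fst p) (snd p) + u (fst p) + u (snd p)"
      by (intro off) (auto simp: pairs_def)
    then show "energy_coeff n m p * k (W (fst p)) (W (snd p))
      = \<sigma> * (energy_coeff n m p * \<eta> (fst p) (snd p)) + energy_coeff n m p * (u (fst p) + u (snd p))"
      by (simp add: algebra_simps)
  qed
  also have "\<dots> = \<sigma> * (\<Sum>p\<in>pairs (n + m). energy_coeff n m p * \<eta> (fst p) (snd p))"
    unfolding sum.distrib sum_energy_coeff_additive[OF n m] by (simp add: sum_distrib_left)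
  finally have E: "energy_stat k n m x y = \<sigma> * (\<Sum>p\<in>pairs (n + m). energy_coeff n m p * \<eta> (fst p) (snd p))" .
  have "V_star k a0 n m x y = var_ratio (n + m) (\<lambda>s t. \<sigma> * \<eta> s t)"
    unfolding V_star_def Let_def W_def[symmetric]
    by (rule U_centred_sum_of_squares[where u = u]) (use n m off diag sym zero in auto)
  then have V: "V_star k a0 n m x y = \<sigma>\<^sup>2 * var_ratio (n + m) \<eta>" by (simp add: var_ratio_scale)
  show ?thesis
    unfolding T_stat_def E V real_sqrt_mult using \<sigma>
    by (simp add: sum_divide_distrib[symmetric])
qed

section \<open>Studentisation\<close>

lemma cmod_iexp_diff_le: "cmod (iexp a - iexp b) \<le> \<bar>a - b\<bar>"
proof -
  have "iexp a - iexp b = iexp b * (iexp (a - b) - 1)"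
    by (simp add: algebra_simps exp_add[symmetric])
  then have "cmod (iexp a - iexp b) = cmod (iexp (a - b) - 1)" by (simp add: norm_mult)
  also have "\<dots> \<le> \<bar>a - b\<bar>" using iexp_approx1[of "a - b" 0] by simp
  finally show ?thesis .
qed

lemma inverse_sqrt_near_1:
  assumes "\<bar>R - 1\<bar> \<le> \<delta>" "\<delta> \<le> 1 / 2"
  shows "\<bar>1 / sqrt R - 1\<bar> \<le> 2 * \<delta>"
proof -
  have R: "1 / 2 \<le> R" using assms by (simp add: abs_if split: if_splits)
  define q where "q = sqrt R"
  have q: "0 < q" "q * q = R" using R by (simp_all add: q_def)
  have "1 / q - 1 = (1 - R) / (R + q)"
  proof -
    have "q * q + q \<noteq> 0" using q(1) add_pos_pos[of "q * q" q] by simp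
    then show ?thesis
      unfolding q(2)[symmetric] using q(1) by (simp add: divide_simps) (simp add: algebra_simps)
  qed
  then have "\<bar>1 / q - 1\<bar> = \<bar>R - 1\<bar> / (R + q)" using q R by (simp add: abs_divide abs_minus_commute)
  also have "\<dots> \<le> \<delta> / (1 / 2)" using assms R q by (intro frac_le) auto
  finally show ?thesis by (simp add: q_def)
qed

text \<open>Where \<open>R\<close> is within \<open>\<delta>\<close> of \<open>1\<close>, the argument of the exponential changes by at most \<open>2 * \<bar>u\<bar> * \<delta> * \<bar>S\<bar>\<close>.
  Elsewhere the exponentials differ by at most \<open>2 \<le> 2 * \<bar>R - 1\<bar> / \<delta>\<close>. This also covers points with
  \<open>R \<le> 0\<close>, where the quotient has no meaning.\<close>

lemma (in prob_space) studentised_char_bound: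
  fixes S R :: "'a \<Rightarrow> real"
  assumes S: "S \<in> borel_measurable M" and S2: "integrable M (\<lambda>w. (S w)\<^sup>2)" "expectation (\<lambda>w. (S w)\<^sup>2) \<le> 1"
    and R: "integrable M R" and \<delta>: "0 < \<delta>" "\<delta> \<le> 1 / 2"
  shows "cmod ((\<integral>w. iexp (u * (S w / sqrt (R w))) \<partial>M) - (\<integral>w. iexp (u * S w) \<partial>M))
    \<le> 2 * \<bar>u\<bar> * \<delta> + 2 / \<delta> * expectation (\<lambda>w. \<bar>R w - 1\<bar>)"
proof -
  have [measurable]: "S \<in> borel_measurable M" "R \<in> borel_measurable M" using S R by auto
  have S1: "integrable M S" by (rule square_integrable_imp_integrable[OF S S2(1)])
  have ES: "expectation (\<lambda>w. \<bar>S w\<bar>) \<le> 1"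
  proof -
    have "expectation (\<lambda>w. \<bar>S w\<bar>) \<le> expectation (\<lambda>w. (1 + (S w)\<^sup>2) / 2)"
    proof (rule integral_mono)
      show "\<bar>S w\<bar> \<le> (1 + (S w)\<^sup>2) / 2" for w
        using sum_squares_bound[of 1 "\<bar>S w\<bar>"] by simp
    qed (use S1 S2 in auto)
    also have "\<dots> \<le> 1" using S2 by (simp add: prob_space)
    finally show ?thesis .
  qed
  have i1: "integrable M (\<lambda>w. iexp (u * (S w / sqrt (R w))))" and i2: "integrable M (\<lambda>w. iexp (u * S w))"
    by (auto intro!: integrable_const_bound[of _ 1])
  have "cmod ((\<integral>w. iexp (u * (S w / sqrt (R w))) \<partial>M) - (\<integral>w. iexp (u * S w) \<partial>M))
     = cmod (\<integral>w. iexp (u * (S w / sqrt (R w))) - iexp (u * S w) \<partial>M)"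
    using i1 i2 by simp
  also have "\<dots> \<le> (\<integral>w. cmod (iexp (u * (S w / sqrt (R w))) - iexp (u * S w)) \<partial>M)"
    by (rule integral_norm_bound)
  also have "\<dots> \<le> (\<integral>w. 2 * \<bar>u\<bar> * \<delta> * \<bar>S w\<bar> + 2 / \<delta> * \<bar>R w - 1\<bar> \<partial>M)"
  proof (rule integral_mono)
    show "integrable M (\<lambda>w. cmod (iexp (u * (S w / sqrt (R w))) - iexp (u * S w)))" using i1 i2 by auto
    show "integrable M (\<lambda>w. 2 * \<bar>u\<bar> * \<delta> * \<bar>S w\<bar> + 2 / \<delta> * \<bar>R w - 1\<bar>)" using S1 R by auto
    fix w
    show "cmod (iexp (u * (S w / sqrt (R w))) - iexp (u * S w)) \<le> 2 * \<bar>u\<bar> * \<delta> * \<bar>S w\<bar> + 2 / \<delta> * \<bar>R w - 1\<bar>"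
    proof (cases "\<bar>R w - 1\<bar> \<le> \<delta>")
      case True
      have "u * (S w / sqrt (R w)) - u * S w = u * S w * (1 / sqrt (R w) - 1)" by (simp add: algebra_simps)
      then have "\<bar>u * (S w / sqrt (R w)) - u * S w\<bar> = \<bar>u\<bar> * \<bar>S w\<bar> * \<bar>1 / sqrt (R w) - 1\<bar>" by (simp only: abs_mult)
      also have "\<dots> \<le> \<bar>u\<bar> * \<bar>S w\<bar> * (2 * \<delta>)"
        using inverse_sqrt_near_1[OF True \<delta>(2)] by (intro mult_left_mono) auto
      finally have "cmod (iexp (u * (S w / sqrt (R w))) - iexp (u * S w)) \<le> \<bar>u\<bar> * \<bar>S w\<bar> * (2 * \<delta>)"
        using cmod_iexp_diff_le[of "u * (S w / sqrt (R w))" "u * S w"] by linarith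
      moreover have "0 \<le> 2 / \<delta> * \<bar>R w - 1\<bar>" using \<delta> by simp
      ultimately show ?thesis by (simp add: mult_ac)
    next
      case False
      have "cmod (iexp (u * (S w / sqrt (R w))) - iexp (u * S w)) \<le> 2"
        using norm_triangle_ineq4[of "iexp (u * (S w / sqrt (R w)))" "iexp (u * S w)"] by simp
      also have "2 = 2 / \<delta> * \<delta>" using \<delta> by simp
      also have "\<dots> \<le> 2 / \<delta> * \<bar>R w - 1\<bar>" using False \<delta> by (intro mult_left_mono) auto
      also have "\<dots> \<le> 2 * \<bar>u\<bar> * \<delta> * \<bar>S w\<bar> + 2 / \<delta> * \<bar>R w - 1\<bar>" using \<delta> by simp
      finally show ?thesis .
    qed
  qed
  also have "\<dots> = 2 * \<bar>u\<bar> * \<delta> * expectation (\<lambda>w. \<bar>S w\<bar>) + 2 / \<delta> * expectation (\<lambda>w. \<bar>R w - 1\<bar>)"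
    using S1 R by simp
  also have "\<dots> \<le> 2 * \<bar>u\<bar> * \<delta> * 1 + 2 / \<delta> * expectation (\<lambda>w. \<bar>R w - 1\<bar>)"
    using ES \<delta> by (intro add_mono mult_left_mono) auto
  finally show ?thesis by simp
qed

context degenerate_kernel
begin

text \<open>Taking the smaller index first makes the matrix symmetric for every \<open>w\<close>.\<close>

definition sample_matrix :: "(nat \<Rightarrow> 'x) \<Rightarrow> nat \<Rightarrow> nat \<Rightarrow> real" where
  "sample_matrix w s t = (if s = t then 0 else h (w (min s t)) (w (max s t)))"

lemma sample_matrix_sym: "sample_matrix w s t = sample_matrix w t s"
  by (simp add: sample_matrix_def min.commute max.commute)

lemma sample_matrix_diag: "sample_matrix w s s = 0"
  by (simp add: sample_matrix_def)

lemma sample_matrix_pair: "p \<in> pairs N \<Longrightarrow> sample_matrix w (fst p) (snd p) = h (w (fst p)) (w (snd p))"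
  by (auto simp: sample_matrix_def pairs_def)

lemma sample_matrix_eq:
  assumes "w \<in> space (sample {1..N})" "s \<in> {1..N}" "t \<in> {1..N}" "s \<noteq> t"
  shows "sample_matrix w s t = h (w s) (w t)"
  using assms h_sym[OF space_coordinate[OF assms(2,1)] space_coordinate[OF assms(3,1)]]
  by (auto simp: sample_matrix_def min_def max_def)

text \<open>The leading sum obeys the law of large numbers with weights \<open>2 / (N * (N - 3)) \<le> 8 / N\<^sup>2\<close>, whose sum is
  \<open>1 + 2 / (N - 3)\<close>. By orthogonality the squared row sums have mean \<open>N - 1\<close>, so the two correction terms
  contribute at most \<open>3 / (N - 3)\<close> and \<open>1 / (N - 3)\<close>.\<close>

lemma var_ratio_concentration:
  assumes N: "4 \<le> N" and sq_norm: "sq_norm = 1"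
  defines "\<Omega> \<equiv> sample {1..N}"
  shows "integrable \<Omega> (\<lambda>w. var_ratio N (sample_matrix w))"
    and "(\<integral>w. \<bar>var_ratio N (sample_matrix w) - 1\<bar> \<partial>\<Omega>) \<le> 16 * (sqrt (lindeberg N) + lindeberg N) + 6 / (real N - 3)"
proof -
  interpret \<Omega>: prob_space \<Omega> unfolding \<Omega>_def by (rule prob_space_sample)
  have Np: "4 \<le> real N" using N by simp
  have pos: "fst p \<in> {1..N} \<and> snd p \<in> {1..N} \<and> fst p < snd p" if "p \<in> pairs N" for p
    using that by (auto simp: pairs_def)
  define c where "c = 2 / (real N * (real N - 3))"
  define A where "A w = (\<Sum>p\<in>pairs N. c * ((h (w (fst p)) (w (snd p)))\<^sup>2 - 1))" for w
  define q where "q s w = (\<Sum>t\<in>{1..N} - {s}. 1 * h (w t) (w s))" for s w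
  define Q where "Q w = (\<Sum>p\<in>pairs N. 1 * h (w (fst p)) (w (snd p)))" for w
  define d1 where "d1 = 2 / (real N * (real N - 2) * (real N - 3))"
  define d2 where "d2 = 4 / (real N * (real N - 1) * (real N - 2) * (real N - 3))"
  have d: "0 \<le> d1" "0 \<le> d2" using Np by (auto simp: d1_def d2_def)
  have c0: "0 \<le> c" using Np by (simp add: c_def)
  have c1: "c \<le> 8 / (real N)\<^sup>2"
  proof -
    have "real N * (real N / 4) \<le> real N * (real N - 3)" using Np by (intro mult_left_mono) auto
    then have "c \<le> 2 / (real N * (real N / 4))" unfolding c_def using Np by (intro divide_left_mono) auto
    then show ?thesis by (simp add: power2_eq_square)
  qed
  have h2: "(\<integral>z. (h (fst z) (snd z))\<^sup>2 \<partial>(L \<Otimes>\<^sub>M L)) = 1" using sq_norm by (simp add: sq_norm_def)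
  have A_int: "integrable \<Omega> A" and EA: "(\<integral>w. \<bar>A w\<bar> \<partial>\<Omega>) \<le> 16 * (sqrt (lindeberg N) + lindeberg N)"
    using pair_average_law_of_large_numbers[of "\<lambda>x y. (h x y)\<^sup>2" N "\<lambda>_. c" 8] h_meas h_sq_int N c0 c1
    unfolding h2 lindeberg_def[symmetric] A_def[symmetric] \<Omega>_def[symmetric] by auto
  have q_int: "integrable \<Omega> (\<lambda>w. (q s w)\<^sup>2)" and Eq: "(\<integral>w. (q s w)\<^sup>2 \<partial>\<Omega>) = real N - 1" if s: "s \<in> {1..N}" for s
  proof -
    have F: "finite ({1..N} - {s})" by simp
    have "real (card ({1..N} - {s})) = real N - 1" using s N by (simp add: of_nat_diff)
    then show "(\<integral>w. (q s w)\<^sup>2 \<partial>\<Omega>) = real N - 1"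
      unfolding q_def \<Omega>_def using increment_square_integrable(2)[OF s F order_refl, of "\<lambda>_. 1"] sq_norm by simp
    show "integrable \<Omega> (\<lambda>w. (q s w)\<^sup>2)"
      unfolding q_def \<Omega>_def by (rule increment_square_integrable(1)[OF s F order_refl])
  qed
  have Q_int: "integrable \<Omega> (\<lambda>w. (Q w)\<^sup>2)" and EQ: "(\<integral>w. (Q w)\<^sup>2 \<partial>\<Omega>) = real N * (real N - 1) / 2"
    unfolding Q_def \<Omega>_def
    using integrable_sum_h_sq[OF finite_pairs pos, where \<beta> = "\<lambda>_. 1"] integral_sum_h_sq[OF finite_pairs pos, where \<beta> = "\<lambda>_. 1"]
      card_pairs[of N] sq_norm by simp_all
  have dec: "var_ratio N (sample_matrix w) = A w + (1 + 2 / (real N - 3)) - d1 * (\<Sum>s=1..N. (q s w)\<^sup>2) + d2 * (Q w)\<^sup>2"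
    if w: "w \<in> space \<Omega>" for w
  proof -
    have 1: "(\<Sum>t=1..N. sample_matrix w s t) = q s w" if s: "s \<in> {1..N}" for s
    proof -
      have "(\<Sum>t=1..N. sample_matrix w s t) = (\<Sum>t\<in>{1..N} - {s}. sample_matrix w s t)"
        unfolding sum_remove_one[OF s] by (simp add: sample_matrix_diag)
      also have "\<dots> = q s w"
        unfolding q_def using s w by (intro sum.cong refl) (auto simp: sample_matrix_sym[of w s] sample_matrix_eq \<Omega>_def)
      finally show ?thesis .
    qed
    have 2: "(\<Sum>p\<in>pairs N. sample_matrix w (fst p) (snd p)) = Q w"
      unfolding Q_def by (intro sum.cong refl) (simp add: sample_matrix_pair)
    have 3: "(\<Sum>p\<in>pairs N. (sample_matrix w (fst p) (snd p))\<^sup>2) = (\<Sum>p\<in>pairs N. (h (w (fst p)) (w (snd p)))\<^sup>2)"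
      by (intro sum.cong refl) (simp add: sample_matrix_pair)
    have 4: "c * (\<Sum>p\<in>pairs N. (h (w (fst p)) (w (snd p)))\<^sup>2) = A w + (1 + 2 / (real N - 3))"
    proof -
      have "A w = c * (\<Sum>p\<in>pairs N. (h (w (fst p)) (w (snd p)))\<^sup>2) - c * real (card (pairs N))"
        unfolding A_def by (simp add: sum_subtractf sum_distrib_left[symmetric] right_diff_distrib)
      also have "c * real (card (pairs N)) = 1 + 2 / (real N - 3)"
        unfolding card_pairs c_def using Np by (simp add: divide_simps) (simp add: algebra_simps)
      finally show ?thesis by simp
    qed
    have 5: "(\<Sum>s=1..N. (\<Sum>t=1..N. sample_matrix w s t)\<^sup>2) = (\<Sum>s=1..N. (q s w)\<^sup>2)"
      using 1 by (intro sum.cong refl) simp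
    show ?thesis
      unfolding var_ratio_def 2 3 5 c_def[symmetric] d1_def[symmetric] 4
      by (simp add: d2_def power2_eq_square)
  qed
  have int: "integrable \<Omega> (\<lambda>w. A w + (1 + 2 / (real N - 3)) - d1 * (\<Sum>s=1..N. (q s w)\<^sup>2) + d2 * (Q w)\<^sup>2)"
    using A_int q_int Q_int
    by (intro Bochner_Integration.integrable_add Bochner_Integration.integrable_diff integrable_mult_right
        Bochner_Integration.integrable_sum) auto
  then show int': "integrable \<Omega> (\<lambda>w. var_ratio N (sample_matrix w))"
    by (rule Bochner_Integration.integrable_cong[THEN iffD1, OF refl _, rotated]) (simp add: dec)
  have "(\<integral>w. \<bar>var_ratio N (sample_matrix w) - 1\<bar> \<partial>\<Omega>)
    \<le> (\<integral>w. \<bar>A w\<bar> + 2 / (real N - 3) + d1 * (\<Sum>s=1..N. (q s w)\<^sup>2) + d2 * (Q w)\<^sup>2 \<partial>\<Omega>)"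
  proof (rule integral_mono)
    show "integrable \<Omega> (\<lambda>w. \<bar>var_ratio N (sample_matrix w) - 1\<bar>)" using int' by auto
    show "integrable \<Omega> (\<lambda>w. \<bar>A w\<bar> + 2 / (real N - 3) + d1 * (\<Sum>s=1..N. (q s w)\<^sup>2) + d2 * (Q w)\<^sup>2)"
      using A_int q_int Q_int
      by (intro Bochner_Integration.integrable_add integrable_mult_right Bochner_Integration.integrable_sum) auto
    fix w assume w: "w \<in> space \<Omega>"
    have "0 \<le> d1 * (\<Sum>s=1..N. (q s w)\<^sup>2)" "0 \<le> d2 * (Q w)\<^sup>2" "0 \<le> 2 / (real N - 3)"
      using d Np by (auto intro!: mult_nonneg_nonneg sum_nonneg)
    then show "\<bar>var_ratio N (sample_matrix w) - 1\<bar> \<le> \<bar>A w\<bar> + 2 / (real N - 3) + d1 * (\<Sum>s=1..N. (q s w)\<^sup>2) + d2 * (Q w)\<^sup>2"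
      unfolding dec[OF w] by linarith
  qed
  also have "\<dots> = (\<integral>w. \<bar>A w\<bar> \<partial>\<Omega>) + 2 / (real N - 3) + d1 * (real N * (real N - 1)) + d2 * (real N * (real N - 1) / 2)"
  proof -
    have s: "(\<integral>w. (\<Sum>s=1..N. (q s w)\<^sup>2) \<partial>\<Omega>) = real N * (real N - 1)"
      using q_int by (subst Bochner_Integration.integral_sum) (auto simp: Eq)
    have si: "integrable \<Omega> (\<lambda>w. \<Sum>s=1..N. (q s w)\<^sup>2)"
      using q_int by (intro Bochner_Integration.integrable_sum) auto
    have "(\<integral>w. \<bar>A w\<bar> + 2 / (real N - 3) + d1 * (\<Sum>s=1..N. (q s w)\<^sup>2) + d2 * (Q w)\<^sup>2 \<partial>\<Omega>)
      = (\<integral>w. \<bar>A w\<bar> \<partial>\<Omega>) + 2 / (real N - 3) + d1 * (\<integral>w. (\<Sum>s=1..N. (q s w)\<^sup>2) \<partial>\<Omega>) + d2 * (\<integral>w. (Q w)\<^sup>2 \<partial>\<Omega>)"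
      using A_int si Q_int by (simp add: \<Omega>.prob_space del: Bochner_Integration.integral_sum)
    then show ?thesis unfolding s EQ .
  qed
  also have "d1 * (real N * (real N - 1)) \<le> 3 / (real N - 3)"
  proof -
    have "d1 * (real N * (real N - 1)) = 2 * ((real N - 1) / (real N - 2)) / (real N - 3)"
      using Np by (simp add: d1_def)
    also have "\<dots> \<le> 2 * (3 / 2) / (real N - 3)"
      using Np by (intro divide_right_mono mult_left_mono) (auto simp: divide_simps)
    finally show ?thesis by simp
  qed
  also have "d2 * (real N * (real N - 1) / 2) \<le> 1 / (real N - 3)"
  proof -
    have "d2 * (real N * (real N - 1) / 2) = 2 / (real N - 2) / (real N - 3)"
      using Np by (simp add: d2_def divide_simps) (simp add: algebra_simps)
    also have "\<dots> \<le> 1 / (real N - 3)"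
      using Np by (intro divide_right_mono) (auto simp: divide_simps)
    finally show ?thesis .
  qed
  finally have "(\<integral>w. \<bar>var_ratio N (sample_matrix w) - 1\<bar> \<partial>\<Omega>)
      \<le> (\<integral>w. \<bar>A w\<bar> \<partial>\<Omega>) + 2 / (real N - 3) + 3 / (real N - 3) + 1 / (real N - 3)" by simp
  also have "\<dots> = (\<integral>w. \<bar>A w\<bar> \<partial>\<Omega>) + 6 / (real N - 3)" by (simp add: add_divide_distrib[symmetric])
  finally show "(\<integral>w. \<bar>var_ratio N (sample_matrix w) - 1\<bar> \<partial>\<Omega>) \<le> 16 * (sqrt (lindeberg N) + lindeberg N) + 6 / (real N - 3)"
    using EA by linarith
qed

theorem studentised_clt_bound:
  assumes N: "4 \<le> N" and K: "1 \<le> K" and sq_norm: "sq_norm = 1"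
    and b: "\<And>p. p \<in> pairs N \<Longrightarrow> \<bar>b p\<bar> \<le> K / real N"
    and b1: "(\<Sum>p\<in>pairs N. (b p)\<^sup>2) = 1" and \<epsilon>: "0 < \<epsilon>" "\<epsilon> \<le> 1 / 2"
  shows "cmod ((\<integral>w. iexp (u * ((\<Sum>p\<in>pairs N. b p * sample_matrix w (fst p) (snd p)) / sqrt (var_ratio N (sample_matrix w)))) \<partial>sample {1..N})
      - exp (- (u\<^sup>2 / 2)))
    \<le> u\<^sup>2 * K\<^sup>2 * (sqrt (lindeberg N) + lindeberg N + sqrt G_sq_norm) + 2 * \<epsilon> * u\<^sup>2 + 256 / \<epsilon>\<^sup>2 * (1 + u\<^sup>2)\<^sup>2 * K ^ 4 * lindeberg N
      + (2 * \<bar>u\<bar> * \<epsilon> + 2 / \<epsilon> * (16 * (sqrt (lindeberg N) + lindeberg N) + 6 / (real N - 3)))"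
proof -
  let ?\<Omega> = "sample {1..N}"
  interpret \<Omega>: prob_space ?\<Omega> by (rule prob_space_sample)
  have N0: "0 < N" using N by simp
  have pos: "fst p \<in> {1..N} \<and> snd p \<in> {1..N} \<and> fst p < snd p" if "p \<in> pairs N" for p
    using that by (auto simp: pairs_def)
  define S where "S w = (\<Sum>p\<in>pairs N. b p * h (w (fst p)) (w (snd p)))" for w
  have SK: "(\<Sum>p\<in>pairs N. b p * sample_matrix w (fst p) (snd p)) = S w" for w
    unfolding S_def by (intro sum.cong refl) (simp add: sample_matrix_pair)
  have S_meas: "S \<in> borel_measurable ?\<Omega>"
    unfolding S_def using pos
    by (intro borel_measurable_sum borel_measurable_times borel_measurable_const h_comp measurable_coordinate) auto
  have S2: "integrable ?\<Omega> (\<lambda>w. (S w)\<^sup>2)" "\<Omega>.expectation (\<lambda>w. (S w)\<^sup>2) \<le> 1"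
    unfolding S_def using integrable_sum_h_sq[OF finite_pairs pos, where \<beta> = b] integral_sum_h_sq[OF finite_pairs pos, where \<beta> = b] b1 sq_norm
    by simp_all
  note V = var_ratio_concentration[OF N sq_norm]
  have 1: "cmod ((\<integral>w. iexp (u * (S w / sqrt (var_ratio N (sample_matrix w)))) \<partial>?\<Omega>) - (\<integral>w. iexp (u * S w) \<partial>?\<Omega>))
    \<le> 2 * \<bar>u\<bar> * \<epsilon> + 2 / \<epsilon> * (16 * (sqrt (lindeberg N) + lindeberg N) + 6 / (real N - 3))"
  proof (rule order_trans[OF \<Omega>.studentised_char_bound[OF S_meas S2 V(1) \<epsilon>]])
    show "2 * \<bar>u\<bar> * \<epsilon> + 2 / \<epsilon> * \<Omega>.expectation (\<lambda>w. \<bar>var_ratio N (sample_matrix w) - 1\<bar>)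
      \<le> 2 * \<bar>u\<bar> * \<epsilon> + 2 / \<epsilon> * (16 * (sqrt (lindeberg N) + lindeberg N) + 6 / (real N - 3))"
      using V(2) \<epsilon> by (intro add_mono mult_left_mono) auto
  qed
  have 2: "cmod ((\<integral>w. iexp (u * S w) \<partial>?\<Omega>) - exp (- (u\<^sup>2 / 2)))
    \<le> u\<^sup>2 * K\<^sup>2 * (sqrt (lindeberg N) + lindeberg N + sqrt G_sq_norm) + 2 * \<epsilon> * u\<^sup>2 + 256 / \<epsilon>\<^sup>2 * (1 + u\<^sup>2)\<^sup>2 * K ^ 4 * lindeberg N"
    unfolding S_def using \<epsilon> by (intro degenerate_clt_bound[OF N0 K sq_norm b b1]) auto
  show ?thesis
    unfolding SK
    using norm_triangle_ineq[of "(\<integral>w. iexp (u * (S w / sqrt (var_ratio N (sample_matrix w)))) \<partial>?\<Omega>) - (\<integral>w. iexp (u * S w) \<partial>?\<Omega>)"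
        "(\<integral>w. iexp (u * S w) \<partial>?\<Omega>) - exp (- (u\<^sup>2 / 2))"] 1 2
    by simp
qed

end

section \<open>Double centering of a kernel\<close>

lemma pow4_add4: "(a + b + c + d) ^ 4 \<le> 64 * (a ^ 4 + b ^ 4 + c ^ 4 + (d :: real) ^ 4)"
proof -
  have two: "(x + y) ^ 4 \<le> 8 * (x ^ 4 + y ^ 4)" for x y :: real
  proof -
    have "(x + y)\<^sup>2 \<le> 2 * (x\<^sup>2 + y\<^sup>2)" using sum_squares_bound[of x y] by (simp add: power2_sum)
    then have "((x + y)\<^sup>2)\<^sup>2 \<le> (2 * (x\<^sup>2 + y\<^sup>2))\<^sup>2" by (rule power_mono) simp
    also have "\<dots> = 4 * (x\<^sup>2 + y\<^sup>2)\<^sup>2" unfolding power_mult_distrib by simp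
    also have "(x\<^sup>2 + y\<^sup>2)\<^sup>2 \<le> 2 * ((x\<^sup>2)\<^sup>2 + (y\<^sup>2)\<^sup>2)"
      using sum_squares_bound[of "x\<^sup>2" "y\<^sup>2"] by (simp add: power2_sum)
    finally show ?thesis by simp
  qed
  show ?thesis using two[of "a + b" "c + d"] two[of a b] two[of c d] by (simp add: add.assoc)
qed

lemma abs_prod4_le: "\<bar>a * b * c * d\<bar> \<le> a ^ 4 + b ^ 4 + c ^ 4 + (d :: real) ^ 4"
proof -
  have "\<bar>a * b * c * d\<bar> = \<bar>(a * b) * (c * d)\<bar>" by (simp add: mult.assoc)
  also have "\<dots> \<le> ((a * b)\<^sup>2 + (c * d)\<^sup>2) / 2"
    using sum_squares_bound[of "\<bar>a * b\<bar>" "\<bar>c * d\<bar>"] unfolding power2_abs abs_mult[of "a * b"] by simp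
  also have "(a * b)\<^sup>2 \<le> (a\<^sup>2)\<^sup>2 + (b\<^sup>2)\<^sup>2" using abs_mult_le_squares[of "a\<^sup>2" "b\<^sup>2"] by (simp add: power_mult_distrib)
  also have "(c * d)\<^sup>2 \<le> (c\<^sup>2)\<^sup>2 + (d\<^sup>2)\<^sup>2" using abs_mult_le_squares[of "c\<^sup>2" "d\<^sup>2"] by (simp add: power_mult_distrib)
  also have "((a\<^sup>2)\<^sup>2 + (b\<^sup>2)\<^sup>2 + ((c\<^sup>2)\<^sup>2 + (d\<^sup>2)\<^sup>2)) / 2 \<le> a ^ 4 + b ^ 4 + c ^ 4 + d ^ 4"
  proof -
    have "0 \<le> a ^ 4" "0 \<le> b ^ 4" "0 \<le> c ^ 4" "0 \<le> d ^ 4" by simp_all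
    then show ?thesis by simp
  qed
  finally show ?thesis by simp
qed

locale centred_kernel = law L for L :: "'x measure" +
  fixes k :: "'x \<Rightarrow> 'x \<Rightarrow> real"
  assumes k_meas: "(\<lambda>z. k (fst z) (snd z)) \<in> borel_measurable (L \<Otimes>\<^sub>M L)"
    and k_sym: "\<And>x y. x \<in> space L \<Longrightarrow> y \<in> space L \<Longrightarrow> k x y = k y x"
    and k4: "integrable (L \<Otimes>\<^sub>M L) (\<lambda>z. (k (fst z) (snd z)) ^ 4)"
begin

sublocale LL: pair_prob_space L L ..

lemmas k_comp [measurable (raw)] = measurable_kernel_comp[OF k_meas]

lemma k2: "integrable (L \<Otimes>\<^sub>M L) (\<lambda>z. (k (fst z) (snd z))\<^sup>2)"
proof (rule LL.P.square_integrable_imp_integrable)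
  show "integrable (L \<Otimes>\<^sub>M L) (\<lambda>z. ((k (fst z) (snd z))\<^sup>2)\<^sup>2)" using k4 by simp
qed (use k_meas in measurable)

lemma k1: "integrable (L \<Otimes>\<^sub>M L) (\<lambda>z. k (fst z) (snd z))"
  by (rule LL.P.square_integrable_imp_integrable[OF k_meas k2])

definition \<mu> :: real where "\<mu> = (\<integral>z. k (fst z) (snd z) \<partial>(L \<Otimes>\<^sub>M L))"
definition kbar :: "'x \<Rightarrow> real" where "kbar x = (\<integral>y. k x y \<partial>L)"

lemma kbar_meas [measurable]: "kbar \<in> borel_measurable L"
  unfolding kbar_def by measurable

lemma AE_k4: "AE x in L. integrable L (\<lambda>y. (k x y) ^ 4)"
  using LL.AE_integrable_fst[of "\<lambda>x y. (k x y) ^ 4"] k4 by (simp add: case_prod_unfold)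

lemma ex_good: "\<exists>A. A \<in> sets L \<and> A \<subseteq> {x \<in> space L. integrable L (\<lambda>y. (k x y) ^ 4)} \<and> (AE x in L. x \<in> A)"
proof -
  obtain N where N: "{x \<in> space L. \<not> integrable L (\<lambda>y. (k x y) ^ 4)} \<subseteq> N" "emeasure L N = 0" "N \<in> sets L"
    using AE_E[OF AE_k4] by blast
  have "N \<in> null_sets L" using N by (simp add: null_setsI)
  then have "AE x in L. x \<notin> N" by (rule AE_not_in)
  then have "AE x in L. x \<in> space L - N" using AE_space by eventually_elim auto
  then show ?thesis using N by (intro exI[of _ "space L - N"]) auto
qed

text \<open>A measurable set of full measure on which the sections of \<open>k\<close> have a fourth moment.\<close>

definition good :: "'x set" where
  "good = (SOME A. A \<in> sets L \<and> A \<subseteq> {x \<in> space L. integrable L (\<lambda>y. (k x y) ^ 4)} \<and> (AE x in L. x \<in> A))"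

lemma good_sets [measurable]: "good \<in> sets L" and AE_good: "AE x in L. x \<in> good"
  and good_subset: "good \<subseteq> {x \<in> space L. integrable L (\<lambda>y. (k x y) ^ 4)}"
  using someI_ex[OF ex_good] unfolding good_def by blast+

lemma good_space: "x \<in> good \<Longrightarrow> x \<in> space L"
  using good_subset by auto

lemma good_k4: "x \<in> good \<Longrightarrow> integrable L (\<lambda>y. (k x y) ^ 4)"
  using good_subset by auto

lemma good_k2: "x \<in> good \<Longrightarrow> integrable L (\<lambda>y. (k x y)\<^sup>2)"
proof (rule square_integrable_imp_integrable)
  assume x: "x \<in> good"
  show "(\<lambda>y. (k x y)\<^sup>2) \<in> borel_measurable L" using good_space[OF x] by measurable
  show "integrable L (\<lambda>y. ((k x y)\<^sup>2)\<^sup>2)" using good_k4[OF x] by simp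
qed

lemma good_k1: "x \<in> good \<Longrightarrow> integrable L (k x)"
proof (rule square_integrable_imp_integrable)
  assume x: "x \<in> good"
  show "k x \<in> borel_measurable L" using good_space[OF x] by measurable
  show "integrable L (\<lambda>y. (k x y)\<^sup>2)" by (rule good_k2[OF x])
qed

lemma kbar_pow4_le: "x \<in> good \<Longrightarrow> kbar x ^ 4 \<le> (\<integral>y. (k x y) ^ 4 \<partial>L)"
proof -
  assume x: "x \<in> good"
  have m: "k x \<in> borel_measurable L" using good_space[OF x] by measurable
  have "(kbar x)\<^sup>2 \<le> (\<integral>y. (k x y)\<^sup>2 \<partial>L)"
    unfolding kbar_def using m good_k2[OF x] by (rule power2_expectation_le)
  then have "((kbar x)\<^sup>2)\<^sup>2 \<le> (\<integral>y. (k x y)\<^sup>2 \<partial>L)\<^sup>2" by (rule power_mono) simp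
  also have "\<dots> \<le> (\<integral>y. ((k x y)\<^sup>2)\<^sup>2 \<partial>L)"
    using m good_k4[OF x] by (intro power2_expectation_le) auto
  finally show ?thesis by simp
qed

lemma kbar4: "integrable L (\<lambda>x. kbar x ^ 4)"
proof (rule Bochner_Integration.integrable_bound)
  have "integrable (L \<Otimes>\<^sub>M L) (\<lambda>(x, y). (k x y) ^ 4)" using k4 by (simp add: case_prod_unfold)
  from LL.integrable_fst[OF this] show "integrable L (\<lambda>x. \<integral>y. (k x y) ^ 4 \<partial>L)" .
  show "AE x in L. norm (kbar x ^ 4) \<le> norm (\<integral>y. (k x y) ^ 4 \<partial>L)"
    using AE_good by eventually_elim (use kbar_pow4_le in force)
qed measurable

lemma kbar2: "integrable L (\<lambda>x. (kbar x)\<^sup>2)"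
proof (rule square_integrable_imp_integrable)
  show "integrable L (\<lambda>x. ((kbar x)\<^sup>2)\<^sup>2)" using kbar4 by simp
qed measurable

lemma kbar1: "integrable L kbar"
  by (rule square_integrable_imp_integrable[OF _ kbar2]) measurable

lemma integral_kbar: "(\<integral>x. kbar x \<partial>L) = \<mu>"
  unfolding kbar_def \<mu>_def using LL.integral_fst[of k] k1 by (simp add: case_prod_unfold)

definition dk :: "'x \<Rightarrow> 'x \<Rightarrow> real" where "dk x y = k x y - kbar x - kbar y + \<mu>"

lemma dk_meas: "(\<lambda>z. dk (fst z) (snd z)) \<in> borel_measurable (L \<Otimes>\<^sub>M L)"
  unfolding dk_def by measurable

lemmas dk_comp [measurable (raw)] = measurable_kernel_comp[OF dk_meas]

lemma dk_sym: "x \<in> space L \<Longrightarrow> y \<in> space L \<Longrightarrow> dk x y = dk y x"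
  using k_sym[of x y] by (simp add: dk_def)

lemma dk4: "integrable (L \<Otimes>\<^sub>M L) (\<lambda>z. (dk (fst z) (snd z)) ^ 4)"
proof (rule Bochner_Integration.integrable_bound)
  show "integrable (L \<Otimes>\<^sub>M L) (\<lambda>z. 64 * ((k (fst z) (snd z)) ^ 4 + (kbar (fst z)) ^ 4 + (kbar (snd z)) ^ 4 + \<mu> ^ 4))"
    using k4 integrable_pair_prod[OF kbar4, of "\<lambda>_. 1"] integrable_pair_prod[of "\<lambda>_. 1", OF _ kbar4] by simp
  show "AE z in L \<Otimes>\<^sub>M L. norm ((dk (fst z) (snd z)) ^ 4)
      \<le> norm (64 * ((k (fst z) (snd z)) ^ 4 + (kbar (fst z)) ^ 4 + (kbar (snd z)) ^ 4 + \<mu> ^ 4))"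
  proof (rule AE_I2)
    fix z
    show "norm ((dk (fst z) (snd z)) ^ 4)
      \<le> norm (64 * ((k (fst z) (snd z)) ^ 4 + (kbar (fst z)) ^ 4 + (kbar (snd z)) ^ 4 + \<mu> ^ 4))"
      using pow4_add4[of "k (fst z) (snd z)" "- kbar (fst z)" "- kbar (snd z)" \<mu>] by (simp add: dk_def)
  qed
qed (use dk_meas in measurable)

lemma dk2: "integrable (L \<Otimes>\<^sub>M L) (\<lambda>z. (dk (fst z) (snd z))\<^sup>2)"
proof (rule LL.P.square_integrable_imp_integrable)
  show "integrable (L \<Otimes>\<^sub>M L) (\<lambda>z. ((dk (fst z) (snd z))\<^sup>2)\<^sup>2)" using dk4 by simp
qed (use dk_meas in measurable)

lemma good_dk:
  assumes x: "x \<in> good"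
  shows "integrable L (\<lambda>y. (dk x y)\<^sup>2)" and "(\<integral>y. dk x y \<partial>L) = 0"
proof -
  have m: "k x \<in> borel_measurable L" using good_space[OF x] by measurable
  have p: "integrable L (\<lambda>y. k x y * kbar y)"
  proof (rule Bochner_Integration.integrable_bound)
    show "integrable L (\<lambda>y. (k x y)\<^sup>2 + (kbar y)\<^sup>2)" using good_k2[OF x] kbar2 by auto
    show "AE y in L. norm (k x y * kbar y) \<le> norm ((k x y)\<^sup>2 + (kbar y)\<^sup>2)" by (simp add: abs_mult_le_squares)
  qed (use m in measurable)
  have e: "(dk x y)\<^sup>2 = (k x y)\<^sup>2 + (kbar y)\<^sup>2 - 2 * (k x y * kbar y) + 2 * (\<mu> - kbar x) * k x y
      - 2 * (\<mu> - kbar x) * kbar y + (\<mu> - kbar x)\<^sup>2" for y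
    by (simp add: dk_def power2_eq_square algebra_simps)
  show "integrable L (\<lambda>y. (dk x y)\<^sup>2)"
    unfolding e using good_k2[OF x] kbar2 p good_k1[OF x] kbar1 by auto
  have "(\<integral>y. dk x y \<partial>L) = (\<integral>y. k x y \<partial>L) - kbar x - (\<integral>y. kbar y \<partial>L) + \<mu>"
    unfolding dk_def using good_k1[OF x] kbar1 by (simp add: prob_space)
  then show "(\<integral>y. dk x y \<partial>L) = 0" by (simp add: integral_kbar kbar_def[symmetric])
qed

definition V2 :: real where "V2 = (\<integral>z. (dk (fst z) (snd z))\<^sup>2 \<partial>(L \<Otimes>\<^sub>M L))"

text \<open>Of second moment \<open>1\<close> if \<open>V2\<close> is positive, and degenerate at every point because of the value \<open>0\<close> outside of
  \<open>good\<close>.\<close>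

definition hk :: "'x \<Rightarrow> 'x \<Rightarrow> real" where
  "hk x y = (if x \<in> good \<and> y \<in> good then dk x y / sqrt V2 else 0)"

lemma hk_eq: "x \<in> good \<Longrightarrow> y \<in> good \<Longrightarrow> hk x y = dk x y / sqrt V2"
  by (simp add: hk_def)

lemma AE_good_pair: "AE z in L \<Otimes>\<^sub>M L. fst z \<in> good \<and> snd z \<in> good"
proof (rule LL.AE_pair_measure)
  show "{z \<in> space (L \<Otimes>\<^sub>M L). fst z \<in> good \<and> snd z \<in> good} \<in> sets (L \<Otimes>\<^sub>M L)" by measurable
  show "AE x in L. AE y in L. fst (x, y) \<in> good \<and> snd (x, y) \<in> good"
    using AE_good by eventually_elim (use AE_good in auto)
qed

lemma hk_meas: "(\<lambda>z. hk (fst z) (snd z)) \<in> borel_measurable (L \<Otimes>\<^sub>M L)"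
  unfolding hk_def by measurable

lemma degenerate_kernel_hk: "degenerate_kernel L hk"
proof unfold_locales
  show "(\<lambda>z. hk (fst z) (snd z)) \<in> borel_measurable (L \<Otimes>\<^sub>M L)" by (rule hk_meas)
  show "hk x y = hk y x" if "x \<in> space L" "y \<in> space L" for x y
    using dk_sym[OF that] by (simp add: hk_def)
  show "integrable L (\<lambda>y. (hk x y)\<^sup>2)" if x: "x \<in> space L" for x
  proof (cases "x \<in> good")
    case True
    show ?thesis
    proof (rule Bochner_Integration.integrable_bound[where f = "\<lambda>y. (dk x y)\<^sup>2 / (sqrt V2)\<^sup>2"])
      show "integrable L (\<lambda>y. (dk x y)\<^sup>2 / (sqrt V2)\<^sup>2)" using good_dk(1)[OF True] by simp
      show "(\<lambda>y. (hk x y)\<^sup>2) \<in> borel_measurable L"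
        using measurable_kernel_comp[OF hk_meas measurable_const[OF x] measurable_ident_sets[OF refl]] by measurable
    qed (auto simp: hk_def power_divide)
  qed (simp add: hk_def)
  show "(\<integral>y. hk x y \<partial>L) = 0" if x: "x \<in> space L" for x
  proof (cases "x \<in> good")
    case True
    have "(\<integral>y. hk x y \<partial>L) = (\<integral>y. dk x y / sqrt V2 \<partial>L)"
    proof (rule integral_cong_AE)
      show "hk x \<in> borel_measurable L"
        using measurable_kernel_comp[OF hk_meas measurable_const[OF x] measurable_ident_sets[OF refl]] .
      show "(\<lambda>y. dk x y / sqrt V2) \<in> borel_measurable L" using x by measurable
      show "AE y in L. hk x y = dk x y / sqrt V2"
        using AE_good by eventually_elim (use True in \<open>simp add: hk_eq\<close>)
    qed
    then show ?thesis using good_dk(2)[OF True] by simp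
  qed (simp add: hk_def)
  show "integrable (L \<Otimes>\<^sub>M L) (\<lambda>z. (hk (fst z) (snd z))\<^sup>2)"
  proof (rule Bochner_Integration.integrable_bound[where f = "\<lambda>z. (dk (fst z) (snd z))\<^sup>2 / (sqrt V2)\<^sup>2"])
    show "integrable (L \<Otimes>\<^sub>M L) (\<lambda>z. (dk (fst z) (snd z))\<^sup>2 / (sqrt V2)\<^sup>2)" using dk2 by simp
  qed (use hk_meas in \<open>auto simp: hk_def power_divide\<close>)
qed

sublocale H: degenerate_kernel L hk
  by (rule degenerate_kernel_hk)

lemma integral_hk_sq:
  assumes V: "0 < V2"
  shows "H.sq_norm = 1"
proof -
  have "H.sq_norm = (\<integral>z. (dk (fst z) (snd z))\<^sup>2 / V2 \<partial>(L \<Otimes>\<^sub>M L))"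
    unfolding H.sq_norm_def
  proof (rule integral_cong_AE)
    show "AE z in L \<Otimes>\<^sub>M L. (hk (fst z) (snd z))\<^sup>2 = (dk (fst z) (snd z))\<^sup>2 / V2"
      using AE_good_pair by eventually_elim (use V in \<open>simp add: hk_eq power_divide\<close>)
  qed (use hk_meas dk_meas in measurable)
  also have "\<dots> = 1" using V by (simp add: V2_def[symmetric])
  finally show ?thesis .
qed

lemma k_mean_eq: "k_mean k L = \<mu>"
  unfolding k_mean_def copies_def \<mu>_def
  using integral_two_coordinates[of 1 "{1..}" 2 "\<lambda>z. k (fst z) (snd z)"] k_meas by simp

lemma d_fun_eq:
  assumes "x \<in> space L" "y \<in> space L"
  shows "d_fun k L x y = dk x y"
proof -
  have "(\<integral>z. k z y \<partial>L) = kbar y"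
    unfolding kbar_def using assms k_sym by (intro Bochner_Integration.integral_cong) auto
  then show ?thesis by (simp add: d_fun_def dk_def k_mean_eq kbar_def)
qed

lemma V2_expand: "V2 = (\<integral>z. (k (fst z) (snd z))\<^sup>2 \<partial>(L \<Otimes>\<^sub>M L)) - 2 * (\<integral>x. (kbar x)\<^sup>2 \<partial>L) + \<mu>\<^sup>2"
proof -
  have kk: "integrable (L \<Otimes>\<^sub>M L) (\<lambda>z. dk (fst z) (snd z) * k (fst z) (snd z))"
  proof (rule Bochner_Integration.integrable_bound)
    show "integrable (L \<Otimes>\<^sub>M L) (\<lambda>z. (dk (fst z) (snd z))\<^sup>2 + (k (fst z) (snd z))\<^sup>2)" using dk2 k2 by auto
  qed (use dk_meas k_meas in \<open>auto simp: abs_mult_le_squares\<close>)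
  have b1: "integrable (L \<Otimes>\<^sub>M L) (\<lambda>z. (kbar (fst z))\<^sup>2)" "integrable (L \<Otimes>\<^sub>M L) (\<lambda>z. (kbar (snd z))\<^sup>2)"
    using integrable_pair_prod[OF kbar2, of "\<lambda>_. 1"] integrable_pair_prod[of "\<lambda>_. 1", OF _ kbar2] by simp_all
  have b2: "integrable (L \<Otimes>\<^sub>M L) (\<lambda>z. kbar (fst z))" "integrable (L \<Otimes>\<^sub>M L) (\<lambda>z. kbar (snd z))"
    using integrable_pair_prod[OF kbar1, of "\<lambda>_. 1"] integrable_pair_prod[of "\<lambda>_. 1", OF _ kbar1] by simp_all
  have b3: "integrable (L \<Otimes>\<^sub>M L) (\<lambda>z. kbar (fst z) * kbar (snd z))"
    by (rule integrable_pair_prod[OF kbar1 kbar1])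
  have c1: "integrable (L \<Otimes>\<^sub>M L) (\<lambda>z. k (fst z) (snd z) * kbar (fst z))"
  proof (rule Bochner_Integration.integrable_bound)
    show "integrable (L \<Otimes>\<^sub>M L) (\<lambda>z. (k (fst z) (snd z))\<^sup>2 + (kbar (fst z))\<^sup>2)" using b1 k2 by auto
  qed (use k_meas in \<open>auto simp: abs_mult_le_squares\<close>)
  have c2: "integrable (L \<Otimes>\<^sub>M L) (\<lambda>z. k (fst z) (snd z) * kbar (snd z))"
  proof (rule Bochner_Integration.integrable_bound)
    show "integrable (L \<Otimes>\<^sub>M L) (\<lambda>z. (k (fst z) (snd z))\<^sup>2 + (kbar (snd z))\<^sup>2)" using b1 k2 by auto
  qed (use k_meas in \<open>auto simp: abs_mult_le_squares\<close>)
  have fst_int: "(\<integral>z. f (fst z) \<partial>(L \<Otimes>\<^sub>M L)) = (\<integral>x. f x \<partial>L)" if "integrable L f" for f :: "'x \<Rightarrow> real"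
    using LL.integral_fst[of "\<lambda>x y. f x"] integrable_pair_prod[OF that, of "\<lambda>_. 1"] by (simp add: case_prod_unfold prob_space)
  have snd_int: "(\<integral>z. f (snd z) \<partial>(L \<Otimes>\<^sub>M L)) = (\<integral>x. f x \<partial>L)" if "integrable L f" for f :: "'x \<Rightarrow> real"
    using LL.integral_fst[of "\<lambda>x y. f y"] integrable_pair_prod[of "\<lambda>_. 1", OF _ that] by (simp add: case_prod_unfold prob_space)
  have e1: "(\<integral>z. k (fst z) (snd z) * kbar (fst z) \<partial>(L \<Otimes>\<^sub>M L)) = (\<integral>x. (kbar x)\<^sup>2 \<partial>L)"
    using LL.integral_fst[of "\<lambda>x y. k x y * kbar x"] c1
    by (simp add: case_prod_unfold kbar_def[symmetric] power2_eq_square)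
  have e2: "(\<integral>z. k (fst z) (snd z) * kbar (snd z) \<partial>(L \<Otimes>\<^sub>M L)) = (\<integral>x. (kbar x)\<^sup>2 \<partial>L)"
  proof -
    have "(\<integral>x. k x y \<partial>L) = kbar y" if "y \<in> space L" for y
      unfolding kbar_def using that k_sym by (intro Bochner_Integration.integral_cong) auto
    then have "(\<integral>y. (\<integral>x. k x y * kbar y \<partial>L) \<partial>L) = (\<integral>y. (kbar y)\<^sup>2 \<partial>L)"
      by (intro Bochner_Integration.integral_cong) (auto simp: power2_eq_square)
    then show ?thesis
      using LL.integral_snd[of "\<lambda>x y. k x y * kbar y"] c2 by (simp add: case_prod_unfold)
  qed
  have e3: "(\<integral>z. kbar (fst z) * kbar (snd z) \<partial>(L \<Otimes>\<^sub>M L)) = \<mu>\<^sup>2"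
    using LL.integral_fst[of "\<lambda>x y. kbar x * kbar y"] b3
    by (simp add: case_prod_unfold integral_kbar power2_eq_square)
  have "V2 = (\<integral>z. (k (fst z) (snd z))\<^sup>2 + (kbar (fst z))\<^sup>2 + (kbar (snd z))\<^sup>2 + \<mu>\<^sup>2
      - 2 * (k (fst z) (snd z) * kbar (fst z)) - 2 * (k (fst z) (snd z) * kbar (snd z)) + 2 * \<mu> * k (fst z) (snd z)
      + 2 * (kbar (fst z) * kbar (snd z)) - 2 * \<mu> * kbar (fst z) - 2 * \<mu> * kbar (snd z) \<partial>(L \<Otimes>\<^sub>M L))"
    unfolding V2_def by (intro Bochner_Integration.integral_cong refl) (simp add: dk_def power2_eq_square algebra_simps)
  also have "\<dots> = (\<integral>z. (k (fst z) (snd z))\<^sup>2 \<partial>(L \<Otimes>\<^sub>M L)) + (\<integral>x. (kbar x)\<^sup>2 \<partial>L) + (\<integral>x. (kbar x)\<^sup>2 \<partial>L) + \<mu>\<^sup>2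
      - 2 * (\<integral>x. (kbar x)\<^sup>2 \<partial>L) - 2 * (\<integral>x. (kbar x)\<^sup>2 \<partial>L) + 2 * \<mu> * \<mu> + 2 * \<mu>\<^sup>2 - 2 * \<mu> * \<mu> - 2 * \<mu> * \<mu>"
    using k2 k1 b1 b2 b3 c1 c2 e1 e2 e3 fst_int[OF kbar2] snd_int[OF kbar2] fst_int[OF kbar1] snd_int[OF kbar1]
    by (simp add: integral_kbar \<mu>_def[symmetric] LL.P.prob_space)
  finally show ?thesis by (simp add: power2_eq_square)
qed

lemma k_var_eq: "k_var k L = V2"
proof -
  let ?I = "{1::nat..}"
  have sp: "w i \<in> space L" if "w \<in> space (sample ?I)" "i \<in> ?I" for w i
    using space_coordinate[OF that(2,1)] .
  have E2: "(\<integral>Z. (k (Z 1) (Z 2))\<^sup>2 \<partial>sample ?I) = (\<integral>z. (k (fst z) (snd z))\<^sup>2 \<partial>(L \<Otimes>\<^sub>M L))"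
    using integral_two_coordinates[of 1 ?I 2 "\<lambda>z. (k (fst z) (snd z))\<^sup>2"] k_meas by simp
  have i2: "integrable (sample ?I) (\<lambda>w. (k (w i) (w j))\<^sup>2)" if "i \<in> ?I" "j \<in> ?I" "i \<noteq> j" for i j
    using integrable_two_coordinates[OF that, of "\<lambda>z. (k (fst z) (snd z))\<^sup>2"] k_meas k2 by simp
  have i: "integrable (sample ?I) (\<lambda>w. k (w 1) (w 2) * k (w 1) (w 3))"
  proof (rule Bochner_Integration.integrable_bound)
    show "integrable (sample ?I) (\<lambda>w. (k (w 1) (w 2))\<^sup>2 + (k (w 1) (w 3))\<^sup>2)"
      using i2 by auto
  qed (auto simp: abs_mult_le_squares)
  have "(\<integral>w. k (w 1) (w 2) * k (w 1) (w 3) \<partial>sample ?I) = (\<integral>w. k (w 1) (w 2) * kbar (w 1) \<partial>sample ?I)"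
    by (rule integral_integrate_out[of 3]) (use i in \<open>auto simp: kbar_def\<close>)
  also have "\<dots> = (\<integral>w. kbar (w 1) * k (w 1) (w 2) \<partial>sample ?I)" by (simp add: mult.commute)
  also have "\<dots> = (\<integral>w. kbar (w 1) * kbar (w 1) \<partial>sample ?I)"
  proof (rule integral_integrate_out[of 2])
    have "integrable (sample ?I) (\<lambda>w. k (w 1) (w 2) * kbar (w 1))"
      by (rule integrable_integrate_out[of 3 _ _ "\<lambda>w. k (w 1) (w 3)"]) (use i in \<open>auto simp: kbar_def\<close>)
    then show "integrable (sample ?I) (\<lambda>w. kbar (w 1) * k (w 1) (w 2))" by (simp add: mult.commute)
  qed (auto simp: kbar_def)
  also have "\<dots> = (\<integral>x. kbar x * kbar x \<partial>L)"
    by (rule integral_one_coordinate) auto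
  finally have E3: "(\<integral>w. k (w 1) (w 2) * k (w 1) (w 3) \<partial>sample ?I) = (\<integral>x. (kbar x)\<^sup>2 \<partial>L)"
    by (simp add: power2_eq_square)
  show ?thesis
    unfolding k_var_def V2_expand k_mean_eq copies_def E2 E3 by simp
qed

lemma hk4: "integrable (L \<Otimes>\<^sub>M L) (\<lambda>z. (hk (fst z) (snd z)) ^ 4)"
proof (rule Bochner_Integration.integrable_bound[where f = "\<lambda>z. (dk (fst z) (snd z)) ^ 4 / (sqrt V2) ^ 4"])
  show "integrable (L \<Otimes>\<^sub>M L) (\<lambda>z. (dk (fst z) (snd z)) ^ 4 / (sqrt V2) ^ 4)" using dk4 by simp
qed (use hk_meas in \<open>auto simp: hk_def power_divide\<close>)

text \<open>The variable \<open>Z 1\<close> occurs in the first two factors of \<open>g\<close> only and \<open>Z 4\<close> in the last two. Averaging over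
  either of them produces \<open>G (Z 2) (Z 3)\<close>.\<close>

lemma g_mean_eq:
  assumes V: "0 < V2"
  shows "(\<integral>Z. g_fun k L (Z 1) (Z 2) (Z 3) (Z 4) \<partial>copies L) = V2\<^sup>2 * H.G_sq_norm"
proof -
  let ?I = "{1::nat..}"
  have sp: "w i \<in> space L" if "w \<in> space (sample ?I)" "i \<in> ?I" for w i
    using space_coordinate[OF that(2,1)] .
  have good: "AE w in sample ?I. w i \<in> good" if "i \<in> ?I" for i
    using AE_PiM_component[of ?I "\<lambda>_. L" i, OF _ that AE_good] prob_space_axioms by simp
  have g1: "AE w in sample ?I. w 1 \<in> good" and g2: "AE w in sample ?I. w 2 \<in> good"
    and g3: "AE w in sample ?I. w 3 \<in> good" and g4: "AE w in sample ?I. w 4 \<in> good"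
    by (rule good, simp)+
  have gm: "(\<lambda>w. g_fun k L (w 1) (w 2) (w 3) (w 4)) \<in> borel_measurable (sample ?I)"
  proof -
    have "(\<lambda>w. dk (w 1) (w 2) * dk (w 1) (w 3) * dk (w 2) (w 4) * dk (w 3) (w 4)) \<in> borel_measurable (sample ?I)"
      by measurable
    then show ?thesis
      by (rule measurable_cong[THEN iffD1, rotated]) (auto simp: g_fun_def d_fun_eq sp)
  qed
  have hm [measurable]: "(\<lambda>w. hk (w i) (w j)) \<in> borel_measurable (sample ?I)" if "i \<in> ?I" "j \<in> ?I" for i j
    using that by (intro H.h_comp measurable_coordinate)
  have step1: "(\<integral>w. (hk (w 2) (w 4) * hk (w 3) (w 4)) * (hk (w 2) (w 1) * hk (w 3) (w 1)) \<partial>sample ?I)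
    = (\<integral>w. (hk (w 2) (w 4) * hk (w 3) (w 4)) * H.G (w 2) (w 3) \<partial>sample ?I)"
    and out: "integrable (sample ?I) (\<lambda>w. (hk (w 2) (w 4) * hk (w 3) (w 4)) * H.G (w 2) (w 3))"
  proof -
    have i4: "integrable (sample ?I) (\<lambda>w. (hk (w i) (w j)) ^ 4)" if "i \<in> ?I" "j \<in> ?I" "i \<noteq> j" for i j
      using integrable_two_coordinates[OF that, of "\<lambda>z. (hk (fst z) (snd z)) ^ 4"] hk_meas hk4 by simp
    have int: "integrable (sample ?I) (\<lambda>w. (hk (w 2) (w 4) * hk (w 3) (w 4)) * (hk (w 2) (w 1) * hk (w 3) (w 1)))"
    proof (rule Bochner_Integration.integrable_bound)
      show "integrable (sample ?I) (\<lambda>w. (hk (w 2) (w 4)) ^ 4 + (hk (w 3) (w 4)) ^ 4 + (hk (w 2) (w 1)) ^ 4 + (hk (w 3) (w 1)) ^ 4)"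
        by (intro Bochner_Integration.integrable_add i4) auto
      show "AE w in sample ?I. norm ((hk (w 2) (w 4) * hk (w 3) (w 4)) * (hk (w 2) (w 1) * hk (w 3) (w 1)))
        \<le> norm ((hk (w 2) (w 4)) ^ 4 + (hk (w 3) (w 4)) ^ 4 + (hk (w 2) (w 1)) ^ 4 + (hk (w 3) (w 1)) ^ 4)"
      proof (rule AE_I2)
        fix w :: "nat \<Rightarrow> 'x"
        show "norm ((hk (w 2) (w 4) * hk (w 3) (w 4)) * (hk (w 2) (w 1) * hk (w 3) (w 1)))
          \<le> norm ((hk (w 2) (w 4)) ^ 4 + (hk (w 3) (w 4)) ^ 4 + (hk (w 2) (w 1)) ^ 4 + (hk (w 3) (w 1)) ^ 4)"
          using abs_prod4_le[of "hk (w 2) (w 4)" "hk (w 3) (w 4)" "hk (w 2) (w 1)" "hk (w 3) (w 1)"]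
          by (simp add: mult.assoc)
      qed
    qed measurable
    have one: "1 \<in> ?I" by simp
    show "(\<integral>w. (hk (w 2) (w 4) * hk (w 3) (w 4)) * (hk (w 2) (w 1) * hk (w 3) (w 1)) \<partial>sample ?I)
      = (\<integral>w. (hk (w 2) (w 4) * hk (w 3) (w 4)) * H.G (w 2) (w 3) \<partial>sample ?I)"
      by (rule integral_integrate_out[OF one int]) (simp_all add: H.G_def)
    show "integrable (sample ?I) (\<lambda>w. (hk (w 2) (w 4) * hk (w 3) (w 4)) * H.G (w 2) (w 3))"
      by (rule integrable_integrate_out[OF one int]) (simp_all add: H.G_def)
  qed
  have "(\<integral>Z. g_fun k L (Z 1) (Z 2) (Z 3) (Z 4) \<partial>copies L)
    = (\<integral>w. V2\<^sup>2 * ((hk (w 2) (w 4) * hk (w 3) (w 4)) * (hk (w 2) (w 1) * hk (w 3) (w 1))) \<partial>sample ?I)"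
    unfolding copies_def
  proof (rule integral_cong_AE[OF gm])
    show "AE w in sample ?I. g_fun k L (w 1) (w 2) (w 3) (w 4)
        = V2\<^sup>2 * ((hk (w 2) (w 4) * hk (w 3) (w 4)) * (hk (w 2) (w 1) * hk (w 3) (w 1)))"
      using g1 g2 g3 g4 AE_space
    proof eventually_elim
      case (elim w)
      have d: "dk (w i) (w j) = sqrt V2 * hk (w i) (w j)" if "w i \<in> good" "w j \<in> good" for i j
        using that V by (simp add: hk_eq)
      have s: "hk (w 1) (w 2) = hk (w 2) (w 1)" "hk (w 1) (w 3) = hk (w 3) (w 1)"
        using elim by (auto intro!: H.h_sym good_space)
      have "g_fun k L (w 1) (w 2) (w 3) (w 4) = dk (w 1) (w 2) * dk (w 1) (w 3) * dk (w 2) (w 4) * dk (w 3) (w 4)"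
        using elim by (simp add: g_fun_def d_fun_eq good_space)
      also have "\<dots> = (sqrt V2 * sqrt V2) * (sqrt V2 * sqrt V2)
          * ((hk (w 2) (w 4) * hk (w 3) (w 4)) * (hk (w 2) (w 1) * hk (w 3) (w 1)))"
        using elim by (simp only: d s mult_ac)
      finally show ?case using V by (simp add: power2_eq_square)
    qed
  qed measurable
  also have "\<dots> = V2\<^sup>2 * (\<integral>w. (hk (w 2) (w 4) * hk (w 3) (w 4)) * (hk (w 2) (w 1) * hk (w 3) (w 1)) \<partial>sample ?I)"
    by simp
  also note step1
  also have "(\<integral>w. (hk (w 2) (w 4) * hk (w 3) (w 4)) * H.G (w 2) (w 3) \<partial>sample ?I)
    = (\<integral>w. H.G (w 2) (w 3) * (hk (w 2) (w 4) * hk (w 3) (w 4)) \<partial>sample ?I)"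
    by (simp add: mult.commute)
  also have "\<dots> = (\<integral>w. H.G (w 2) (w 3) * H.G (w 2) (w 3) \<partial>sample ?I)"
  proof (rule integral_integrate_out[of 4])
    show "integrable (sample ?I) (\<lambda>w. H.G (w 2) (w 3) * (hk (w 2) (w 4) * hk (w 3) (w 4)))"
      using out by (simp add: mult.commute)
  qed (simp_all add: H.G_def)
  also have "\<dots> = H.G_sq_norm"
    unfolding H.G_sq_norm_def
    using integral_two_coordinates[of 2 ?I 3 "\<lambda>z. (H.G (fst z) (snd z))\<^sup>2"] H.G_meas by (simp add: power2_eq_square)
  finally show ?thesis .
qed

end

section \<open>From the moment conditions to a bound for the statistic\<close>

definition clt_error :: "real \<Rightarrow> real \<Rightarrow> real \<Rightarrow> nat \<Rightarrow> real \<Rightarrow> real \<Rightarrow> real" where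
  "clt_error u K \<epsilon> N \<Lambda> \<gamma> =
     u\<^sup>2 * K\<^sup>2 * (sqrt \<Lambda> + \<Lambda> + sqrt \<gamma>) + 2 * \<epsilon> * u\<^sup>2 + 256 / \<epsilon>\<^sup>2 * (1 + u\<^sup>2)\<^sup>2 * K ^ 4 * \<Lambda>
      + (2 * \<bar>u\<bar> * \<epsilon> + 2 / \<epsilon> * (16 * (sqrt \<Lambda> + \<Lambda>) + 6 / (real N - 3)))"

lemma clt_error_mono:
  assumes "\<Lambda> \<le> \<Lambda>'" "0 < \<epsilon>" "0 \<le> K"
  shows "clt_error u K \<epsilon> N \<Lambda> \<gamma> \<le> clt_error u K \<epsilon> N \<Lambda>' \<gamma>"
  unfolding clt_error_def
  using assms by (intro add_mono mult_left_mono real_sqrt_le_mono order_refl) auto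

context centred_kernel
begin

definition lyapunov_ratio :: "real \<Rightarrow> nat \<Rightarrow> real" where
  "lyapunov_ratio \<tau> N = (\<integral>Z. \<bar>k_tilde k L (Z 1) (Z 2)\<bar> powr (2 + 2 * \<tau>) \<partial>copies L)
     / (real N powr \<tau> * k_var k L powr (1 + \<tau>))"

text \<open>Almost everywhere \<open>hk x y / sqrt N\<close> is \<open>e x y - e1 x - e1 y\<close>, where \<open>e\<close> is the scaled kernel centred at its
  mean and \<open>e1\<close> its average over one argument. By Jensen's inequality the \<open>chi\<close>-mean of \<open>e1\<^sup>2\<close> is at most
  that of \<open>e\<^sup>2\<close>, so the constant is \<open>3 * 81\<close>.\<close>

lemma lindeberg_le_lyapunov_ratio:
  assumes V: "0 < V2" and \<tau>: "0 < \<tau>" "\<tau> \<le> 1" and N: "0 < N"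
  shows "H.lindeberg N \<le> 243 * lyapunov_ratio \<tau> N"
proof -
  have Np: "0 < real N" using N by simp
  define s where "s = sqrt (V2 * real N)"
  have s: "0 < s" using V N by (simp add: s_def)
  define e where "e x y = (k x y - \<mu>) / s" for x y
  define e1 where "e1 x = (kbar x - \<mu>) / s" for x
  have e_meas [measurable]: "(\<lambda>z. e (fst z) (snd z)) \<in> borel_measurable (L \<Otimes>\<^sub>M L)"
    unfolding e_def using k_meas by measurable
  have e1_meas [measurable]: "e1 \<in> borel_measurable L" unfolding e1_def by measurable
  have e2: "integrable (L \<Otimes>\<^sub>M L) (\<lambda>z. (e (fst z) (snd z))\<^sup>2)"
    unfolding e_def power_divide power2_diff using k1 k2 by auto
  have e12: "integrable L (\<lambda>x. (e1 x)\<^sup>2)"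
    unfolding e1_def power_divide power2_diff using kbar1 kbar2 by auto
  have ce: "integrable (L \<Otimes>\<^sub>M L) (\<lambda>z. chi ((e (fst z) (snd z))\<^sup>2))"
    by (rule LL.P.chi_expectation_le(2)[OF e2]) simp
  have ce1: "integrable L (\<lambda>x. chi ((e1 x)\<^sup>2))" by (rule chi_expectation_le(2)[OF e12]) simp
  have c1: "integrable (L \<Otimes>\<^sub>M L) (\<lambda>z. chi ((e1 (fst z))\<^sup>2))" "integrable (L \<Otimes>\<^sub>M L) (\<lambda>z. chi ((e1 (snd z))\<^sup>2))"
    using integrable_pair_prod[OF ce1, of "\<lambda>_. 1"] integrable_pair_prod[of "\<lambda>_. 1", OF _ ce1] by simp_all
  have i1: "(\<integral>z. chi ((e1 (fst z))\<^sup>2) \<partial>(L \<Otimes>\<^sub>M L)) = (\<integral>x. chi ((e1 x)\<^sup>2) \<partial>L)"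
    using LL.integral_fst[of "\<lambda>x y. chi ((e1 x)\<^sup>2)"] c1 by (simp add: case_prod_unfold prob_space)
  have i2: "(\<integral>z. chi ((e1 (snd z))\<^sup>2) \<partial>(L \<Otimes>\<^sub>M L)) = (\<integral>x. chi ((e1 x)\<^sup>2) \<partial>L)"
    using LL.integral_fst[of "\<lambda>x y. chi ((e1 y)\<^sup>2)"] c1 by (simp add: case_prod_unfold prob_space)
  have jensen: "(\<integral>x. chi ((e1 x)\<^sup>2) \<partial>L) \<le> (\<integral>z. chi ((e (fst z) (snd z))\<^sup>2) \<partial>(L \<Otimes>\<^sub>M L))"
  proof -
    have cei: "integrable (L \<Otimes>\<^sub>M L) (\<lambda>(x, y). chi ((e x y)\<^sup>2))" using ce by (simp add: case_prod_unfold)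
    have "(\<integral>x. chi ((e1 x)\<^sup>2) \<partial>L) \<le> (\<integral>x. (\<integral>y. chi ((e x y)\<^sup>2) \<partial>L) \<partial>L)"
    proof (rule integral_mono_AE[OF ce1 LL.integrable_fst[OF cei]])
      show "AE x in L. chi ((e1 x)\<^sup>2) \<le> (\<integral>y. chi ((e x y)\<^sup>2) \<partial>L)"
        using AE_good
      proof eventually_elim
        case (elim x)
        have m: "e x \<in> borel_measurable L" unfolding e_def using good_space[OF elim] by measurable
        have sq: "integrable L (\<lambda>y. (e x y)\<^sup>2)"
          unfolding e_def power_divide power2_diff using good_k1[OF elim] good_k2[OF elim] by auto
        have "(\<integral>y. e x y \<partial>L) = e1 x"
          unfolding e_def e1_def using good_k1[OF elim] by (simp add: kbar_def prob_space)
        then have "(e1 x)\<^sup>2 \<le> (\<integral>y. (e x y)\<^sup>2 \<partial>L)" using power2_expectation_le[OF m sq] by simp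
        then have "chi ((e1 x)\<^sup>2) \<le> chi (\<integral>y. (e x y)\<^sup>2 \<partial>L)" by (intro chi_mono) auto
        also have "\<dots> \<le> (\<integral>y. chi ((e x y)\<^sup>2) \<partial>L)" by (rule chi_expectation_le(1)[OF sq]) simp
        finally show ?case .
      qed
    qed
    also have "\<dots> = (\<integral>z. chi ((e (fst z) (snd z))\<^sup>2) \<partial>(L \<Otimes>\<^sub>M L))"
      using LL.integral_fst[OF cei] by (simp add: case_prod_unfold)
    finally show ?thesis .
  qed
  have "(\<integral>z. chi ((hk (fst z) (snd z))\<^sup>2 / real N) \<partial>(L \<Otimes>\<^sub>M L))
    \<le> (\<integral>z. 81 * (chi ((e (fst z) (snd z))\<^sup>2) + chi ((e1 (fst z))\<^sup>2) + chi ((e1 (snd z))\<^sup>2)) \<partial>(L \<Otimes>\<^sub>M L))"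
  proof (rule integral_mono_AE[OF H.integrable_chi_h])
    show "integrable (L \<Otimes>\<^sub>M L) (\<lambda>z. 81 * (chi ((e (fst z) (snd z))\<^sup>2) + chi ((e1 (fst z))\<^sup>2) + chi ((e1 (snd z))\<^sup>2)))"
      using ce c1 by auto
    show "AE z in L \<Otimes>\<^sub>M L. chi ((hk (fst z) (snd z))\<^sup>2 / real N)
      \<le> 81 * (chi ((e (fst z) (snd z))\<^sup>2) + chi ((e1 (fst z))\<^sup>2) + chi ((e1 (snd z))\<^sup>2))"
      using AE_good_pair
    proof eventually_elim
      case (elim z)
      have "hk (fst z) (snd z) / sqrt (real N) = e (fst z) (snd z) + (- e1 (fst z)) + (- e1 (snd z))"
        using elim by (simp add: hk_eq dk_def e_def e1_def s_def real_sqrt_mult diff_divide_distrib add_divide_distrib)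
      then have "(hk (fst z) (snd z))\<^sup>2 / real N = (e (fst z) (snd z) + (- e1 (fst z)) + (- e1 (snd z)))\<^sup>2"
        by (metis power_divide real_sqrt_pow2 of_nat_0_le_iff)
      then show ?case using chi_square_add3[of "e (fst z) (snd z)" "- e1 (fst z)" "- e1 (snd z)"] by simp
    qed
  qed
  also have "\<dots> = 81 * ((\<integral>z. chi ((e (fst z) (snd z))\<^sup>2) \<partial>(L \<Otimes>\<^sub>M L)) + (\<integral>x. chi ((e1 x)\<^sup>2) \<partial>L) + (\<integral>x. chi ((e1 x)\<^sup>2) \<partial>L))"
    using ce c1 i1 i2 by simp
  also have "\<dots> \<le> 243 * (\<integral>z. chi ((e (fst z) (snd z))\<^sup>2) \<partial>(L \<Otimes>\<^sub>M L))" using jensen by simp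
  also have "\<dots> \<le> 243 * (\<integral>z. \<bar>e (fst z) (snd z)\<bar> powr (2 + 2 * \<tau>) \<partial>(L \<Otimes>\<^sub>M L))"
  proof (rule mult_left_mono, rule integral_mono[OF ce])
    show "integrable (L \<Otimes>\<^sub>M L) (\<lambda>z. \<bar>e (fst z) (snd z)\<bar> powr (2 + 2 * \<tau>))"
    proof (rule Bochner_Integration.integrable_bound[where f = "\<lambda>z. 1 + 64 * ((k (fst z) (snd z) / s) ^ 4 + (\<mu> / s) ^ 4)"])
      show "integrable (L \<Otimes>\<^sub>M L) (\<lambda>z. 1 + 64 * ((k (fst z) (snd z) / s) ^ 4 + (\<mu> / s) ^ 4))"
        unfolding power_divide using k4 by auto
      show "AE z in L \<Otimes>\<^sub>M L. norm (\<bar>e (fst z) (snd z)\<bar> powr (2 + 2 * \<tau>))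
        \<le> norm (1 + 64 * ((k (fst z) (snd z) / s) ^ 4 + (\<mu> / s) ^ 4))"
      proof (rule AE_I2)
        fix z
        define a where "a = e (fst z) (snd z)"
        have "\<bar>a\<bar> powr (2 + 2 * \<tau>) \<le> 1 + a ^ 4"
        proof (cases "\<bar>a\<bar> \<le> 1")
          case True
          have "\<bar>a\<bar> powr (2 + 2 * \<tau>) \<le> 1 powr (2 + 2 * \<tau>)" using True \<tau> by (intro powr_mono2) auto
          moreover have "0 \<le> a ^ 4" by simp
          ultimately show ?thesis by (simp del: zero_le_power_eq_numeral)
        next
          case False
          have "\<bar>a\<bar> powr (2 + 2 * \<tau>) \<le> \<bar>a\<bar> powr 4" using False \<tau> by (intro powr_mono) auto
          also have "\<dots> = a ^ 4" using False by (simp add: powr_numeral)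
          finally show ?thesis by simp
        qed
        also have "a ^ 4 \<le> 64 * ((k (fst z) (snd z) / s) ^ 4 + (\<mu> / s) ^ 4)"
          using pow4_add4[of "k (fst z) (snd z) / s" "- \<mu> / s" 0 0]
          by (simp add: a_def e_def diff_divide_distrib)
        finally show "norm (\<bar>e (fst z) (snd z)\<bar> powr (2 + 2 * \<tau>)) \<le> norm (1 + 64 * ((k (fst z) (snd z) / s) ^ 4 + (\<mu> / s) ^ 4))"
          by (simp add: a_def)
      qed
    qed measurable
    show "chi ((e (fst z) (snd z))\<^sup>2) \<le> \<bar>e (fst z) (snd z)\<bar> powr (2 + 2 * \<tau>)" for z
      by (rule chi_square_le_powr[OF \<tau>])
  qed simp
  also have "(\<integral>z. \<bar>e (fst z) (snd z)\<bar> powr (2 + 2 * \<tau>) \<partial>(L \<Otimes>\<^sub>M L))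
    = (\<integral>z. \<bar>k (fst z) (snd z) - \<mu>\<bar> powr (2 + 2 * \<tau>) \<partial>(L \<Otimes>\<^sub>M L)) / (V2 * real N) powr (1 + \<tau>)"
  proof -
    have "s powr (2 + 2 * \<tau>) = (V2 * real N) powr (1 + \<tau>)"
      using V N by (simp add: s_def powr_half_sqrt[symmetric] powr_powr add_divide_distrib)
    then have "\<bar>e (fst z) (snd z)\<bar> powr (2 + 2 * \<tau>) = \<bar>k (fst z) (snd z) - \<mu>\<bar> powr (2 + 2 * \<tau>) / (V2 * real N) powr (1 + \<tau>)" for z
      using s by (simp add: e_def abs_divide powr_divide)
    then show ?thesis by simp
  qed
  also have "(\<integral>z. \<bar>k (fst z) (snd z) - \<mu>\<bar> powr (2 + 2 * \<tau>) \<partial>(L \<Otimes>\<^sub>M L))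
    = (\<integral>Z. \<bar>k_tilde k L (Z 1) (Z 2)\<bar> powr (2 + 2 * \<tau>) \<partial>copies L)"
    unfolding copies_def k_tilde_def k_mean_eq
    using integral_two_coordinates[of 1 "{1..}" 2 "\<lambda>z. \<bar>k (fst z) (snd z) - \<mu>\<bar> powr (2 + 2 * \<tau>)"] k_meas by simp
  finally have "(\<integral>z. chi ((hk (fst z) (snd z))\<^sup>2 / real N) \<partial>(L \<Otimes>\<^sub>M L))
    \<le> 243 * ((\<integral>Z. \<bar>k_tilde k L (Z 1) (Z 2)\<bar> powr (2 + 2 * \<tau>) \<partial>copies L) / (V2 * real N) powr (1 + \<tau>))" .
  then have "H.lindeberg N \<le> real N * (243 * ((\<integral>Z. \<bar>k_tilde k L (Z 1) (Z 2)\<bar> powr (2 + 2 * \<tau>) \<partial>copies L) / (V2 * real N) powr (1 + \<tau>)))"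
    unfolding H.lindeberg_def by (rule mult_left_mono) simp
  also have "\<dots> = 243 * lyapunov_ratio \<tau> N"
    unfolding lyapunov_ratio_def k_var_eq using V Np by (simp add: powr_mult powr_add)
  finally show ?thesis .
qed

lemma G_sq_norm_eq:
  assumes "0 < V2"
  shows "H.G_sq_norm = (\<integral>Z. g_fun k L (Z 1) (Z 2) (Z 3) (Z 4) \<partial>copies L) / (k_var k L)\<^sup>2"
  using assms by (simp only: g_mean_eq k_var_eq) simp

lemma measurable_T_stat: "(\<lambda>w. T_stat k a0 n m w (\<lambda>j. w (n + j))) \<in> borel_measurable (sample {1..n + m})"
proof -
  have p: "pooled n w (\<lambda>j. w (n + j)) = w" for w :: "nat \<Rightarrow> 'x"
    by (auto simp: pooled_def)
  have kw: "(\<lambda>w. k (w i) (w j)) \<in> borel_measurable (sample {1..n + m})" if "i \<in> {1..n + m}" "j \<in> {1..n + m}" for i j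
    using that by (intro k_comp measurable_coordinate)
  have E: "(\<lambda>w. energy_stat k n m w (\<lambda>j. w (n + j))) \<in> borel_measurable (sample {1..n + m})"
    unfolding energy_stat_def
    by (intro borel_measurable_diff borel_measurable_times borel_measurable_const borel_measurable_sum kw) auto
  have V: "(\<lambda>w. V_star k a0 n m w (\<lambda>j. w (n + j))) \<in> borel_measurable (sample {1..n + m})"
    unfolding V_star_def Let_def p A_star_def
    by (intro borel_measurable_diff borel_measurable_add borel_measurable_power borel_measurable_times
        borel_measurable_const borel_measurable_sum kw) auto
  note [measurable] = E V
  show ?thesis unfolding T_stat_def by measurable
qed

theorem T_stat_char_bound:
  assumes n: "2 \<le> n" and m: "2 \<le> m" and \<kappa>: "0 < \<kappa>" "\<kappa> \<le> 1"
    and n\<kappa>: "\<kappa> * real (n + m) \<le> real n" and m\<kappa>: "\<kappa> * real (n + m) \<le> real m"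
    and V: "0 < k_var k L" and diag: "\<And>x. x \<in> space L \<Longrightarrow> k x x = a0"
    and \<tau>: "0 < \<tau>" "\<tau> \<le> 1" and \<epsilon>: "0 < \<epsilon>" "\<epsilon> \<le> 1 / 2"
  shows "cmod ((\<integral>w. iexp (u * T_stat k a0 n m w (\<lambda>j. w (n + j))) \<partial>sample {1..n + m}) - exp (- (u\<^sup>2 / 2)))
    \<le> clt_error u (2 / \<kappa>\<^sup>2) \<epsilon> (n + m) (243 * lyapunov_ratio \<tau> (n + m))
        ((\<integral>Z. g_fun k L (Z 1) (Z 2) (Z 3) (Z 4) \<partial>copies L) / (k_var k L)\<^sup>2)"
proof -
  have V': "0 < V2" using V by (simp add: k_var_eq)
  define N where "N = n + m"
  define b where "b p = energy_coeff n m p / sqrt (c_coeff n m)" for p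
  have N: "4 \<le> N" "0 < N" using n m by (auto simp: N_def)
  have K: "1 \<le> 2 / \<kappa>\<^sup>2"
  proof -
    have "\<kappa>\<^sup>2 \<le> 1" using \<kappa> by (simp add: power_le_one)
    then show ?thesis using \<kappa> by simp
  qed
  have cpos: "0 < c_coeff n m" unfolding c_coeff_def using n m by (intro add_pos_pos divide_pos_pos mult_pos_pos) auto
  have b1: "(\<Sum>p\<in>pairs N. (b p)\<^sup>2) = 1"
    unfolding b_def power_divide sum_divide_distrib[symmetric] N_def sum_energy_coeff_sq[OF n m] using cpos by simp
  have bK: "\<bar>b p\<bar> \<le> 2 / \<kappa>\<^sup>2 / real N" for p
    unfolding b_def N_def by (rule abs_energy_coeff_le[OF n m \<kappa>(1) n\<kappa> m\<kappa>])
  have p: "pooled n w (\<lambda>j. w (n + j)) = w" for w :: "nat \<Rightarrow> 'x"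
    by (auto simp: pooled_def)
  have good: "AE w in sample {1..N}. \<forall>i\<in>{1..N}. w i \<in> good"
  proof (rule AE_finite_allI)
    show "AE w in sample {1..N}. w i \<in> good" if "i \<in> {1..N}" for i
      using AE_PiM_component[of "{1..N}" "\<lambda>_. L" i, OF _ that AE_good] prob_space_axioms by simp
  qed simp
  have Teq: "AE w in sample {1..N}. T_stat k a0 n m w (\<lambda>j. w (n + j))
     = (\<Sum>p\<in>pairs N. b p * H.sample_matrix w (fst p) (snd p)) / sqrt (var_ratio N (H.sample_matrix w))"
    using good AE_space
  proof eventually_elim
    case (elim w)
    have g: "w i \<in> good" if "i \<in> {1..N}" for i using elim(1) that by auto
    show ?case
      unfolding b_def N_def
    proof (rule T_stat_eq[OF n m, where \<sigma> = "sqrt V2" and u = "\<lambda>s. kbar (w s) - \<mu> / 2"], unfold p)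
      show "0 < sqrt V2" using V' by simp
      show "k (w s) (w t) = sqrt V2 * H.sample_matrix w s t + (kbar (w s) - \<mu> / 2) + (kbar (w t) - \<mu> / 2)"
        if "s \<in> {1..n + m}" "t \<in> {1..n + m}" "s \<noteq> t" for s t
        using that elim(2) V' g[of s] g[of t] by (simp add: H.sample_matrix_eq[of w N s t] N_def hk_eq dk_def)
      show "k (w s) (w s) = a0" if "s \<in> {1..n + m}" for s
        using g[of s] that by (intro diag good_space) (simp add: N_def)
    qed (rule H.sample_matrix_sym, rule H.sample_matrix_diag)
  qed
  have T_meas: "(\<lambda>w. T_stat k a0 n m w (\<lambda>j. w (n + j))) \<in> borel_measurable (sample {1..N})"
    unfolding N_def by (rule measurable_T_stat)
  note VR = H.var_ratio_concentration(1)[OF N(1) integral_hk_sq[OF V']]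
  have S_meas: "(\<lambda>w. \<Sum>p\<in>pairs N. b p * H.sample_matrix w (fst p) (snd p)) \<in> borel_measurable (sample {1..N})"
  proof (intro borel_measurable_sum borel_measurable_times borel_measurable_const)
    fix q assume q: "q \<in> pairs N"
    have "fst q \<in> {1..N}" "snd q \<in> {1..N}" using q by (auto simp: pairs_def)
    then show "(\<lambda>w. H.sample_matrix w (fst q) (snd q)) \<in> borel_measurable (sample {1..N})"
      unfolding H.sample_matrix_pair[OF q] by (intro H.h_comp measurable_coordinate)
  qed
  have "(\<integral>w. iexp (u * T_stat k a0 n m w (\<lambda>j. w (n + j))) \<partial>sample {1..N})
     = (\<integral>w. iexp (u * ((\<Sum>p\<in>pairs N. b p * H.sample_matrix w (fst p) (snd p)) / sqrt (var_ratio N (H.sample_matrix w)))) \<partial>sample {1..N})"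
  proof (rule integral_cong_AE)
    show "(\<lambda>w. iexp (u * T_stat k a0 n m w (\<lambda>j. w (n + j)))) \<in> borel_measurable (sample {1..N})"
      using T_meas by measurable
    show "(\<lambda>w. iexp (u * ((\<Sum>p\<in>pairs N. b p * H.sample_matrix w (fst p) (snd p)) / sqrt (var_ratio N (H.sample_matrix w))))) \<in> borel_measurable (sample {1..N})"
      using S_meas borel_measurable_integrable[OF VR] by measurable
    show "AE w in sample {1..N}. iexp (u * T_stat k a0 n m w (\<lambda>j. w (n + j)))
       = iexp (u * ((\<Sum>p\<in>pairs N. b p * H.sample_matrix w (fst p) (snd p)) / sqrt (var_ratio N (H.sample_matrix w))))"
      using Teq by eventually_elim (simp only:)
  qed
  then have "cmod ((\<integral>w. iexp (u * T_stat k a0 n m w (\<lambda>j. w (n + j))) \<partial>sample {1..N}) - exp (- (u\<^sup>2 / 2)))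
      \<le> clt_error u (2 / \<kappa>\<^sup>2) \<epsilon> N (H.lindeberg N) H.G_sq_norm"
    using H.studentised_clt_bound[OF N(1) K integral_hk_sq[OF V'] bK b1 \<epsilon>, of u] by (simp only: clt_error_def)
  also have "\<dots> \<le> clt_error u (2 / \<kappa>\<^sup>2) \<epsilon> N (243 * lyapunov_ratio \<tau> N) H.G_sq_norm"
    using K \<epsilon> by (intro clt_error_mono lindeberg_le_lyapunov_ratio[OF V' \<tau> N(2)]) auto
  finally show ?thesis unfolding G_sq_norm_eq[OF V'] N_def .
qed

end

section \<open>The sample as a product measure\<close>

lemma A_star_cong:
  assumes ab: "\<And>s t. s \<in> {1..N} \<Longrightarrow> t \<in> {1..N} \<Longrightarrow> a s t = b s t"
    and st: "s \<in> {1..N}" "t \<in> {1..N}"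
  shows "A_star N a s t = A_star N b s t"
proof -
  have "(\<Sum>i=1..N. a i t) = (\<Sum>i=1..N. b i t)" "(\<Sum>j=1..N. a s j) = (\<Sum>j=1..N. b s j)"
    "(\<Sum>i=1..N. \<Sum>j=1..N. a i j) = (\<Sum>i=1..N. \<Sum>j=1..N. b i j)"
    using ab st by (intro sum.cong refl; blast)+
  then show ?thesis unfolding A_star_def using ab[OF st] by simp
qed

lemma T_stat_cong:
  assumes x: "\<And>i. i \<in> {1..n} \<Longrightarrow> x i = x' i" and y: "\<And>j. j \<in> {1..m} \<Longrightarrow> y j = y' j"
  shows "T_stat k a0 n m x y = T_stat k a0 n m x' y'"
proof -
  have p: "pooled n x y s = pooled n x' y' s" if "s \<in> {1..n + m}" for s
  proof (cases "s \<le> n")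
    case False
    then have "s - n \<in> {1..m}" using that by auto
    then show ?thesis using False y by (simp add: pooled_def)
  qed (use that x in \<open>simp add: pooled_def\<close>)
  have "energy_stat k n m x y = energy_stat k n m x' y'"
    unfolding energy_stat_def using x y
    by (intro arg_cong2[where f = "(-)"] arg_cong2[where f = "(*)"] sum.cong refl) auto
  moreover have "A_star (n + m) (\<lambda>s t. k (pooled n x y s) (pooled n x y t)) s t
      = A_star (n + m) (\<lambda>s t. k (pooled n x' y' s) (pooled n x' y' t)) s t"
    if "s \<in> {1..n + m}" "t \<in> {1..n + m}" for s t
    using p that by (intro A_star_cong) auto
  then have "V_star k a0 n m x y = V_star k a0 n m x' y'"
    unfolding V_star_def Let_def by simp
  ultimately show ?thesis by (simp add: T_stat_def)
qed

text \<open>The two samples are indexed by a sum type; \<open>f\<close> enumerates the part of it that is used. Under the null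
  hypothesis all factors of the product measure agree.\<close>

lemma distr_pooled_sample:
  assumes samp: "two_sample M R X Y Xs Ys" and null: "distr M R X = distr M R Y" and nm: "0 < n + m"
  shows "(\<lambda>\<omega>. \<lambda>s\<in>{1..n + m}. pooled n (\<lambda>i. Xs i \<omega>) (\<lambda>j. Ys j \<omega>) s) \<in> M \<rightarrow>\<^sub>M (\<Pi>\<^sub>M i\<in>{1..n + m}. R)"
    and "distr M (\<Pi>\<^sub>M i\<in>{1..n + m}. R) (\<lambda>\<omega>. \<lambda>s\<in>{1..n + m}. pooled n (\<lambda>i. Xs i \<omega>) (\<lambda>j. Ys j \<omega>) s)
      = (\<Pi>\<^sub>M i\<in>{1..n + m}. distr M R X)"
proof -
  define L where "L = distr M R X"
  interpret prob_space M using samp by (simp add: two_sample_def)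
  have ind: "indep_vars (\<lambda>_. R) (case_sum Xs Ys) ({1..} <+> {1..})"
    and dX: "\<And>i. 1 \<le> i \<Longrightarrow> distr M R (Xs i) = L" and dY: "\<And>j. 1 \<le> j \<Longrightarrow> distr M R (Ys j) = L"
    and X: "X \<in> M \<rightarrow>\<^sub>M R"
    using samp null by (simp_all add: two_sample_def L_def)
  define I where "I = {1..n + m}"
  define f where "f s = (if s \<le> n then Inl s else Inr (s - n))" for s :: nat
  define Z where "Z = case_sum Xs Ys"
  define J where "J = f ` I"
  have J: "J \<subseteq> {1..} <+> {1..}" by (auto simp: J_def I_def f_def)
  have J0: "J \<noteq> {}" using nm by (auto simp: J_def I_def)
  have inj: "inj_on f I" by (auto simp: inj_on_def f_def I_def split: if_splits)
  have indJ: "indep_vars (\<lambda>_. R) Z J" unfolding Z_def using indep_vars_subset[OF ind J] .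
  have rv: "Z i \<in> M \<rightarrow>\<^sub>M R" if "i \<in> J" for i
    using indJ that by (auto simp: indep_vars_def)
  have dZ: "distr M R (Z i) = L" if "i \<in> J" for i
    using that J dX dY by (auto simp: Z_def)
  have Zf: "Z (f s) \<omega> = pooled n (\<lambda>i. Xs i \<omega>) (\<lambda>j. Ys j \<omega>) s" for s \<omega>
    by (simp add: Z_def f_def pooled_def)
  have joint: "distr M (\<Pi>\<^sub>M i\<in>J. R) (\<lambda>\<omega>. \<lambda>i\<in>J. Z i \<omega>) = (\<Pi>\<^sub>M i\<in>J. L)"
    using indep_vars_iff_distr_eq_PiM'[OF J0 rv] indJ dZ by (simp cong: PiM_cong)
  have m1: "(\<lambda>\<omega>. \<lambda>i\<in>J. Z i \<omega>) \<in> M \<rightarrow>\<^sub>M (\<Pi>\<^sub>M i\<in>J. R)" by (rule measurable_restrict) (rule rv)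
  have m2: "(\<lambda>z. \<lambda>s\<in>I. z (f s)) \<in> (\<Pi>\<^sub>M i\<in>J. R) \<rightarrow>\<^sub>M (\<Pi>\<^sub>M i\<in>I. R)"
    by (rule measurable_restrict) (auto simp: J_def intro: measurable_component_singleton)
  have eq: "(\<lambda>s\<in>I. pooled n (\<lambda>i. Xs i \<omega>) (\<lambda>j. Ys j \<omega>) s) = ((\<lambda>z. \<lambda>s\<in>I. z (f s)) \<circ> (\<lambda>\<omega>. \<lambda>i\<in>J. Z i \<omega>)) \<omega>" for \<omega>
    by (auto simp: J_def Zf[symmetric] restrict_def)
  show "(\<lambda>\<omega>. \<lambda>s\<in>{1..n + m}. pooled n (\<lambda>i. Xs i \<omega>) (\<lambda>j. Ys j \<omega>) s) \<in> M \<rightarrow>\<^sub>M (\<Pi>\<^sub>M i\<in>{1..n + m}. R)"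
    unfolding I_def[symmetric] eq by (rule measurable_comp[OF m1 m2])
  have pL: "prob_space L" unfolding L_def by (rule prob_space_distr[OF X])
  have setsL: "sets (\<Pi>\<^sub>M i\<in>I. R) = sets (\<Pi>\<^sub>M i\<in>I. L)" by (intro sets_PiM_cong) (auto simp: L_def)
  have "distr M (\<Pi>\<^sub>M i\<in>I. R) (\<lambda>\<omega>. \<lambda>s\<in>I. pooled n (\<lambda>i. Xs i \<omega>) (\<lambda>j. Ys j \<omega>) s)
     = distr (\<Pi>\<^sub>M i\<in>J. L) (\<Pi>\<^sub>M i\<in>I. R) (\<lambda>z. \<lambda>s\<in>I. z (f s))"
    unfolding eq joint[symmetric] using distr_distr[OF m2 m1] by (simp add: comp_def)
  also have "\<dots> = distr (\<Pi>\<^sub>M i\<in>J. L) (\<Pi>\<^sub>M i\<in>I. L) (\<lambda>z. \<lambda>s\<in>I. z (f s))"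
    by (rule distr_cong[OF refl setsL refl])
  also have "\<dots> = (\<Pi>\<^sub>M i\<in>I. L)"
    using distr_PiM_reindex[of J "\<lambda>_. L" f I] pL inj by (auto simp: J_def)
  finally show "distr M (\<Pi>\<^sub>M i\<in>{1..n + m}. R) (\<lambda>\<omega>. \<lambda>s\<in>{1..n + m}. pooled n (\<lambda>i. Xs i \<omega>) (\<lambda>j. Ys j \<omega>) s)
      = (\<Pi>\<^sub>M i\<in>{1..n + m}. distr M R X)"
    by (simp add: I_def L_def)
qed

lemma mixture_same:
  assumes "prob_space P"
  shows "mixture \<rho> P P = P"
  unfolding mixture_def if_cancel
  by (rule bind_const') (auto intro: measure_pmf.prob_space_axioms prob_space_imp_subprob_space assms)

section \<open>Asymptotic normality under the null hypothesis\<close>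

theorem theorem16:
  fixes k :: "nat \<Rightarrow> (nat \<Rightarrow> real) \<Rightarrow> (nat \<Rightarrow> real) \<Rightarrow> real"
    and a0 :: "nat \<Rightarrow> real"
    and M :: "nat \<Rightarrow> 'w measure"
    and X Y :: "nat \<Rightarrow> 'w \<Rightarrow> (nat \<Rightarrow> real)"
    and Xs Ys :: "nat \<Rightarrow> nat \<Rightarrow> 'w \<Rightarrow> (nat \<Rightarrow> real)"
    and LZ :: "nat \<Rightarrow> (nat \<Rightarrow> real) measure"
    and n m p :: "nat \<Rightarrow> nat"
    and \<rho> \<tau> :: real
  assumes rho: "0 < \<rho>" "\<rho> < 1"
    and tau: "0 < \<tau>" "\<tau> \<le> 1"
    and n_lim: "filterlim n at_top sequentially"
    and m_lim: "filterlim m at_top sequentially"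
    and p_lim: "filterlim p at_top sequentially"
    and ratio_lim: "(\<lambda>r. real (n r) / real (n r + m r)) \<longlonglongrightarrow> \<rho>"
    and kernel: "\<And>q. q \<ge> 1 \<Longrightarrow> is_kernel (Rvec q) (k q)"
    and diag: "\<And>q x. q \<ge> 1 \<Longrightarrow> x \<in> space (Rvec q) \<Longrightarrow> k q x x = a0 q"
    and sampling: "\<And>q. q \<ge> 1 \<Longrightarrow> two_sample (M q) (Rvec q) (X q) (Y q) (Xs q) (Ys q)"
    and LZ: "\<And>q. LZ q = mixture \<rho> (distr (M q) (Rvec q) (X q)) (distr (M q) (Rvec q) (Y q))"
    and fourth_moment: "\<And>q. q \<ge> 1 \<Longrightarrow> integrable (copies (LZ q)) (\<lambda>Z. (k q (Z 1) (Z 2)) ^ 4)"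
    and null: "\<And>q. q \<ge> 1 \<Longrightarrow> distr (M q) (Rvec q) (X q) = distr (M q) (Rvec q) (Y q)"
    and var_pos: "\<forall>\<^sub>F r in sequentially. k_var (k (p r)) (LZ (p r)) > 0"
    and moment_cond:
      "(\<lambda>r. (\<integral>Z. \<bar>k_tilde (k (p r)) (LZ (p r)) (Z 1) (Z 2)\<bar> powr (2 + 2 * \<tau>) \<partial>copies (LZ (p r)))
            / (real (n r + m r) powr \<tau> * k_var (k (p r)) (LZ (p r)) powr (1 + \<tau>))) \<longlonglongrightarrow> 0"
    and g_cond:
      "(\<lambda>r. (\<integral>Z. g_fun (k (p r)) (LZ (p r)) (Z 1) (Z 2) (Z 3) (Z 4) \<partial>copies (LZ (p r)))
              powr ((1 + \<tau>) / 2)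
            / k_var (k (p r)) (LZ (p r)) powr (1 + \<tau>)) \<longlonglongrightarrow> 0"
  shows "weak_conv_m
           (\<lambda>r. distr (M (p r)) borel
              (\<lambda>\<omega>. T_stat (k (p r)) (a0 (p r)) (n r) (m r) (\<lambda>i. Xs (p r) i \<omega>) (\<lambda>j. Ys (p r) j \<omega>)))
           std_normal_distribution"
proof -
  define L where "L q = distr (M q) (Rvec q) (X q)" for q
  define N where "N r = n r + m r" for r
  define Tr where "Tr r \<omega> = T_stat (k (p r)) (a0 (p r)) (n r) (m r) (\<lambda>i. Xs (p r) i \<omega>) (\<lambda>j. Ys (p r) j \<omega>)" for r \<omega>
  define \<Lambda> where "\<Lambda> r = (\<integral>Z. \<bar>k_tilde (k (p r)) (LZ (p r)) (Z 1) (Z 2)\<bar> powr (2 + 2 * \<tau>) \<partial>copies (LZ (p r)))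
            / (real (N r) powr \<tau> * k_var (k (p r)) (LZ (p r)) powr (1 + \<tau>))" for r
  define g where "g r = (\<integral>Z. g_fun (k (p r)) (LZ (p r)) (Z 1) (Z 2) (Z 3) (Z 4) \<partial>copies (LZ (p r)))" for r
  define V where "V r = k_var (k (p r)) (LZ (p r))" for r
  \<comment> \<open>Eventually each sample makes up at least this proportion of the pooled sample.\<close>
  define \<kappa> where "\<kappa> = min \<rho> (1 - \<rho>) / 2"
  have \<kappa>: "0 < \<kappa>" "\<kappa> \<le> 1" "\<kappa> < \<rho>" "\<kappa> < 1 - \<rho>" using rho by (auto simp: \<kappa>_def)

  have prob: "prob_space (M q)" and X: "X q \<in> M q \<rightarrow>\<^sub>M Rvec q" if "q \<ge> 1" for q
    using sampling[OF that] by (auto simp: two_sample_def)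
  have pL: "prob_space (L q)" if q: "q \<ge> 1" for q
  proof -
    interpret prob_space "M q" by (rule prob[OF q])
    show ?thesis unfolding L_def by (rule prob_space_distr[OF X[OF q]])
  qed
  have LZL: "LZ q = L q" if q: "q \<ge> 1" for q
    unfolding LZ null[OF q, symmetric] L_def[symmetric] by (rule mixture_same[OF pL[OF q]])
  have sL: "sets (L q) = sets (Rvec q)" and spL: "space (L q) = space (Rvec q)" for q
    by (simp_all add: L_def)
  have ck: "centred_kernel (L q) (k q)" if q: "q \<ge> 1" for q
  proof -
    interpret prob_space "L q" by (rule pL[OF q])
    interpret law "L q" ..
    have km: "(\<lambda>z. k q (fst z) (snd z)) \<in> borel_measurable (L q \<Otimes>\<^sub>M L q)"
      using kernel[OF q] sets_pair_measure_cong[OF sL[of q] sL[of q]]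
      by (simp add: is_kernel_def cong: measurable_cong_sets)
    show ?thesis
    proof unfold_locales
      show "integrable (L q \<Otimes>\<^sub>M L q) (\<lambda>z. (k q (fst z) (snd z)) ^ 4)"
        using fourth_moment[OF q] integrable_two_coordinates[of 1 "{1..}" 2 "\<lambda>z. (k q (fst z) (snd z)) ^ 4"] km
        by (simp add: LZL[OF q] copies_def)
    qed (use kernel[OF q] km in \<open>auto simp: is_kernel_def spL\<close>)
  qed

  \<comment> \<open>The statistic is a function of the pooled sample, whose law is a product measure.\<close>
  define W where "W r \<omega> = (\<lambda>s\<in>{1..N r}. pooled (n r) (\<lambda>i. Xs (p r) i \<omega>) (\<lambda>j. Ys (p r) j \<omega>) s)" for r \<omega>
  define F where "F r w = T_stat (k (p r)) (a0 (p r)) (n r) (m r) w (\<lambda>j. w (n r + j))" for r w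
  have TF: "Tr r \<omega> = F r (W r \<omega>)" for r \<omega>
    unfolding Tr_def F_def by (rule T_stat_cong) (auto simp: W_def N_def pooled_def)
  have W_meas: "W r \<in> M (p r) \<rightarrow>\<^sub>M PiM {1..N r} (\<lambda>_. Rvec (p r))"
    and W_distr: "distr (M (p r)) (PiM {1..N r} (\<lambda>_. Rvec (p r))) (W r) = PiM {1..N r} (\<lambda>_. L (p r))"
    if "p r \<ge> 1" "0 < N r" for r
    using distr_pooled_sample[OF sampling[OF that(1)] null[OF that(1)], of "n r" "m r"] that(2)
    unfolding W_def N_def L_def by auto
  have F_meas: "F r \<in> borel_measurable (PiM {1..N r} (\<lambda>_. Rvec (p r)))" if "p r \<ge> 1" for r
  proof -
    interpret centred_kernel "L (p r)" "k (p r)" by (rule ck[OF that])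
    have "sets (PiM {1..N r} (\<lambda>_. L (p r))) = sets (PiM {1..N r} (\<lambda>_. Rvec (p r)))"
      by (intro sets_PiM_cong) (auto simp: sL)
    then show ?thesis
      using measurable_T_stat[of "a0 (p r)" "n r" "m r"] unfolding F_def N_def
      by (simp cong: measurable_cong_sets)
  qed
  have T_meas: "Tr r \<in> borel_measurable (M (p r))" if "p r \<ge> 1" "0 < N r" for r
    unfolding TF using measurable_compose[OF W_meas[OF that] F_meas[OF that(1)]] .

  define ok where "ok r \<longleftrightarrow> p r \<ge> 1 \<and> 2 \<le> n r \<and> 2 \<le> m r \<and> 0 < V r
      \<and> \<kappa> * real (N r) \<le> real (n r) \<and> \<kappa> * real (N r) \<le> real (m r)" for r
  have ev_ok: "eventually ok sequentially"
  proof -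
    have ratio2: "(\<lambda>r. real (m r) / real (N r)) \<longlonglongrightarrow> 1 - \<rho>"
    proof (rule Lim_transform_eventually)
      show "(\<lambda>r. 1 - real (n r) / real (n r + m r)) \<longlonglongrightarrow> 1 - \<rho>" by (intro tendsto_intros ratio_lim)
      show "\<forall>\<^sub>F r in sequentially. 1 - real (n r) / real (n r + m r) = real (m r) / real (N r)"
        using filterlim_at_top[THEN iffD1, OF n_lim, rule_format, of 1]
        by eventually_elim (simp add: N_def field_simps)
    qed
    have "\<forall>\<^sub>F r in sequentially. p r \<ge> 1" "\<forall>\<^sub>F r in sequentially. n r \<ge> 2" "\<forall>\<^sub>F r in sequentially. m r \<ge> 2"
      using p_lim n_lim m_lim by (auto simp: filterlim_at_top)
    moreover have "\<forall>\<^sub>F r in sequentially. \<kappa> < real (n r) / real (n r + m r)"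
      by (rule order_tendstoD(1)[OF ratio_lim \<kappa>(3)])
    moreover have "\<forall>\<^sub>F r in sequentially. \<kappa> < real (m r) / real (N r)"
      by (rule order_tendstoD(1)[OF ratio2 \<kappa>(4)])
    ultimately show ?thesis
      using var_pos
    proof eventually_elim
      case (elim r)
      have "0 < real (N r)" using elim by (simp add: N_def)
      then show ?case
        using elim by (auto simp: ok_def V_def N_def[symmetric] pos_less_divide_eq)
    qed
  qed

  have bound: "cmod (char (distr (M (p r)) borel (Tr r)) u - exp (- (u\<^sup>2 / 2)))
      \<le> clt_error u (2 / \<kappa>\<^sup>2) \<epsilon> (N r) (243 * \<Lambda> r) (g r / (V r)\<^sup>2)"
    if ok: "ok r" and \<epsilon>: "0 < \<epsilon>" "\<epsilon> \<le> 1 / 2" for r u \<epsilon>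
  proof -
    have pr: "p r \<ge> 1" and N0: "0 < N r" using ok by (auto simp: ok_def N_def)
    interpret centred_kernel "L (p r)" "k (p r)" by (rule ck[OF pr])
    have "char (distr (M (p r)) borel (Tr r)) u = (\<integral>\<omega>. iexp (u * F r (W r \<omega>)) \<partial>M (p r))"
      unfolding char_def using T_meas[OF pr N0] by (subst integral_distr) (auto simp: TF)
    also have "\<dots> = (\<integral>w. iexp (u * F r w) \<partial>distr (M (p r)) (PiM {1..N r} (\<lambda>_. Rvec (p r))) (W r))"
      using F_meas[OF pr] by (intro integral_distr[symmetric] W_meas[OF pr N0]) measurable
    also have "\<dots> = (\<integral>w. iexp (u * T_stat (k (p r)) (a0 (p r)) (n r) (m r) w (\<lambda>j. w (n r + j))) \<partial>sample {1..n r + m r})"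
      unfolding W_distr[OF pr N0] by (simp add: F_def N_def)
    finally show ?thesis
      using T_stat_char_bound[of "n r" "m r" \<kappa> "a0 (p r)" \<tau> \<epsilon> u] ok \<kappa> tau \<epsilon> diag[OF pr]
      unfolding ok_def N_def V_def \<Lambda>_def g_def lyapunov_ratio_def LZL[OF pr] by (simp add: spL)
  qed

  have \<Lambda>_lim: "\<Lambda> \<longlonglongrightarrow> 0"
    using moment_cond unfolding \<Lambda>_def N_def .
  have \<gamma>_nonneg: "0 \<le> g r / (V r)\<^sup>2" if "ok r" for r
  proof -
    have pr: "p r \<ge> 1" using that by (simp add: ok_def)
    interpret centred_kernel "L (p r)" "k (p r)" by (rule ck[OF pr])
    have "0 < V2" using that by (simp add: ok_def V_def LZL[OF pr] k_var_eq)
    then have "g r = V2\<^sup>2 * H.G_sq_norm" unfolding g_def LZL[OF pr] by (rule g_mean_eq)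
    then show ?thesis using H.G_sq_norm_nonneg by simp
  qed
  have \<gamma>_lim: "(\<lambda>r. g r / (V r)\<^sup>2) \<longlonglongrightarrow> 0"
  proof -
    have "(\<lambda>r. (g r powr ((1 + \<tau>) / 2) / V r powr (1 + \<tau>)) powr (2 / (1 + \<tau>))) \<longlonglongrightarrow> 0"
    proof (rule tendsto_zero_powrI[OF _ tendsto_const])
      show "(\<lambda>r. g r powr ((1 + \<tau>) / 2) / V r powr (1 + \<tau>)) \<longlonglongrightarrow> 0"
        using g_cond unfolding g_def V_def .
    qed (use tau in auto)
    then show ?thesis
    proof (rule Lim_transform_eventually)
      show "\<forall>\<^sub>F r in sequentially. (g r powr ((1 + \<tau>) / 2) / V r powr (1 + \<tau>)) powr (2 / (1 + \<tau>)) = g r / (V r)\<^sup>2"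
        using ev_ok
      proof eventually_elim
        case (elim r)
        have V0: "0 < V r" using elim by (simp add: ok_def)
        have "0 \<le> g r" using \<gamma>_nonneg[OF elim] V0 by (simp add: zero_le_divide_iff)
        moreover have "(1 + \<tau>) / 2 * (2 / (1 + \<tau>)) = 1" "(1 + \<tau>) * (2 / (1 + \<tau>)) = 2"
          using tau by (simp_all add: divide_simps)
        ultimately show ?case using V0 by (simp only: powr_divide powr_powr powr_ge_zero) simp
      qed
    qed
  qed
  have N_lim: "filterlim (\<lambda>r. real (N r)) at_top sequentially"
    unfolding N_def
    by (rule filterlim_compose[OF filterlim_real_sequentially filterlim_at_top_mono[OF n_lim]]) auto
  have char_lim: "(\<lambda>r. char (distr (M (p r)) borel (Tr r)) u) \<longlonglongrightarrow> exp (- (u\<^sup>2 / 2))" for u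
  proof (rule tendstoI)
    fix e :: real assume e: "0 < e"
    \<comment> \<open>For fixed \<open>\<epsilon>\<close> the error bound tends to \<open>2 * \<epsilon> * u\<^sup>2 + 2 * \<bar>u\<bar> * \<epsilon>\<close>, so \<open>\<epsilon>\<close> is chosen first.\<close>
    define c where "c = 2 * u\<^sup>2 + 2 * \<bar>u\<bar> + 1"
    have c: "0 < c" by (simp add: c_def add_nonneg_pos)
    define \<epsilon> where "\<epsilon> = min (1 / 2) (e / (2 * c))"
    have \<epsilon>: "0 < \<epsilon>" "\<epsilon> \<le> 1 / 2" using e c by (auto simp: \<epsilon>_def)
    have "\<epsilon> * c \<le> e / (2 * c) * c" using c by (intro mult_right_mono) (auto simp: \<epsilon>_def)
    then have \<epsilon>c: "\<epsilon> * c < e" using e c by simp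
    have inv: "(\<lambda>r. 6 / (real (N r) - 3)) \<longlonglongrightarrow> 0"
    proof (rule tendsto_divide_0[OF tendsto_const])
      show "filterlim (\<lambda>r. real (N r) - 3) at_infinity sequentially"
        by (rule filterlim_at_top_imp_at_infinity)
           (use filterlim_tendsto_add_at_top[OF tendsto_const N_lim, of "-3"] in simp)
    qed
    have "(\<lambda>r. clt_error u (2 / \<kappa>\<^sup>2) \<epsilon> (N r) (243 * \<Lambda> r) (g r / (V r)\<^sup>2))
      \<longlonglongrightarrow> u\<^sup>2 * (2 / \<kappa>\<^sup>2)\<^sup>2 * (sqrt (243 * 0) + 243 * 0 + sqrt 0) + 2 * \<epsilon> * u\<^sup>2
         + 256 / \<epsilon>\<^sup>2 * (1 + u\<^sup>2)\<^sup>2 * (2 / \<kappa>\<^sup>2) ^ 4 * (243 * 0)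
         + (2 * \<bar>u\<bar> * \<epsilon> + 2 / \<epsilon> * (16 * (sqrt (243 * 0) + 243 * 0) + 0))"
      unfolding clt_error_def by (intro tendsto_intros \<Lambda>_lim \<gamma>_lim inv)
    moreover have "2 * \<epsilon> * u\<^sup>2 + 2 * \<bar>u\<bar> * \<epsilon> < e"
      using \<epsilon>c \<epsilon> by (simp add: c_def algebra_simps)
    ultimately have "\<forall>\<^sub>F r in sequentially. clt_error u (2 / \<kappa>\<^sup>2) \<epsilon> (N r) (243 * \<Lambda> r) (g r / (V r)\<^sup>2) < e"
      by (intro order_tendstoD(2)) auto
    then show "\<forall>\<^sub>F r in sequentially. dist (char (distr (M (p r)) borel (Tr r)) u) (complex_of_real (exp (- (u\<^sup>2 / 2)))) < e"
      using ev_ok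
    proof eventually_elim
      case (elim r)
      then show ?case using bound[OF elim(2) \<epsilon>, of u] by (simp add: dist_norm)
    qed
  qed

  \<comment> \<open>Only large indices matter, so the others may be given a law for which Levy's theorem applies.\<close>
  define D where "D r = (if ok r then distr (M (p r)) borel (Tr r) else std_normal_distribution)" for r
  have "weak_conv_m D std_normal_distribution"
  proof (rule levy_continuity)
    show "real_distribution (D r)" for r
    proof (cases "ok r")
      case True
      then have pr: "p r \<ge> 1" and N0: "0 < N r" by (auto simp: ok_def N_def)
      interpret prob_space "M (p r)" by (rule prob[OF pr])
      show ?thesis using True T_meas[OF pr N0] by (simp add: D_def real_distribution_distr)
    qed (simp add: D_def real_dist_normal_dist)
    show "(\<lambda>r. char (D r) u) \<longlonglongrightarrow> char std_normal_distribution u" for u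
      unfolding char_std_normal_distribution
    proof (rule Lim_transform_eventually)
      show "(\<lambda>r. char (distr (M (p r)) borel (Tr r)) u) \<longlonglongrightarrow> complex_of_real (exp (- (u\<^sup>2) / 2))"
        using char_lim[of u] by simp
      show "\<forall>\<^sub>F r in sequentially. char (distr (M (p r)) borel (Tr r)) u = char (D r) u"
        using ev_ok by eventually_elim (simp add: D_def)
    qed
  qed (rule real_dist_normal_dist)
  then have D_lim: "(\<lambda>r. cdf (D r) x) \<longlonglongrightarrow> cdf std_normal_distribution x" if "isCont (cdf std_normal_distribution) x" for x
    using that by (simp add: weak_conv_m_def weak_conv_def)
  have "(\<lambda>r. cdf (distr (M (p r)) borel (Tr r)) x) \<longlonglongrightarrow> cdf std_normal_distribution x"
    if "isCont (cdf std_normal_distribution) x" for x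
    using D_lim[OF that]
  proof (rule Lim_transform_eventually)
    show "\<forall>\<^sub>F r in sequentially. cdf (D r) x = cdf (distr (M (p r)) borel (Tr r)) x"
      using ev_ok by eventually_elim (simp add: D_def)
  qed
  then show ?thesis
    unfolding weak_conv_m_def weak_conv_def Tr_def by blast
qed

end
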